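(* Let $g$ be a complete negative-definite pseudo-Riemannian metric (i.e., $-g$ is a Riemannian metric) on a closed connected $n$-dimensional manifold $M^n$. Then the cone $(\hat M, \hat g)$ over $(M^n,g)$ is not decomposable.
   Context: All objects are smooth. A closed manifold is a compact manifold without boundary. The cone over $(M^n,g)$ is the pseudo-Riemannian manifold $(\hat M^{n+1},\hat g)$ with $\hat M=\mathbb{R}_{>0}\times M$ and $\hat g=(dx_0)^2+x_0^2\cdot\left(\sum_{i,j=1}^n g_{ij}(x_1,\dots,x_n)\,dx_i\,dx_j\right)$, where $x_0$ is the standard coordinate on $\mathbb{R}_{>0}$ and $x_1,\dots,x_n$ are local coordinates on $M^n$. The cone is decomposable if for a point $p\in\hat M$ there exists a proper (nonzero and not the whole space) nondegenerate subspace $U\subset T_p\hat M$ (i.e., $\hat g|_U$ is nondegenerate) that is invariant with respect to the holonomy group of $(\hat M,\hat g)$ at $p$. *)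

theory Defs
  imports "HOL-Analysis.Analysis"
begin

section \<open>Smooth maps\<close>

text \<open>Only meaningful for open \<open>S\<close>: iterated directional derivatives exist and are continuous.\<close>

fun Ck_on :: "nat \<Rightarrow> 'a::real_normed_vector set \<Rightarrow> ('a \<Rightarrow> 'b::real_normed_vector) \<Rightarrow> bool" where
  "Ck_on 0 S f \<longleftrightarrow> continuous_on S f"
| "Ck_on (Suc k) S f \<longleftrightarrow> (\<forall>x\<in>S. f differentiable at x) \<and>
     (\<forall>v. Ck_on k S (\<lambda>x. frechet_derivative f (at x) v))"

definition smooth_on :: "'a::real_normed_vector set \<Rightarrow> ('a \<Rightarrow> 'b::real_normed_vector) \<Rightarrow> bool" where
  "smooth_on S f \<longleftrightarrow> (\<forall>k. Ck_on k S f)"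


section \<open>Smooth manifolds\<close>

text \<open>
  A manifold is a topology together with an indexed atlas modelled on \<open>'e\<close>; its dimension is
  \<open>DIM('e)\<close>. Indexing the charts lets the cone over \<open>M\<close> have the same index set as \<open>M\<close>.
\<close>

record ('a, 'i, 'e) manifold =
  mtop :: "'a topology"
  charts :: "'i set"
  cdom :: "'i \<Rightarrow> 'a set"
  coord :: "'i \<Rightarrow> 'a \<Rightarrow> 'e"

definition cran :: "('a, 'i, 'e) manifold \<Rightarrow> 'i \<Rightarrow> 'e set" where
  "cran M i = coord M i ` cdom M i"

definition transition :: "('a, 'i, 'e) manifold \<Rightarrow> 'i \<Rightarrow> 'i \<Rightarrow> 'e \<Rightarrow> 'e" where
  "transition M i j = (\<lambda>x. coord M j (inv_into (cdom M i) (coord M i) x))"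

definition smooth_manifold :: "('a, 'i, 'e::euclidean_space) manifold \<Rightarrow> bool" where
  "smooth_manifold M \<longleftrightarrow>
     Hausdorff_space (mtop M) \<and> second_countable (mtop M) \<and>
     (\<Union>i\<in>charts M. cdom M i) = topspace (mtop M) \<and>
     (\<forall>i\<in>charts M. openin (mtop M) (cdom M i) \<and> open (cran M i) \<and>
        homeomorphic_map (subtopology (mtop M) (cdom M i)) (top_of_set (cran M i)) (coord M i)) \<and>
     (\<forall>i\<in>charts M. \<forall>j\<in>charts M.
        smooth_on (coord M i ` (cdom M i \<inter> cdom M j)) (transition M i j))"

definition closed_manifold :: "('a, 'i, 'e::euclidean_space) manifold \<Rightarrow> bool" where
  "closed_manifold M \<longleftrightarrow> smooth_manifold M \<and> compact_space (mtop M)"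


section \<open>Tangent vectors\<close>

text \<open>
  A tangent vector at \<open>p\<close> is the family of its component vectors in all charts around \<open>p\<close>,
  related by the differentials of the transition maps, with the value \<open>0\<close> at all other indices.
\<close>

type_synonym ('i, 'e) tangent = "'i \<Rightarrow> 'e"

definition tangent_space ::
    "('a, 'i, 'e::euclidean_space) manifold \<Rightarrow> 'a \<Rightarrow> ('i, 'e) tangent set" where
  "tangent_space M p = {v.
     (\<forall>i. \<not> (i \<in> charts M \<and> p \<in> cdom M i) \<longrightarrow> v i = 0) \<and>
     (\<forall>i\<in>charts M. \<forall>j\<in>charts M. p \<in> cdom M i \<inter> cdom M j \<longrightarrow>
        v j = frechet_derivative (transition M i j) (at (coord M i p)) (v i))}"

definition linear_subspace_of ::
    "('i, 'e::euclidean_space) tangent set \<Rightarrow> ('i, 'e) tangent set \<Rightarrow> bool" where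
  "linear_subspace_of U T \<longleftrightarrow> U \<subseteq> T \<and> (\<lambda>_. 0) \<in> U \<and>
     (\<forall>u\<in>U. \<forall>v\<in>U. (\<lambda>i. u i + v i) \<in> U) \<and>
     (\<forall>a. \<forall>u\<in>U. (\<lambda>i. a *\<^sub>R u i) \<in> U)"


section \<open>Pseudo-Riemannian metrics\<close>

text \<open>
  \<open>g i x\<close> is the bilinear form representing the metric in the chart \<open>i\<close> at the point with
  coordinates \<open>x\<close>.
\<close>

type_synonym ('i, 'e) metric = "'i \<Rightarrow> 'e \<Rightarrow> 'e \<Rightarrow> 'e \<Rightarrow> real"

definition pseudo_riemannian_metric ::
    "('a, 'i, 'e::euclidean_space) manifold \<Rightarrow> ('i, 'e) metric \<Rightarrow> bool" where
  "pseudo_riemannian_metric M g \<longleftrightarrow>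
     (\<forall>i\<in>charts M. \<forall>x\<in>cran M i.
        bilinear (g i x) \<and> (\<forall>u v. g i x u v = g i x v u) \<and>
        (\<forall>u. (\<forall>v. g i x u v = 0) \<longrightarrow> u = 0)) \<and>
     (\<forall>i\<in>charts M. \<forall>u v. smooth_on (cran M i) (\<lambda>x. g i x u v)) \<and>
     (\<forall>i\<in>charts M. \<forall>j\<in>charts M. \<forall>p\<in>cdom M i \<inter> cdom M j. \<forall>u v.
        g i (coord M i p) u v =
        g j (coord M j p)
          (frechet_derivative (transition M i j) (at (coord M i p)) u)
          (frechet_derivative (transition M i j) (at (coord M i p)) v))"

definition riemannian_metric ::
    "('a, 'i, 'e::euclidean_space) manifold \<Rightarrow> ('i, 'e) metric \<Rightarrow> bool" where
  "riemannian_metric M g \<longleftrightarrow> pseudo_riemannian_metric M g \<and>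
     (\<forall>i\<in>charts M. \<forall>x\<in>cran M i. \<forall>u. u \<noteq> 0 \<longrightarrow> g i x u u > 0)"

definition negative_definite_metric ::
    "('a, 'i, 'e::euclidean_space) manifold \<Rightarrow> ('i, 'e) metric \<Rightarrow> bool" where
  "negative_definite_metric M g \<longleftrightarrow> pseudo_riemannian_metric M g \<and>
     riemannian_metric M (\<lambda>i x u v. - g i x u v)"

text \<open>The value does not depend on the chart picked, by the transformation law of \<open>g\<close>.\<close>

definition metric_at ::
    "('a, 'i, 'e::euclidean_space) manifold \<Rightarrow> ('i, 'e) metric \<Rightarrow> 'a \<Rightarrow>
     ('i, 'e) tangent \<Rightarrow> ('i, 'e) tangent \<Rightarrow> real" where
  "metric_at M g p v w =
     (let i = (SOME i. i \<in> charts M \<and> p \<in> cdom M i) in g i (coord M i p) (v i) (w i))"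

definition nondegenerate_on ::
    "('a, 'i, 'e::euclidean_space) manifold \<Rightarrow> ('i, 'e) metric \<Rightarrow> 'a \<Rightarrow>
     ('i, 'e) tangent set \<Rightarrow> bool" where
  "nondegenerate_on M g p U \<longleftrightarrow>
     (\<forall>u\<in>U. (\<forall>w\<in>U. metric_at M g p u w = 0) \<longrightarrow> u = (\<lambda>_. 0))"


section \<open>Levi-Civita connection\<close>

text \<open>
  In the chart \<open>i\<close>, \<open>christoffel g i x u v\<close> is the vector with components
  \<open>\<Gamma>\<^sup>k\<^sub>a\<^sub>b u\<^sup>a v\<^sup>b\<close>; raising the index with \<open>g\<close> is expressed by the
  description operator, which is well defined as \<open>g i x\<close> is nondegenerate.
\<close>

definition christoffel_first_kind ::
    "('i, 'e::euclidean_space) metric \<Rightarrow> 'i \<Rightarrow> 'e \<Rightarrow> 'e \<Rightarrow> 'e \<Rightarrow> 'e \<Rightarrow> real" where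
  "christoffel_first_kind g i x u v z =
     (frechet_derivative (\<lambda>y. g i y v z) (at x) u
      + frechet_derivative (\<lambda>y. g i y u z) (at x) v
      - frechet_derivative (\<lambda>y. g i y u v) (at x) z) / 2"

definition christoffel ::
    "('i, 'e::euclidean_space) metric \<Rightarrow> 'i \<Rightarrow> 'e \<Rightarrow> 'e \<Rightarrow> 'e \<Rightarrow> 'e" where
  "christoffel g i x u v = (THE w. \<forall>z. g i x w z = christoffel_first_kind g i x u v z)"


section \<open>Curves, parallel transport, geodesics\<close>

text \<open>Here \<open>J\<close> is an open set of parameters.\<close>

definition smooth_curve_on ::
    "('a, 'i, 'e::euclidean_space) manifold \<Rightarrow> real set \<Rightarrow> (real \<Rightarrow> 'a) \<Rightarrow> bool" where
  "smooth_curve_on M J c \<longleftrightarrow> continuous_map (top_of_set J) (mtop M) c \<and>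
     (\<forall>i\<in>charts M. smooth_on {t \<in> J. c t \<in> cdom M i} (\<lambda>t. coord M i (c t)))"

text \<open>Smooth on the closed interval, one-sidedly at its end points.\<close>

definition smooth_arc ::
    "('a, 'i, 'e::euclidean_space) manifold \<Rightarrow> real \<Rightarrow> real \<Rightarrow> (real \<Rightarrow> 'a) \<Rightarrow> bool" where
  "smooth_arc M a b c \<longleftrightarrow>
     (\<exists>J c'. open J \<and> {a..b} \<subseteq> J \<and> smooth_curve_on M J c' \<and> (\<forall>t\<in>{a..b}. c' t = c t))"

definition piecewise_smooth_path ::
    "('a, 'i, 'e::euclidean_space) manifold \<Rightarrow> (real \<Rightarrow> 'a) \<Rightarrow> bool" where
  "piecewise_smooth_path M c \<longleftrightarrow> pathin (mtop M) c \<and>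
     (\<exists>S. finite S \<and>
        (\<forall>a b. 0 \<le> a \<and> a < b \<and> b \<le> 1 \<and> {a<..<b} \<inter> S = {} \<longrightarrow> smooth_arc M a b c))"

definition velocity ::
    "('a, 'i, 'e::euclidean_space) manifold \<Rightarrow> (real \<Rightarrow> 'a) \<Rightarrow> real \<Rightarrow> ('i, 'e) tangent" where
  "velocity M c t = (\<lambda>i. if i \<in> charts M \<and> c t \<in> cdom M i
     then vector_derivative (\<lambda>s. coord M i (c s)) (at t) else 0)"

text \<open>The covariant derivative of the vector field \<open>V\<close> along \<open>c\<close> exists and vanishes at \<open>t\<close>.\<close>

definition cov_deriv_zero ::
    "('a, 'i, 'e::euclidean_space) manifold \<Rightarrow> ('i, 'e) metric \<Rightarrow> (real \<Rightarrow> 'a) \<Rightarrow>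
     (real \<Rightarrow> ('i, 'e) tangent) \<Rightarrow> real \<Rightarrow> bool" where
  "cov_deriv_zero M g c V t \<longleftrightarrow>
     (\<forall>i\<in>charts M. c t \<in> cdom M i \<longrightarrow>
        ((\<lambda>s. V s i) has_vector_derivative
           - christoffel g i (coord M i (c t)) (velocity M c t i) (V t i)) (at t))"

definition parallel_along ::
    "('a, 'i, 'e::euclidean_space) manifold \<Rightarrow> ('i, 'e) metric \<Rightarrow> (real \<Rightarrow> 'a) \<Rightarrow>
     (real \<Rightarrow> ('i, 'e) tangent) \<Rightarrow> bool" where
  "parallel_along M g c V \<longleftrightarrow>
     (\<forall>t\<in>{0..1}. V t \<in> tangent_space M (c t)) \<and>
     (\<forall>i\<in>charts M. continuous_on {t \<in> {0..1}. c t \<in> cdom M i} (\<lambda>t. V t i)) \<and>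
     (\<exists>S. finite S \<and> (\<forall>t\<in>{0<..<1} - S. cov_deriv_zero M g c V t))"

text \<open>
  The elements are the parallel transports along piecewise smooth loops at \<open>p\<close>, as maps on
  the tangent space at \<open>p\<close> (\<open>undefined\<close> elsewhere). Loops need not be contractible: this is the
  full, not the restricted, holonomy group.
\<close>

definition holonomy_group ::
    "('a, 'i, 'e::euclidean_space) manifold \<Rightarrow> ('i, 'e) metric \<Rightarrow> 'a \<Rightarrow>
     (('i, 'e) tangent \<Rightarrow> ('i, 'e) tangent) set" where
  "holonomy_group M g p = {\<tau> \<in> extensional (tangent_space M p).
     \<exists>c. piecewise_smooth_path M c \<and> c 0 = p \<and> c 1 = p \<and>
       (\<forall>v\<in>tangent_space M p. \<exists>V. parallel_along M g c V \<and> V 0 = v \<and> V 1 = \<tau> v)}"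

definition complete_geodesic ::
    "('a, 'i, 'e::euclidean_space) manifold \<Rightarrow> ('i, 'e) metric \<Rightarrow> (real \<Rightarrow> 'a) \<Rightarrow> bool" where
  "complete_geodesic M g c \<longleftrightarrow> smooth_curve_on M UNIV c \<and>
     (\<forall>t. cov_deriv_zero M g c (velocity M c) t)"

definition complete_metric ::
    "('a, 'i, 'e::euclidean_space) manifold \<Rightarrow> ('i, 'e) metric \<Rightarrow> bool" where
  "complete_metric M g \<longleftrightarrow>
     (\<forall>p\<in>topspace (mtop M). \<forall>v\<in>tangent_space M p.
        \<exists>c. complete_geodesic M g c \<and> c 0 = p \<and> velocity M c 0 = v)"


section \<open>Decomposability and the cone\<close>

definition decomposable ::
    "('a, 'i, 'e::euclidean_space) manifold \<Rightarrow> ('i, 'e) metric \<Rightarrow> bool" where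
  "decomposable M g \<longleftrightarrow>
     (\<exists>p\<in>topspace (mtop M). \<exists>U.
        linear_subspace_of U (tangent_space M p) \<and>
        U \<noteq> {\<lambda>_. 0} \<and> U \<noteq> tangent_space M p \<and>
        nondegenerate_on M g p U \<and>
        (\<forall>\<tau>\<in>holonomy_group M g p. \<tau> ` U \<subseteq> U))"

definition cone_manifold ::
    "('a, 'i, 'e::euclidean_space) manifold \<Rightarrow> (real \<times> 'a, 'i, real \<times> 'e) manifold" where
  "cone_manifold M = \<lparr>
     mtop = prod_topology (top_of_set {0<..}) (mtop M),
     charts = charts M,
     cdom = (\<lambda>i. {0<..} \<times> cdom M i),
     coord = (\<lambda>i (r, q). (r, coord M i q)) \<rparr>"

text \<open>\<open>(dx\<^sub>0)\<^sup>2 + x\<^sub>0\<^sup>2 g\<close>, evaluated on \<open>(a, u)\<close> and \<open>(b, v)\<close>.\<close>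

definition cone_metric :: "('i, 'e::euclidean_space) metric \<Rightarrow> ('i, real \<times> 'e) metric" where
  "cone_metric g = (\<lambda>i (r, x) (a, u) (b, v). a * b + r\<^sup>2 * g i x u v)"

end

theory Submission
  imports Defs
begin

text \<open>
  Write \<open>\<langle>_, _\<rangle>\<close> for the cone metric. It is Lorentzian: the radial direction \<open>\<partial>\<^sub>0\<close> is positive and
  its orthogonal complement, the tangent space of \<open>M\<close>, is negative definite. Suppose that \<open>U\<close> is a
  proper nondegenerate subspace of the tangent space at \<open>(r, q)\<close>, invariant under holonomy. Its
  orthogonal complement is nonzero, since \<open>U\<close> is proper, and invariant, since parallel
  transport preserves the metric. If \<open>U\<close> is not negative definite, then nondegeneracy provides a vector of
  \<open>U\<close> of positive square, and by the reverse Cauchy--Schwarz inequality the complement is negative definite.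
  So there is always a nonzero, invariant, negative definite subspace \<open>W\<close>. It remains to show that
  such a \<open>W\<close> is \<open>0\<close> (\<open>negative_definite_invariant_subspace_trivial\<close>).

  Take \<open>w\<close> in \<open>W\<close> and a geodesic \<open>c\<close> of \<open>M\<close> from \<open>q\<close>, defined for all times by completeness,
  with \<open>g c' c' = - \<mu>\<^sup>2\<close>. Along the curve \<open>(r, c t)\<close> of the cone both null fields
  \<open>exp (\<plusminus> \<mu> t) (\<partial>\<^sub>0 \<mp> c' / (r \<mu>))\<close> are parallel, and \<open>\<partial>\<^sub>0\<close> is their combination with the coefficients
  \<open>exp (\<mp> \<mu> t) / 2\<close>. If \<open>w\<^sub>t\<close> is the parallel transport of \<open>w\<close> along this curve, then
  \<open>2 \<langle>w\<^sub>t, \<partial>\<^sub>0\<rangle> = exp (- \<mu> t) \<langle>w, n\<^sub>+\<rangle> + exp (\<mu> t) \<langle>w, n\<^sub>-\<rangle>\<close>, where \<open>n\<^sub>+\<close> and \<open>n\<^sub>-\<close> are the null vectors at time \<open>0\<close>.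

  The left-hand side stays bounded because \<open>M\<close> is compact
  (\<open>bounded_pairing_in_coordinate_ball\<close>, \<open>radial_pairing_bounded\<close>): whenever the curve visits a fixed coordinate ball,
  a short segment to the centre of the ball followed by one fixed curve back to \<open>(r, q)\<close> closes it up to a loop.
  The loop carries \<open>w\<close> to a vector of \<open>W\<close> of the same square as \<open>w\<close>; such vectors form a bounded
  set as \<open>W\<close> is definite. The same short segment and fixed curve carry \<open>\<partial>\<^sub>0\<close> to a vector that stays bounded as well, and
  transport preserves the product of the two. Finitely many such balls suffice.

  A bounded combination of \<open>exp (- \<mu> t)\<close> and \<open>exp (\<mu> t)\<close> over all real \<open>t\<close> vanishes, so \<open>w\<close> is
  orthogonal to \<open>n\<^sub>+\<close> and \<open>n\<^sub>-\<close>. As the geodesic starts in an arbitrary direction, these vectors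
  span the tangent space of the cone and \<open>w = 0\<close>.

  The argument rests on the existence of parallel transport and on its isometry, which are developed for an
  arbitrary pseudo-Riemannian manifold and then applied to the cone. Isometry also gives the bounds on transport along
  the fixed curve: the components of a transported vector are its products with transported basis vectors.
\<close>

section \<open>Calculus in Euclidean space\<close>

text \<open>
  Two applications of the mean value theorem, in the two possible orders, show that the same second
  difference quotient of \<open>f\<close> is a value of either mixed derivative at a nearby point; then continuity applies.
\<close>

lemma mixed_second_derivative_symmetric_real:
  fixes f :: "'a::real_normed_vector \<Rightarrow> real"
  assumes "open S" "x \<in> S"
    and f': "\<And>y v. y \<in> S \<Longrightarrow> (f has_derivative f' y) (at y)"
    and f'': "\<And>y v. y \<in> S \<Longrightarrow> ((\<lambda>z. f' z v) has_derivative f'' v y) (at y)"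
    and cont: "\<And>u v. continuous_on S (\<lambda>y. f'' v y u)"
  shows "f'' v x u = f'' u x v"
proof -
  obtain e where e: "e > 0" "ball x e \<subseteq> S" using assms openE by blast
  \<comment> \<open>small enough for all parallelograms with sides at most \<open>d u\<close> and \<open>d v\<close> to stay in the ball\<close>
  define d where "d = e / (2 * (norm u + norm v + 1))"
  have dpos: "d > 0" using e by (simp add: d_def add_nonneg_pos)
  have inS: "x + s *\<^sub>R u + t *\<^sub>R v \<in> S" if "\<bar>s\<bar> \<le> d" "\<bar>t\<bar> \<le> d" for s t
  proof -
    have "norm (s *\<^sub>R u + t *\<^sub>R v) \<le> \<bar>s\<bar> * norm u + \<bar>t\<bar> * norm v"
      by (metis norm_scaleR norm_triangle_ineq)
    also have "\<dots> \<le> d * norm u + d * norm v"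
      using that by (intro add_mono mult_right_mono) auto
    also have "\<dots> < d * (2 * (norm u + norm v + 1))"
    proof -
      have "0 \<le> d * norm u" "0 \<le> d * norm v" using dpos by auto
      moreover have "d * (2 * (norm u + norm v + 1)) = 2 * (d * norm u) + 2 * (d * norm v) + 2 * d"
        by (simp add: algebra_simps)
      ultimately show ?thesis using dpos by linarith
    qed
    also have "\<dots> = e" using add_nonneg_pos[of "norm u + norm v" 1] by (simp add: d_def)
    finally have "x + (s *\<^sub>R u + t *\<^sub>R v) \<in> ball x e" by (simp add: dist_norm del: minus_add_distrib)
    then show ?thesis using e by (auto simp: add.assoc)
  qed
  have key: "\<exists>s t. 0 < s \<and> s < h \<and> 0 < t \<and> t < h \<and>
      f (x + h *\<^sub>R u + h *\<^sub>R v) - f (x + h *\<^sub>R u) - f (x + h *\<^sub>R v) + f x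
        = h * (h * f'' u (x + s *\<^sub>R u + t *\<^sub>R v) v)"
    if h: "0 < h" "h \<le> d"
      and inS: "\<And>s t. \<bar>s\<bar> \<le> d \<Longrightarrow> \<bar>t\<bar> \<le> d \<Longrightarrow> x + s *\<^sub>R u + t *\<^sub>R v \<in> S" for h u v
  proof -
    define G where "G s = f (x + s *\<^sub>R u + h *\<^sub>R v) - f (x + s *\<^sub>R u + 0 *\<^sub>R v)" for s
    have dG: "(G has_real_derivative f' (x + s *\<^sub>R u + h *\<^sub>R v) u - f' (x + s *\<^sub>R u + 0 *\<^sub>R v) u) (at s)"
      if "0 \<le> s" "s \<le> h" for s
    proof -
      have "((\<lambda>s. f (x + s *\<^sub>R u + c *\<^sub>R v)) has_real_derivative f' (x + s *\<^sub>R u + c *\<^sub>R v) u) (at s)"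
        if "0 \<le> c" "c \<le> h" for c
      proof -
        have *: "((\<lambda>s. f (x + s *\<^sub>R u + c *\<^sub>R v)) has_derivative
            (\<lambda>r. f' (x + s *\<^sub>R u + c *\<^sub>R v) (r *\<^sub>R u))) (at s)"
          by (rule has_derivative_compose[of "\<lambda>s. x + s *\<^sub>R u + c *\<^sub>R v" "\<lambda>r. r *\<^sub>R u" s UNIV f])
            (use f' inS[of s c] \<open>0 \<le> s\<close> \<open>s \<le> h\<close> that h in \<open>auto intro!: derivative_eq_intros\<close>)
        have "linear (f' (x + s *\<^sub>R u + c *\<^sub>R v))"
          using f'[OF inS[of s c]] \<open>0 \<le> s\<close> \<open>s \<le> h\<close> that h by (auto dest: has_derivative_linear)
        then have "(\<lambda>r. f' (x + s *\<^sub>R u + c *\<^sub>R v) (r *\<^sub>R u)) = (*) (f' (x + s *\<^sub>R u + c *\<^sub>R v) u)"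
          by (auto simp: fun_eq_iff linear_cmul)
        then show ?thesis using * by (simp add: has_field_derivative_def)
      qed
      from this[of h] this[of 0] h show ?thesis unfolding G_def by (auto intro!: derivative_intros)
    qed
    obtain s where s: "0 < s" "s < h" "G h - G 0 = h * (f' (x + s *\<^sub>R u + h *\<^sub>R v) u - f' (x + s *\<^sub>R u + 0 *\<^sub>R v) u)"
      using MVT2[of 0 h G "\<lambda>s. f' (x + s *\<^sub>R u + h *\<^sub>R v) u - f' (x + s *\<^sub>R u + 0 *\<^sub>R v) u"] dG h by auto
    define H where "H t = f' (x + s *\<^sub>R u + t *\<^sub>R v) u" for t
    have dH: "(H has_real_derivative f'' u (x + s *\<^sub>R u + t *\<^sub>R v) v) (at t)" if "0 \<le> t" "t \<le> h" for t
    proof -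
      have *: "((\<lambda>t. f' (x + s *\<^sub>R u + t *\<^sub>R v) u) has_derivative
            (\<lambda>r. f'' u (x + s *\<^sub>R u + t *\<^sub>R v) (r *\<^sub>R v))) (at t)"
        by (rule has_derivative_compose[of "\<lambda>t. x + s *\<^sub>R u + t *\<^sub>R v" "\<lambda>r. r *\<^sub>R v" t UNIV "\<lambda>z. f' z u"])
          (use f'' inS[of s t] s that h in \<open>auto intro!: derivative_eq_intros\<close>)
      have "linear (f'' u (x + s *\<^sub>R u + t *\<^sub>R v))"
        using f''[OF inS[of s t]] s that h by (auto dest: has_derivative_linear)
      then have "(\<lambda>r. f'' u (x + s *\<^sub>R u + t *\<^sub>R v) (r *\<^sub>R v)) = (*) (f'' u (x + s *\<^sub>R u + t *\<^sub>R v) v)"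
        by (auto simp: fun_eq_iff linear_cmul)
      then show ?thesis using * unfolding H_def by (simp add: has_field_derivative_def)
    qed
    obtain t where t: "0 < t" "t < h" "H h - H 0 = h * (f'' u (x + s *\<^sub>R u + t *\<^sub>R v) v)"
      using MVT2[of 0 h H "\<lambda>t. f'' u (x + s *\<^sub>R u + t *\<^sub>R v) v"] dH h by auto
    have "f (x + h *\<^sub>R u + h *\<^sub>R v) - f (x + h *\<^sub>R u) - f (x + h *\<^sub>R v) + f x = G h - G 0"
      by (simp add: G_def)
    also have "\<dots> = h * (h * f'' u (x + s *\<^sub>R u + t *\<^sub>R v) v)"
      using s(3) t(3) by (simp add: H_def)
    finally show ?thesis using s t by blast
  qed
  define h where "h n = d / real (Suc n)" for n
  have h: "0 < h n" "h n \<le> d" for n using dpos by (auto simp: h_def divide_le_eq mult_le_cancel_left1)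
  have h0: "h \<longlonglongrightarrow> 0" unfolding h_def by (rule LIMSEQ_Suc, rule lim_const_over_n)
  have "\<exists>s t. 0 < s \<and> s < h n \<and> 0 < t \<and> t < h n \<and>
      f (x + h n *\<^sub>R u + h n *\<^sub>R v) - f (x + h n *\<^sub>R u) - f (x + h n *\<^sub>R v) + f x
        = h n * (h n * f'' u (x + s *\<^sub>R u + t *\<^sub>R v) v)" for n
    by (rule key) (use h inS in auto)
  then obtain s t where st: "\<And>n. 0 < s n \<and> s n < h n \<and> 0 < t n \<and> t n < h n \<and>
      f (x + h n *\<^sub>R u + h n *\<^sub>R v) - f (x + h n *\<^sub>R u) - f (x + h n *\<^sub>R v) + f x
        = h n * (h n * f'' u (x + s n *\<^sub>R u + t n *\<^sub>R v) v)" by metis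
  have "\<exists>s t. 0 < s \<and> s < h n \<and> 0 < t \<and> t < h n \<and>
      f (x + h n *\<^sub>R v + h n *\<^sub>R u) - f (x + h n *\<^sub>R v) - f (x + h n *\<^sub>R u) + f x
        = h n * (h n * f'' v (x + s *\<^sub>R v + t *\<^sub>R u) u)" for n
    by (rule key) (use h inS in \<open>auto simp: add.assoc add.commute\<close>, metis add.assoc add.commute)
  then obtain s' t' where st': "\<And>n. 0 < s' n \<and> s' n < h n \<and> 0 < t' n \<and> t' n < h n \<and>
      f (x + h n *\<^sub>R v + h n *\<^sub>R u) - f (x + h n *\<^sub>R v) - f (x + h n *\<^sub>R u) + f x
        = h n * (h n * f'' v (x + s' n *\<^sub>R v + t' n *\<^sub>R u) u)" by metis
  have sq: "s \<longlonglongrightarrow> 0" "t \<longlonglongrightarrow> 0" "s' \<longlonglongrightarrow> 0" "t' \<longlonglongrightarrow> 0"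
    using st st' by (auto intro!: tendsto_sandwich[OF _ _ tendsto_const h0] always_eventually less_imp_le)
  have isC: "isCont (\<lambda>y. f'' v y u) x" for u v
    using cont assms by (auto simp: continuous_on_eq_continuous_at)
  have l1: "(\<lambda>n. f'' u (x + s n *\<^sub>R u + t n *\<^sub>R v) v) \<longlonglongrightarrow> f'' u x v"
    by (rule isCont_tendsto_compose[OF isC]) (auto intro!: tendsto_eq_intros sq)
  have l2: "(\<lambda>n. f'' v (x + s' n *\<^sub>R v + t' n *\<^sub>R u) u) \<longlonglongrightarrow> f'' v x u"
    by (rule isCont_tendsto_compose[OF isC]) (auto intro!: tendsto_eq_intros sq)
  have eq: "f'' u (x + s n *\<^sub>R u + t n *\<^sub>R v) v = f'' v (x + s' n *\<^sub>R v + t' n *\<^sub>R u) u" for n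
  proof -
    have "h n * (h n * f'' u (x + s n *\<^sub>R u + t n *\<^sub>R v) v) = h n * (h n * f'' v (x + s' n *\<^sub>R v + t' n *\<^sub>R u) u)"
      using st[of n] st'[of n] by (simp add: algebra_simps)
    then show ?thesis using h[of n] by simp
  qed
  show ?thesis using LIMSEQ_unique[OF l2] l1 eq by simp
qed

lemma mixed_second_derivative_symmetric:
  fixes f :: "'a::real_normed_vector \<Rightarrow> 'b::euclidean_space"
  assumes "open S" "x \<in> S"
    and f': "\<And>y. y \<in> S \<Longrightarrow> (f has_derivative f' y) (at y)"
    and f'': "\<And>y v. y \<in> S \<Longrightarrow> ((\<lambda>z. f' z v) has_derivative f'' v y) (at y)"
    and cont: "\<And>u v. continuous_on S (\<lambda>y. f'' v y u)"
  shows "f'' v x u = f'' u x v"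
proof (rule euclidean_eqI)
  fix b :: 'b
  show "f'' v x u \<bullet> b = f'' u x v \<bullet> b"
    by (rule mixed_second_derivative_symmetric_real[of S x "\<lambda>y. f y \<bullet> b" "\<lambda>y v. f' y v \<bullet> b" "\<lambda>v y u. f'' v y u \<bullet> b"])
      (use assms in \<open>auto intro!: derivative_intros continuous_intros\<close>)
qed

lemma euclidean_linear_expand:
  fixes L :: "'e::euclidean_space \<Rightarrow> 'h::real_vector"
  assumes "linear L"
  shows "L v = (\<Sum>b\<in>Basis. (v \<bullet> b) *\<^sub>R L b)"
proof -
  have "L v = L (\<Sum>b\<in>Basis. (v \<bullet> b) *\<^sub>R b)" by (simp add: euclidean_representation)
  also have "\<dots> = (\<Sum>b\<in>Basis. (v \<bullet> b) *\<^sub>R L b)"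
    using assms by (simp add: linear_sum linear_cmul)
  finally show ?thesis .
qed

text \<open>
  Metrics and differentials of transition maps depend linearly on vectors and smoothly on points. Along a curve it
  therefore suffices to differentiate \<open>L s v\<close> for fixed \<open>v\<close>: expanding \<open>V s\<close> in a basis gives a finite sum
  of products.
\<close>

lemma linear_path_derivative:
  fixes L :: "real \<Rightarrow> 'e::euclidean_space \<Rightarrow> 'h::real_normed_vector"
  assumes lin: "\<forall>\<^sub>F s in nhds t. linear (L s)"
    and dL: "\<And>v. ((\<lambda>s. L s v) has_vector_derivative L' v) (at t)"
    and V: "(V has_vector_derivative V') (at t)"
  shows "((\<lambda>s. L s (V s)) has_vector_derivative L' (V t) + L t V') (at t)"
proof -
  have ev: "\<forall>\<^sub>F s in at t. linear (L s)" using lin by (simp add: eventually_nhds_conv_at)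
  have lint: "linear (L t)" using lin by (rule eventually_nhds_x_imp_x)
  have linL': "linear L'"
  proof (rule linearI)
    fix x y
    have "((\<lambda>s. L s x + L s y) has_vector_derivative L' x + L' y) (at t)"
      by (intro derivative_intros dL)
    then have "((\<lambda>s. L s (x + y)) has_vector_derivative L' x + L' y) (at t)"
      unfolding has_vector_derivative_def
      by (rule has_derivative_transform_eventually)
        (use ev lint in \<open>auto elim!: eventually_mono simp: linear_add\<close>)
    then show "L' (x + y) = L' x + L' y" using dL vector_derivative_unique_at by blast
  next
    fix c x
    have "((\<lambda>s. c *\<^sub>R L s x) has_vector_derivative c *\<^sub>R L' x) (at t)"
      by (rule bounded_linear.has_vector_derivative[OF bounded_linear_scaleR_right dL])
    then have "((\<lambda>s. L s (c *\<^sub>R x)) has_vector_derivative c *\<^sub>R L' x) (at t)"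
      unfolding has_vector_derivative_def
      by (rule has_derivative_transform_eventually)
        (use ev lint in \<open>auto elim!: eventually_mono simp: linear_cmul\<close>)
    then show "L' (c *\<^sub>R x) = c *\<^sub>R L' x" using dL vector_derivative_unique_at by blast
  qed
  have Vb: "((\<lambda>s. V s \<bullet> b) has_real_derivative V' \<bullet> b) (at t)" for b
    using bounded_linear.has_vector_derivative[OF bounded_linear_inner_left V]
    by (simp add: has_real_derivative_iff_has_vector_derivative)
  have "((\<lambda>s. \<Sum>b\<in>Basis. (V s \<bullet> b) *\<^sub>R L s b) has_vector_derivative
      (\<Sum>b\<in>Basis. (V t \<bullet> b) *\<^sub>R L' b + (V' \<bullet> b) *\<^sub>R L t b)) (at t)"
    by (intro has_vector_derivative_sum has_vector_derivative_scaleR Vb dL)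
  also have "(\<Sum>b\<in>Basis. (V t \<bullet> b) *\<^sub>R L' b + (V' \<bullet> b) *\<^sub>R L t b) = L' (V t) + L t V'"
    using euclidean_linear_expand[OF linL', of "V t"] euclidean_linear_expand[OF lint, of V']
    by (simp add: sum.distrib)
  finally have *: "((\<lambda>s. \<Sum>b\<in>Basis. (V s \<bullet> b) *\<^sub>R L s b) has_vector_derivative L' (V t) + L t V') (at t)" .
  show ?thesis
    using * unfolding has_vector_derivative_def
    by (rule has_derivative_transform_eventually)
      (use ev lint in \<open>auto elim!: eventually_mono simp: euclidean_linear_expand[symmetric]\<close>)
qed

lemma linear_path_continuous:
  fixes L :: "'x::topological_space \<Rightarrow> 'e::euclidean_space \<Rightarrow> 'h::real_normed_vector"
  assumes lin: "\<And>s. s \<in> S \<Longrightarrow> linear (L s)"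
    and dL: "\<And>v. continuous_on S (\<lambda>s. L s v)"
    and V: "continuous_on S V"
  shows "continuous_on S (\<lambda>s. L s (V s))"
proof -
  have "continuous_on S (\<lambda>s. \<Sum>b\<in>Basis. (V s \<bullet> b) *\<^sub>R L s b)"
    by (intro continuous_intros dL V)
  then show ?thesis by (rule continuous_on_eq) (simp add: lin euclidean_linear_expand[symmetric])
qed

text \<open>
  Parallel fields along piecewise smooth curves satisfy their equation only off a finite set, so
  monotonicity and constancy are read off the fundamental theorem of calculus with finitely many exceptions.
\<close>

lemma nonincreasing_off_finite:
  fixes f :: "real \<Rightarrow> real"
  assumes "finite S" "a \<le> b" "continuous_on {a..b} f"
    and "\<And>t. t \<in> {a<..<b} - S \<Longrightarrow> (f has_vector_derivative f' t) (at t)"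
    and "\<And>t. t \<in> {a<..<b} - S \<Longrightarrow> f' t \<le> 0"
  shows "f b \<le> f a"
proof -
  define h where "h t = (if t \<in> {a<..<b} - S then f' t else 0)" for t
  have "(h has_integral (f b - f a)) {a..b}"
    by (rule fundamental_theorem_of_calculus_interior_strong[OF assms(1,2) _ assms(3)])
      (use assms in \<open>auto simp: h_def\<close>)
  then have "f b - f a \<le> 0"
    by (rule has_integral_le[OF _ has_integral_0]) (use assms in \<open>auto simp: h_def\<close>)
  then show ?thesis by simp
qed

lemma constant_off_finite:
  fixes f :: "real \<Rightarrow> real"
  assumes "finite S" "a \<le> b" "continuous_on {a..b} f"
    and "\<And>t. t \<in> {a<..<b} - S \<Longrightarrow> (f has_vector_derivative 0) (at t)"
  shows "f b = f a"
proof -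
  have "((\<lambda>_. 0) has_integral (f b - f a)) {a..b}"
    by (rule fundamental_theorem_of_calculus_interior_strong[OF assms(1,2) _ assms(3)])
      (use assms in auto)
  then show ?thesis by (metis eq_iff_diff_eq_0 has_integral_0_eq)
qed


lemma linear_family_bound:
  fixes L :: "'x::topological_space \<Rightarrow> 'e::euclidean_space \<Rightarrow> 'h::real_normed_vector"
  assumes "compact S" and lin: "\<And>s. s \<in> S \<Longrightarrow> linear (L s)"
    and cont: "\<And>v. continuous_on S (\<lambda>s. L s v)"
  obtains K where "K > 0" "\<And>s v. s \<in> S \<Longrightarrow> norm (L s v) \<le> K * norm v"
proof -
  have "\<exists>k. \<forall>s\<in>S. norm (L s b) \<le> k" for b
  proof -
    have "bounded ((\<lambda>s. L s b) ` S)"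
      by (rule compact_imp_bounded[OF compact_continuous_image[OF cont \<open>compact S\<close>]])
    then show ?thesis by (auto simp: bounded_iff)
  qed
  then obtain k where k: "\<And>b s. s \<in> S \<Longrightarrow> norm (L s b) \<le> k b" by metis
  define K where "K = (\<Sum>b\<in>(Basis::'e set). \<bar>k b\<bar>) + 1"
  have "norm (L s v) \<le> K * norm v" if "s \<in> S" for s v
  proof -
    have "norm (L s v) = norm (\<Sum>b\<in>Basis. (v \<bullet> b) *\<^sub>R L s b)"
      using euclidean_linear_expand[OF lin[OF that]] by metis
    also have "\<dots> \<le> (\<Sum>b\<in>Basis. norm v * \<bar>k b\<bar>)"
    proof (rule sum_norm_le)
      fix b :: 'e assume b: "b \<in> Basis"
      have "norm (L s b) \<le> \<bar>k b\<bar>" using k[OF that, of b] by linarith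
      then show "norm ((v \<bullet> b) *\<^sub>R L s b) \<le> norm v * \<bar>k b\<bar>"
        using Basis_le_norm[OF b, of v] by (auto intro!: mult_mono)
    qed
    also have "\<dots> \<le> K * norm v" by (simp add: K_def sum_distrib_left[symmetric] algebra_simps)
    finally show ?thesis .
  qed
  moreover have "K > 0" unfolding K_def by (rule add_nonneg_pos[OF sum_nonneg]) auto
  ultimately show ?thesis using that by blast
qed

text \<open>
  The Christoffel symbols are defined only implicitly, as the solution of a linear system; this gives their continuity.
  A lower bound \<open>m * norm w \<le> norm (G x0 w)\<close> persists with \<open>m / 2\<close> for \<open>x\<close> near \<open>x0\<close> and turns
  smallness of \<open>G x (\<Gamma> x - \<Gamma> x0)\<close> into smallness of \<open>\<Gamma> x - \<Gamma> x0\<close>.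
\<close>

lemma continuous_solution_of_linear_family:
  fixes G :: "'x::topological_space \<Rightarrow> 'e::euclidean_space \<Rightarrow> 'e"
  assumes lin: "\<And>x. x \<in> S \<Longrightarrow> linear (G x)"
    and inj: "\<And>x w. x \<in> S \<Longrightarrow> G x w = 0 \<Longrightarrow> w = 0"
    and cont: "\<And>w. continuous_on S (\<lambda>x. G x w)"
    and F: "continuous_on S F"
    and sol: "\<And>x. x \<in> S \<Longrightarrow> G x (\<Gamma> x) = F x"
  shows "continuous_on S \<Gamma>"
  unfolding continuous_on_def
proof
  fix x0 assume x0: "x0 \<in> S"
  have "inj (G x0)" using lin[OF x0] inj[OF x0] by (auto simp: linear_injective_0)
  then obtain m where m: "m > 0" "\<And>w. m * norm w \<le> norm (G x0 w)"
    using linear_inj_bounded_below_pos[OF lin[OF x0]] by blast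
  define \<epsilon> where "\<epsilon> x = (\<Sum>b\<in>Basis. norm (G x b - G x0 b))" for x
  have tG: "((\<lambda>x. G x w) \<longlongrightarrow> G x0 w) (at x0 within S)" for w
    using cont x0 by (auto simp: continuous_on_def)
  have "(\<epsilon> \<longlongrightarrow> (\<Sum>b\<in>(Basis::'e set). norm (G x0 b - G x0 b))) (at x0 within S)"
    unfolding \<epsilon>_def by (intro tendsto_intros tG)
  then have "(\<epsilon> \<longlongrightarrow> 0) (at x0 within S)" by simp
  then have ev\<epsilon>: "\<forall>\<^sub>F x in at x0 within S. \<epsilon> x < m / 2"
    using order_tendstoD(2)[of \<epsilon> 0 _ "m/2"] m by simp
  have \<epsilon>: "norm (G x w - G x0 w) \<le> \<epsilon> x * norm w" if "x \<in> S" for x w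
  proof -
    have "G x w - G x0 w = (\<Sum>b\<in>Basis. (w \<bullet> b) *\<^sub>R (G x b - G x0 b))"
      using euclidean_linear_expand[OF lin[OF that], of w] euclidean_linear_expand[OF lin[OF x0], of w]
      by (simp add: scaleR_diff_right sum_subtractf)
    also have "norm \<dots> \<le> (\<Sum>b\<in>Basis. norm w * norm (G x b - G x0 b))"
      by (rule sum_norm_le) (auto intro!: mult_right_mono Basis_le_norm)
    finally show ?thesis by (simp add: \<epsilon>_def sum_distrib_left[symmetric] mult.commute)
  qed
  have evS: "\<forall>\<^sub>F x in at x0 within S. x \<in> S" by (simp add: eventually_at_topological) blast
  have ev: "\<forall>\<^sub>F x in at x0 within S. norm (\<Gamma> x - \<Gamma> x0) \<le> norm (F x - G x (\<Gamma> x0)) * (2 / m)"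
    using ev\<epsilon> evS
  proof eventually_elim
    case (elim x)
    let ?w = "\<Gamma> x - \<Gamma> x0"
    have "m * norm ?w \<le> norm (G x0 ?w)" by (rule m)
    also have "\<dots> \<le> norm (G x ?w) + norm (G x ?w - G x0 ?w)"
      by (metis norm_minus_commute norm_triangle_sub)
    also have "\<dots> \<le> norm (G x ?w) + m / 2 * norm ?w"
      using \<epsilon>[OF elim(2), of ?w] mult_right_mono[OF less_imp_le[OF elim(1)] norm_ge_zero, of ?w] by linarith
    finally have "m / 2 * norm ?w \<le> norm (G x ?w)" by simp
    also have "G x ?w = F x - G x (\<Gamma> x0)"
      using lin[OF elim(2)] sol[OF elim(2)] by (simp add: linear_diff)
    finally show ?case using m by (simp add: field_simps)
  qed
  have "((\<lambda>x. norm (F x - G x (\<Gamma> x0)) * (2 / m)) \<longlongrightarrow> norm (F x0 - G x0 (\<Gamma> x0)) * (2 / m)) (at x0 within S)"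
    using F x0 by (intro tendsto_intros tG) (auto simp: continuous_on_def)
  then have "((\<lambda>x. norm (F x - G x (\<Gamma> x0)) * (2 / m)) \<longlongrightarrow> 0) (at x0 within S)"
    using sol[OF x0] by simp
  from Lim_null_comparison[OF ev this] show "(\<Gamma> \<longlongrightarrow> \<Gamma> x0) (at x0 within S)"
    by (simp add: Lim_null[symmetric])
qed

text \<open>
  Picard iteration; the bound on the length of the interval makes the integral operator a contraction with
  factor \<open>1 / 2\<close>. Long curves are later covered by gluing short pieces.
\<close>

lemma linear_ode_short_interval:
  fixes A :: "real \<Rightarrow> 'e::euclidean_space \<Rightarrow> 'e"
  assumes ab: "a \<le> b" and K: "K \<ge> 0" "K * (b - a) \<le> 1 / 2"
    and lin: "\<And>t. t \<in> {a..b} \<Longrightarrow> linear (A t)"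
    and bnd: "\<And>t w. t \<in> {a..b} \<Longrightarrow> norm (A t w) \<le> K * norm w"
    and cont: "\<And>w. continuous_on {a..b} (\<lambda>t. A t w)"
  obtains y where "y a = v" "\<And>t. t \<in> {a..b} \<Longrightarrow> (y has_vector_derivative A t (y t)) (at t within {a..b})"
proof -
  \<comment> \<open>clamping the time to \<open>{a..b}\<close> makes the iterates bounded continuous functions on the whole line\<close>
  define cl where "cl t = max a (min b t)" for t
  have cl: "cl t \<in> {a..b}" "t \<in> {a..b} \<Longrightarrow> cl t = t" for t using ab by (auto simp: cl_def)
  define F where "F y t = v + integral {a..cl t} (\<lambda>s. A s (y s))" for y :: "real \<Rightarrow> 'e" and t
  have contA: "continuous_on {a..b} (\<lambda>s. A s (y s))" if "continuous_on UNIV y" for y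
    by (rule linear_path_continuous[OF lin cont]) (auto intro: continuous_on_subset[OF that])
  have contI: "continuous_on {a..b} (\<lambda>t. v + integral {a..t} (\<lambda>s. A s (y s)))" if "continuous_on UNIV y" for y
    by (intro continuous_intros indefinite_integral_continuous_1 integrable_continuous_real contA that)
  have F: "F y \<in> bcontfun" if y: "continuous_on UNIV y" for y
  proof -
    have "continuous_on UNIV cl" unfolding cl_def by (intro continuous_intros)
    then have "continuous_on UNIV (F y)"
      unfolding F_def by (rule continuous_on_compose2[OF contI[OF y]]) (use cl in auto)
    moreover have "bounded ((\<lambda>t. v + integral {a..t} (\<lambda>s. A s (y s))) ` {a..b})"
      by (rule compact_imp_bounded[OF compact_continuous_image[OF contI[OF y]]]) auto
    then have "bounded (range (F y))" by (rule bounded_subset) (use cl in \<open>auto simp: F_def\<close>)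
    ultimately show ?thesis by (simp add: bcontfun_def)
  qed
  define T where "T y = Bcontfun (F (apply_bcontfun y))" for y :: "real \<Rightarrow>\<^sub>C 'e"
  have T: "apply_bcontfun (T y) = F (apply_bcontfun y)" for y
    unfolding T_def by (rule Bcontfun_inverse[OF F]) auto
  have "dist (T y) (T z) \<le> 1/2 * dist y z" for y z
  proof (rule dist_bound)
    fix t
    have c: "continuous_on {a..cl t} (\<lambda>s. A s (apply_bcontfun y s))" for y :: "real \<Rightarrow>\<^sub>C 'e"
      by (rule continuous_on_subset[OF contA]) (use cl[of t] in auto)
    have "F (apply_bcontfun y) t - F (apply_bcontfun z) t
        = integral {a..cl t} (\<lambda>s. A s (apply_bcontfun y s)) - integral {a..cl t} (\<lambda>s. A s (apply_bcontfun z s))"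
      by (simp add: F_def)
    also have "\<dots> = integral {a..cl t} (\<lambda>s. A s (apply_bcontfun y s) - A s (apply_bcontfun z s))"
      by (rule integral_diff[symmetric]; intro integrable_continuous_real c)
    also have "norm \<dots> \<le> (K * dist y z) * (cl t - a)"
    proof (rule integral_bound)
      show "a \<le> cl t" using cl by auto
      show "continuous_on {a..cl t} (\<lambda>s. A s (apply_bcontfun y s) - A s (apply_bcontfun z s))"
        by (intro continuous_intros c)
      fix s assume s: "s \<in> {a..cl t}"
      then have s': "s \<in> {a..b}" using cl(1)[of t] by auto
      have "norm (A s (apply_bcontfun y s) - A s (apply_bcontfun z s)) \<le> K * norm (apply_bcontfun y s - apply_bcontfun z s)"
        using bnd[OF s', of "apply_bcontfun y s - apply_bcontfun z s"] lin[OF s'] by (simp add: linear_diff)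
      also have "\<dots> \<le> K * dist y z"
        using dist_bounded[of y s z] K by (intro mult_left_mono) (auto simp: dist_norm)
      finally show "norm (A s (apply_bcontfun y s) - A s (apply_bcontfun z s)) \<le> K * dist y z" .
    qed
    also have "\<dots> \<le> (K * dist y z) * (b - a)"
      using cl[of t] K by (intro mult_left_mono) auto
    also have "\<dots> \<le> 1/2 * dist y z"
      using mult_right_mono[OF K(2), of "dist y z"] by (simp add: algebra_simps)
    finally show "dist (apply_bcontfun (T y) t) (apply_bcontfun (T z) t) \<le> 1/2 * dist y z"
      by (simp add: T dist_norm)
  qed
  then have "\<exists>!y. T y = y" by (intro banach_fix_type[of "1/2"]) auto
  then obtain y where y: "T y = y" by blast
  let ?y = "apply_bcontfun y"
  have fp: "?y t = v + integral {a..cl t} (\<lambda>s. A s (?y s))" for t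
    using T[of y] y by (metis F_def)
  have "(?y has_vector_derivative A t (?y t)) (at t within {a..b})" if t: "t \<in> {a..b}" for t
  proof -
    have *: "((\<lambda>u. v + integral {a..u} (\<lambda>s. A s (?y s))) has_vector_derivative 0 + A t (?y t)) (at t within {a..b})"
      by (intro derivative_intros integral_has_vector_derivative contA t) auto
    have "(?y has_vector_derivative 0 + A t (?y t)) (at t within {a..b})"
      by (rule has_vector_derivative_transform[OF t _ *]) (metis fp cl(2))
    then show ?thesis by simp
  qed
  moreover have "?y a = v" using fp[of a] cl(2)[of a] ab by simp
  ultimately show ?thesis using that by blast
qed

lemma Ck_on_cong:
  assumes "open S" "\<And>x. x \<in> S \<Longrightarrow> f x = g x" "Ck_on k S f"
  shows "Ck_on k S g"
  using assms(2,3)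
proof (induction k arbitrary: f g)
  case 0
  then show ?case by (simp add: continuous_on_eq)
next
  case (Suc k)
  have eq: "frechet_derivative f (at x) = frechet_derivative g (at x)" if "x \<in> S" for x
    by (rule frechet_derivative_transform_within_open) (use Suc.prems that assms(1) in auto)
  have "g differentiable at x" if "x \<in> S" for x
    using Suc.prems that assms(1) unfolding differentiable_def Ck_on.simps
    by (meson has_derivative_transform_within_open)
  moreover have "Ck_on k S (\<lambda>x. frechet_derivative g (at x) v)" for v
    by (rule Suc.IH[of "\<lambda>x. frechet_derivative f (at x) v"]) (use Suc.prems eq in auto)
  ultimately show ?case by simp
qed

lemma Ck_on_subset: "Ck_on k S f \<Longrightarrow> T \<subseteq> S \<Longrightarrow> Ck_on k T f"
  by (induction k arbitrary: f) (auto intro: continuous_on_subset)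

lemma Ck_on_const: "Ck_on k S (\<lambda>x. c)"
  by (induction k arbitrary: c) (auto simp: continuous_on_const)

lemma Ck_on_bounded_linear:
  assumes "bounded_linear L" shows "Ck_on k S L"
proof (cases k)
  case (Suc j)
  have "frechet_derivative L (at x) = L" for x
    using bounded_linear_imp_has_derivative[OF assms] frechet_derivative_at by metis
  then show ?thesis using Suc assms by (auto simp: bounded_linear_imp_differentiable Ck_on_const)
qed (use assms linear_continuous_on in auto)

text \<open>Any known expression for the derivative may replace \<open>frechet_derivative\<close> in the recursion.\<close>

lemma Ck_on_SucI:
  assumes S: "open S" and d: "\<And>x. x \<in> S \<Longrightarrow> (f has_derivative f' x) (at x)"
    and f': "\<And>v. Ck_on k S (\<lambda>x. f' x v)"
  shows "Ck_on (Suc k) S f"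
proof -
  have "Ck_on k S (\<lambda>x. frechet_derivative f (at x) v)" for v
  proof (rule Ck_on_cong[OF S _ f'])
    show "f' x v = frechet_derivative f (at x) v" if "x \<in> S" for x
      using frechet_derivative_at[OF d[OF that]] by metis
  qed
  then show ?thesis using d by (auto simp: differentiable_def)
qed

lemma Ck_on_affine_compose:
  assumes "open S" "bounded_linear L" "Ck_on k S f"
  shows "Ck_on k {x. c + L x \<in> S} (\<lambda>x. f (c + L x))"
proof -
  have contL: "continuous_on UNIV (\<lambda>x. c + L x)"
    using assms(2) by (intro continuous_intros linear_continuous_on)
  have op: "open {x. c + L x \<in> S}"
    using open_vimage[OF \<open>open S\<close> contL] by (simp add: vimage_def)
  show ?thesis using assms(3)
  proof (induction k arbitrary: f)
    case 0
    then show ?case by (auto intro!: continuous_on_compose2[of S f] continuous_on_subset[OF contL])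
  next
    case (Suc k)
    show ?case
    proof (rule Ck_on_SucI[OF op, where f'="\<lambda>x v. frechet_derivative f (at (c + L x)) (L v)"])
      fix x assume "x \<in> {x. c + L x \<in> S}"
      then have "(f has_derivative frechet_derivative f (at (c + L x))) (at (c + L x))"
        using Suc.prems frechet_derivative_works by auto
      moreover have "((\<lambda>x. c + L x) has_derivative L) (at x)"
        using bounded_linear_imp_has_derivative[OF assms(2)] by (auto intro!: derivative_eq_intros)
      ultimately show "((\<lambda>x. f (c + L x)) has_derivative (\<lambda>v. frechet_derivative f (at (c + L x)) (L v))) (at x)"
        by (intro has_derivative_compose[of "\<lambda>x. c + L x" L x UNIV f])
    next
      show "Ck_on k {x. c + L x \<in> S} (\<lambda>x. frechet_derivative f (at (c + L x)) (L v))" for v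
        using Suc.prems Suc.IH[of "\<lambda>y. frechet_derivative f (at y) (L v)"] by simp
    qed
  qed
qed

lemma Ck_on_Pair:
  assumes "open S" "Ck_on k S f" "Ck_on k S h"
  shows "Ck_on k S (\<lambda>x. (f x, h x))"
  using assms(2,3)
proof (induction k arbitrary: f h)
  case 0
  then show ?case by (auto intro: continuous_intros)
next
  case (Suc k)
  then show ?case
    by (intro Ck_on_SucI[OF assms(1), where f'="\<lambda>x v. (frechet_derivative f (at x) v, frechet_derivative h (at x) v)"]
        has_derivative_Pair Suc.IH) (auto simp: frechet_derivative_works)
qed

section \<open>Charts and metrics in coordinates\<close>

lemma linear_derivative_of_linear_family:
  fixes L :: "'x::real_normed_vector \<Rightarrow> 'e::real_vector \<Rightarrow> 'h::real_normed_vector"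
  assumes "open S" "x \<in> S" and lin: "\<And>y. y \<in> S \<Longrightarrow> linear (L y)"
    and d: "\<And>v. ((\<lambda>y. L y v) has_derivative L' v) (at x)"
  shows "linear (\<lambda>v. L' v z)"
proof (rule linearI)
  fix a b
  have "((\<lambda>y. L y a + L y b) has_derivative (\<lambda>z. L' a z + L' b z)) (at x)"
    by (intro derivative_intros d)
  then have "((\<lambda>y. L y (a + b)) has_derivative (\<lambda>z. L' a z + L' b z)) (at x)"
    by (rule has_derivative_transform_within_open[OF _ assms(1,2)]) (simp add: lin linear_add)
  then show "L' (a + b) z = L' a z + L' b z" using has_derivative_unique[OF d] by metis
next
  fix r a
  have "((\<lambda>y. r *\<^sub>R L y a) has_derivative (\<lambda>z. r *\<^sub>R L' a z)) (at x)"
    by (intro derivative_intros d)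
  then have "((\<lambda>y. L y (r *\<^sub>R a)) has_derivative (\<lambda>z. r *\<^sub>R L' a z)) (at x)"
    by (rule has_derivative_transform_within_open[OF _ assms(1,2)]) (simp add: lin linear_cmul)
  then show "L' (r *\<^sub>R a) z = r *\<^sub>R L' a z" using has_derivative_unique[OF d] by metis
qed

text \<open>The musical isomorphism: \<open>w\<close> with its index lowered by \<open>B\<close>, represented through the Euclidean inner product.\<close>

definition flat :: "('e::euclidean_space \<Rightarrow> 'e \<Rightarrow> real) \<Rightarrow> 'e \<Rightarrow> 'e" where
  "flat B w = (\<Sum>b\<in>Basis. B w b *\<^sub>R b)"

lemma linear_flat:
  assumes "bilinear B"
  shows "linear (flat B)"
proof -
  have l: "linear (\<lambda>w. B w z)" for z using assms by (simp add: bilinear_def)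
  show ?thesis
    unfolding flat_def by (rule linearI)
      (simp_all add: linear_add[OF l] linear_cmul[OF l] scaleR_add_left sum.distrib scaleR_sum_right)
qed

lemma linear_functional_inner:
  fixes \<phi> :: "'e::euclidean_space \<Rightarrow> real"
  assumes "linear \<phi>"
  shows "(\<Sum>b\<in>Basis. \<phi> b *\<^sub>R b) \<bullet> z = \<phi> z"
proof -
  have "(\<Sum>b\<in>Basis. \<phi> b *\<^sub>R b) \<bullet> z = (\<Sum>b\<in>Basis. (z \<bullet> b) *\<^sub>R \<phi> b)"
    unfolding inner_sum_left by (rule sum.cong[OF refl]) (simp add: inner_commute)
  also have "\<dots> = \<phi> z" by (rule euclidean_linear_expand[OF assms, symmetric])
  finally show ?thesis .
qed

lemma inner_flat: "bilinear B \<Longrightarrow> flat B w \<bullet> z = B w z"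
  unfolding flat_def by (rule linear_functional_inner) (simp add: bilinear_def)

lemma nondegenerate_form_riesz:
  fixes B :: "'e::euclidean_space \<Rightarrow> 'e \<Rightarrow> real"
  assumes B: "bilinear B" and nd: "\<And>u. (\<forall>v. B u v = 0) \<Longrightarrow> u = 0" and \<phi>: "linear \<phi>"
  shows "\<exists>!w. \<forall>z. B w z = \<phi> z"
proof -
  have inj: "w = 0" if "flat B w = 0" for w
  proof -
    have "B w v = 0" for v using inner_flat[OF B, of w v] that by simp
    then show ?thesis using nd by blast
  qed
  then have "inj (flat B)" by (simp add: linear_injective_0[OF linear_flat[OF B]])
  then have "surj (flat B)" using linear_flat[OF B] linear_injective_imp_surjective by blast
  then obtain w where w: "flat B w = (\<Sum>b\<in>Basis. \<phi> b *\<^sub>R b)" by (metis surjD)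
  have wz: "B w z = \<phi> z" for z
    using inner_flat[OF B, of w z] linear_functional_inner[OF \<phi>, of z] by (simp add: w)
  moreover have "w' = w" if "\<forall>z. B w' z = \<phi> z" for w'
  proof -
    have "linear (\<lambda>w. B w z)" for z using B by (simp add: bilinear_def)
    from linear_diff[OF this] have "\<forall>z. B (w' - w) z = 0" using that wz by simp
    then show ?thesis using nd by force
  qed
  ultimately show ?thesis by blast
qed

locale pseudo_riemannian_manifold =
  fixes M :: "('a, 'i, 'e::euclidean_space) manifold" and g :: "('i, 'e) metric"
  assumes manifold: "smooth_manifold M" and metric: "pseudo_riemannian_metric M g"
begin

abbreviation overlap :: "'i \<Rightarrow> 'i \<Rightarrow> 'e set" where
  "overlap i j \<equiv> coord M i ` (cdom M i \<inter> cdom M j)"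

abbreviation dtr :: "'i \<Rightarrow> 'i \<Rightarrow> 'e \<Rightarrow> 'e \<Rightarrow> 'e" where
  "dtr i j x \<equiv> frechet_derivative (transition M i j) (at x)"

abbreviation d2tr :: "'i \<Rightarrow> 'i \<Rightarrow> 'e \<Rightarrow> 'e \<Rightarrow> 'e \<Rightarrow> 'e" where
  "d2tr i j x u v \<equiv> frechet_derivative (\<lambda>y. dtr i j y v) (at x) u"

abbreviation dmetric :: "'i \<Rightarrow> 'e \<Rightarrow> 'e \<Rightarrow> 'e \<Rightarrow> 'e \<Rightarrow> real" where
  "dmetric i x z u v \<equiv> frechet_derivative (\<lambda>y. g i y u v) (at x) z"

lemma topspace_charts: "topspace (mtop M) = (\<Union>i\<in>charts M. cdom M i)"
  using manifold by (auto simp: smooth_manifold_def)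

lemma cdom_open: "i \<in> charts M \<Longrightarrow> openin (mtop M) (cdom M i)"
  using manifold by (auto simp: smooth_manifold_def)

lemma cran_open: "i \<in> charts M \<Longrightarrow> open (cran M i)"
  using manifold by (auto simp: smooth_manifold_def)

lemma coord_homeomorphic_map:
  "i \<in> charts M \<Longrightarrow> homeomorphic_map (subtopology (mtop M) (cdom M i)) (top_of_set (cran M i)) (coord M i)"
  using manifold by (auto simp: smooth_manifold_def)

lemma cdom_subset_topspace: "i \<in> charts M \<Longrightarrow> cdom M i \<subseteq> topspace (mtop M)"
  using cdom_open openin_subset by blast

lemma topspace_cdom: "i \<in> charts M \<Longrightarrow> topspace (subtopology (mtop M) (cdom M i)) = cdom M i"
  using cdom_subset_topspace by auto

lemma coord_inj: "i \<in> charts M \<Longrightarrow> inj_on (coord M i) (cdom M i)"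
  using homeomorphic_imp_injective_map[OF coord_homeomorphic_map] topspace_cdom by metis

lemma coord_in_cran: "p \<in> cdom M i \<Longrightarrow> coord M i p \<in> cran M i"
  by (simp add: cran_def)

lemma coord_continuous: "i \<in> charts M \<Longrightarrow>
    continuous_map (subtopology (mtop M) (cdom M i)) euclidean (coord M i)"
  using homeomorphic_imp_continuous_map[OF coord_homeomorphic_map] continuous_map_into_fulltopology by blast

lemma coord_image_open:
  assumes i: "i \<in> charts M" and U: "openin (mtop M) U" "U \<subseteq> cdom M i"
  shows "open (coord M i ` U)"
proof -
  have "openin (subtopology (mtop M) (cdom M i)) U"
    using U by (simp add: openin_subset_topspace_eq openin_subtopology) blast
  then have "openin (top_of_set (cran M i)) (coord M i ` U)"
    using homeomorphic_imp_open_map[OF coord_homeomorphic_map[OF i]] by (auto simp: open_map_def)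
  then show ?thesis using openin_open_trans cran_open[OF i] by blast
qed

lemma overlap_open: "i \<in> charts M \<Longrightarrow> j \<in> charts M \<Longrightarrow> open (overlap i j)"
  by (rule coord_image_open) (auto intro: cdom_open openin_Int)

lemma coord_preimage_open:
  assumes i: "i \<in> charts M" and "open O'"
  shows "openin (mtop M) {p \<in> cdom M i. coord M i p \<in> O'}"
proof -
  have "openin (subtopology (mtop M) (cdom M i)) {p \<in> topspace (subtopology (mtop M) (cdom M i)). coord M i p \<in> O'}"
    using coord_continuous[OF i] \<open>open O'\<close> by (simp add: continuous_map_def)
  then show ?thesis using openin_trans_full[OF _ cdom_open[OF i]] topspace_cdom[OF i] by metis
qed

lemma inv_coord: "i \<in> charts M \<Longrightarrow> p \<in> cdom M i \<Longrightarrow> inv_into (cdom M i) (coord M i) (coord M i p) = p"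
  by (simp add: coord_inj inv_into_f_f)

lemma transition_coord: "i \<in> charts M \<Longrightarrow> p \<in> cdom M i \<Longrightarrow> transition M i j (coord M i p) = coord M j p"
  by (simp add: transition_def inv_coord)

lemma transition_smooth: "i \<in> charts M \<Longrightarrow> j \<in> charts M \<Longrightarrow> smooth_on (overlap i j) (transition M i j)"
  using manifold by (auto simp: smooth_manifold_def)

lemma dtr:
  assumes "i \<in> charts M" "j \<in> charts M" "x \<in> overlap i j"
  shows "(transition M i j has_derivative dtr i j x) (at x)"
proof -
  have "Ck_on (Suc 0) (overlap i j) (transition M i j)"
    using transition_smooth[OF assms(1,2)] unfolding smooth_on_def by blast
  then show ?thesis using assms(3) by (auto simp: frechet_derivative_works)
qed

lemma d2tr:
  assumes "i \<in> charts M" "j \<in> charts M"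
  shows "x \<in> overlap i j \<Longrightarrow> ((\<lambda>y. dtr i j y v) has_derivative (\<lambda>u. d2tr i j x u v)) (at x)"
    and "continuous_on (overlap i j) (\<lambda>x. d2tr i j x u v)"
proof -
  have "Ck_on (Suc (Suc 0)) (overlap i j) (transition M i j)"
    using transition_smooth[OF assms(1,2)] unfolding smooth_on_def by blast
  then show "x \<in> overlap i j \<Longrightarrow> ((\<lambda>y. dtr i j y v) has_derivative (\<lambda>u. d2tr i j x u v)) (at x)"
    and "continuous_on (overlap i j) (\<lambda>x. d2tr i j x u v)"
    by (auto simp: frechet_derivative_works)
qed

lemma d2tr_sym:
  assumes "i \<in> charts M" "j \<in> charts M" "x \<in> overlap i j"
  shows "d2tr i j x u v = d2tr i j x v u"
  by (rule mixed_second_derivative_symmetric[where f''="\<lambda>v x u. d2tr i j x u v",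
        OF overlap_open[OF assms(1,2)] assms(3) dtr[OF assms(1,2)] d2tr[OF assms(1,2)]])

lemma dtr_linear:
  assumes "i \<in> charts M" "j \<in> charts M" "x \<in> overlap i j"
  shows "linear (dtr i j x)"
  using dtr[OF assms] by (rule has_derivative_linear)

text \<open>The chain rule for the composition of two transition maps.\<close>

lemma dtr_cocycle:
  assumes "i \<in> charts M" "j \<in> charts M" "k \<in> charts M" "p \<in> cdom M i" "p \<in> cdom M j" "p \<in> cdom M k"
  shows "dtr j k (coord M j p) (dtr i j (coord M i p) v) = dtr i k (coord M i p) v"
proof -
  let ?x = "coord M i p"
  let ?U = "coord M i ` (cdom M i \<inter> cdom M j \<inter> cdom M k)"
  have U: "open ?U"
    by (rule coord_image_open) (use assms in \<open>auto intro!: openin_Int cdom_open\<close>)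
  have x: "?x \<in> ?U" using assms by auto
  have "((\<lambda>y. transition M j k (transition M i j y)) has_derivative
      (\<lambda>v. dtr j k (transition M i j ?x) (dtr i j ?x v))) (at ?x)"
    by (rule has_derivative_compose[OF dtr dtr]) (use assms transition_coord in auto)
  then have "(transition M i k has_derivative (\<lambda>v. dtr j k (transition M i j ?x) (dtr i j ?x v))) (at ?x)"
    by (rule has_derivative_transform_within_open[OF _ U x]) (use assms transition_coord in auto)
  from frechet_derivative_at[OF this] show ?thesis using assms transition_coord by metis
qed

lemma dtr_id:
  assumes "i \<in> charts M" "p \<in> cdom M i"
  shows "dtr i i (coord M i p) v = v"
proof -
  have "((\<lambda>x. x) has_derivative (\<lambda>v. v)) (at (coord M i p))" by simp
  then have "(transition M i i has_derivative (\<lambda>v. v)) (at (coord M i p))"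
    by (rule has_derivative_transform_within_open[OF _ cran_open[OF assms(1)] coord_in_cran[OF assms(2)]])
      (use assms transition_coord in \<open>auto simp: cran_def\<close>)
  from frechet_derivative_at[OF this] show ?thesis by metis
qed

lemma overlapI: "p \<in> cdom M i \<Longrightarrow> p \<in> cdom M j \<Longrightarrow> coord M i p \<in> overlap i j"
  by auto

lemma dtr_inverse:
  assumes "i \<in> charts M" "j \<in> charts M" "p \<in> cdom M i" "p \<in> cdom M j"
  shows "dtr j i (coord M j p) (dtr i j (coord M i p) v) = v"
  using dtr_cocycle[of i j i p v] dtr_id assms by simp

lemma metric_bilinear: "i \<in> charts M \<Longrightarrow> x \<in> cran M i \<Longrightarrow> bilinear (g i x)"
  and metric_sym: "i \<in> charts M \<Longrightarrow> x \<in> cran M i \<Longrightarrow> g i x u v = g i x v u"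
  and metric_nondegenerate: "i \<in> charts M \<Longrightarrow> x \<in> cran M i \<Longrightarrow> (\<forall>v. g i x u v = 0) \<Longrightarrow> u = 0"
  and metric_smooth: "i \<in> charts M \<Longrightarrow> smooth_on (cran M i) (\<lambda>x. g i x u v)"
  and metric_transition: "i \<in> charts M \<Longrightarrow> j \<in> charts M \<Longrightarrow> p \<in> cdom M i \<Longrightarrow> p \<in> cdom M j \<Longrightarrow>
      g i (coord M i p) u v = g j (coord M j p) (dtr i j (coord M i p) u) (dtr i j (coord M i p) v)"
  using metric unfolding pseudo_riemannian_metric_def by blast+

lemma metric_linear:
  assumes "i \<in> charts M" "x \<in> cran M i"
  shows "linear (g i x u)" "linear (\<lambda>u. g i x u v)"
  using metric_bilinear[OF assms] by (auto simp: bilinear_def)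

lemma dmetric:
  assumes "i \<in> charts M"
  shows "x \<in> cran M i \<Longrightarrow> ((\<lambda>y. g i y u v) has_derivative (\<lambda>z. dmetric i x z u v)) (at x)"
    and "continuous_on (cran M i) (\<lambda>x. dmetric i x z u v)"
    and "continuous_on (cran M i) (\<lambda>x. g i x u v)"
proof -
  have "Ck_on (Suc 0) (cran M i) (\<lambda>x. g i x u v)" "Ck_on 0 (cran M i) (\<lambda>x. g i x u v)"
    using metric_smooth[OF assms] unfolding smooth_on_def by blast+
  then show "x \<in> cran M i \<Longrightarrow> ((\<lambda>y. g i y u v) has_derivative (\<lambda>z. dmetric i x z u v)) (at x)"
    and "continuous_on (cran M i) (\<lambda>x. dmetric i x z u v)"
    and "continuous_on (cran M i) (\<lambda>x. g i x u v)"
    by (simp_all add: frechet_derivative_works)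
qed

lemma dmetric_linear:
  assumes "i \<in> charts M" "x \<in> cran M i"
  shows "linear (\<lambda>z. dmetric i x z u v)" "linear (\<lambda>u. dmetric i x z u v)" "linear (\<lambda>v. dmetric i x z u v)"
proof -
  show "linear (\<lambda>z. dmetric i x z u v)" using dmetric(1)[OF assms] by (rule has_derivative_linear)
  show "linear (\<lambda>u. dmetric i x z u v)"
    by (rule linear_derivative_of_linear_family[OF cran_open[OF assms(1)] assms(2), where L="\<lambda>y u. g i y u v" and L'="\<lambda>u z. dmetric i x z u v"])
      (use assms in \<open>auto intro: metric_linear dmetric\<close>)
  show "linear (\<lambda>v. dmetric i x z u v)"
    by (rule linear_derivative_of_linear_family[OF cran_open[OF assms(1)] assms(2), where L="\<lambda>y v. g i y u v" and L'="\<lambda>v z. dmetric i x z u v"])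
      (use assms in \<open>auto intro: metric_linear dmetric\<close>)
qed

lemma dmetric_sym:
  assumes "i \<in> charts M" "x \<in> cran M i"
  shows "dmetric i x z u v = dmetric i x z v u"
proof -
  have "((\<lambda>y. g i y v u) has_derivative (\<lambda>z. dmetric i x z u v)) (at x)"
    by (rule has_derivative_transform_within_open[OF dmetric(1)[OF assms] cran_open[OF assms(1)] assms(2)])
      (use metric_sym assms in auto)
  from frechet_derivative_at[OF this] show ?thesis by metis
qed

lemma linear_christoffel_first_kind:
  assumes "i \<in> charts M" "x \<in> cran M i"
  shows "linear (\<lambda>v. christoffel_first_kind g i x u v z)" "linear (christoffel_first_kind g i x u v)"
proof -
  note l = dmetric_linear[OF assms]
  show "linear (\<lambda>v. christoffel_first_kind g i x u v z)" "linear (christoffel_first_kind g i x u v)"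
    by (rule linearI;
        simp add: christoffel_first_kind_def linear_add[OF l(1)] linear_add[OF l(2)] linear_add[OF l(3)]
          linear_cmul[OF l(1)] linear_cmul[OF l(2)] linear_cmul[OF l(3)] field_simps)+
qed

lemma christoffel_ex1:
  assumes "i \<in> charts M" "x \<in> cran M i"
  shows "\<exists>!w. \<forall>z. g i x w z = christoffel_first_kind g i x u v z"
  by (rule nondegenerate_form_riesz[OF metric_bilinear[OF assms] metric_nondegenerate[OF assms]])
    (use linear_christoffel_first_kind[OF assms] in auto)

lemma christoffel:
  assumes "i \<in> charts M" "x \<in> cran M i"
  shows "g i x (christoffel g i x u v) z = christoffel_first_kind g i x u v z"
  using theI'[OF christoffel_ex1[OF assms, of u v]] unfolding christoffel_def by blast

lemma christoffel_unique:
  assumes "i \<in> charts M" "x \<in> cran M i" "\<And>z. g i x w z = christoffel_first_kind g i x u v z"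
  shows "christoffel g i x u v = w"
  using christoffel_ex1[OF assms(1,2), of u v] christoffel[OF assms(1,2), of u v] assms(3) by blast

lemma christoffel_linear:
  assumes "i \<in> charts M" "x \<in> cran M i"
  shows "linear (christoffel g i x u)"
proof (rule linearI)
  note l = metric_linear(2)[OF assms] linear_christoffel_first_kind(1)[OF assms]
  show "christoffel g i x u (a + b) = christoffel g i x u a + christoffel g i x u b" for a b
    by (rule christoffel_unique[OF assms]) (simp add: linear_add[OF l(1)] linear_add[OF l(2)] christoffel[OF assms])
  show "christoffel g i x u (r *\<^sub>R a) = r *\<^sub>R christoffel g i x u a" for r a
    by (rule christoffel_unique[OF assms]) (simp add: linear_cmul[OF l(1)] linear_cmul[OF l(2)] christoffel[OF assms])
qed

lemma christoffel_sym:
  assumes "i \<in> charts M" "x \<in> cran M i"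
  shows "christoffel g i x u v = christoffel g i x v u"
  by (rule christoffel_unique[OF assms])
    (simp add: christoffel[OF assms] christoffel_first_kind_def, metis dmetric_sym[OF assms])

lemma continuous_christoffel:
  fixes x u :: "'x::topological_space \<Rightarrow> 'e"
  assumes i: "i \<in> charts M" and x: "\<And>t. t \<in> T \<Longrightarrow> x t \<in> cran M i"
    and cx: "continuous_on T x" and cu: "continuous_on T u"
  shows "continuous_on T (\<lambda>t. christoffel g i (x t) (u t) v)"
proof (rule continuous_solution_of_linear_family[where G="\<lambda>t. flat (g i (x t))"])
  define F where "F t = (\<Sum>b\<in>Basis. christoffel_first_kind g i (x t) (u t) v b *\<^sub>R b)" for t
  show "linear (flat (g i (x t)))" if "t \<in> T" for t by (rule linear_flat[OF metric_bilinear[OF i x[OF that]]])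
  show "w = 0" if t: "t \<in> T" "flat (g i (x t)) w = 0" for t w
  proof (rule metric_nondegenerate[OF i x[OF t(1)]], rule allI)
    show "g i (x t) w v = 0" for v using inner_flat[OF metric_bilinear[OF i x[OF t(1)]], of w v] t(2) by simp
  qed
  have cg: "continuous_on T (\<lambda>t. g i (x t) w z)" for w z
    by (rule continuous_on_compose2[OF dmetric(3)[OF i] cx]) (use x in auto)
  have cd: "continuous_on T (\<lambda>t. dmetric i (x t) z w w')" for w w' z
    by (rule continuous_on_compose2[OF dmetric(2)[OF i] cx]) (use x in auto)
  show "continuous_on T (\<lambda>t. flat (g i (x t)) w)" for w unfolding flat_def by (intro continuous_intros cg)
  have "continuous_on T (\<lambda>t. dmetric i (x t) (u t) w w')" for w w'
    by (rule linear_path_continuous[where L="\<lambda>t u. dmetric i (x t) u w w'", OF _ cd cu]) (use dmetric_linear i x in blast)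
  moreover have "continuous_on T (\<lambda>t. dmetric i (x t) z (u t) w')" for z w'
    by (rule linear_path_continuous[where L="\<lambda>t u. dmetric i (x t) z u w'", OF _ cd cu]) (use dmetric_linear i x in blast)
  ultimately show "continuous_on T F"
    unfolding F_def christoffel_first_kind_def by (intro continuous_intros) auto
  show "flat (g i (x t)) (christoffel g i (x t) (u t) v) = F t" if "t \<in> T" for t
    by (simp add: flat_def F_def christoffel[OF i x[OF that]])
qed

end

lemma has_vector_derivative_chain:
  assumes "(f has_derivative f') (at (x t))" "(x has_vector_derivative x') (at t)"
  shows "((\<lambda>s. f (x s)) has_vector_derivative f' x') (at t)"
  using has_derivative_compose[OF assms(2)[unfolded has_vector_derivative_def] assms(1)]
    has_derivative_linear[OF assms(1)]
  by (simp add: has_vector_derivative_def linear_cmul)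

lemma eventually_path_in_open:
  assumes "(x has_vector_derivative x') (at t)" "open S" "x t \<in> S"
  shows "\<forall>\<^sub>F s in nhds t. x s \<in> S"
proof -
  have "continuous (at t) x" using assms(1) has_vector_derivative_continuous by blast
  then have "(x \<longlongrightarrow> x t) (nhds t)" by (simp add: isCont_def tendsto_at_iff_tendsto_nhds)
  then show ?thesis using assms(2,3) topological_tendstoD by blast
qed

context pseudo_riemannian_manifold
begin

lemma metric_path_derivative:
  assumes i: "i \<in> charts M" and x: "(x has_vector_derivative x') (at t)" "x t \<in> cran M i"
    and V: "(V has_vector_derivative V') (at t)" and W: "(W has_vector_derivative W') (at t)"
  shows "((\<lambda>s. g i (x s) (V s) (W s)) has_vector_derivative
    dmetric i (x t) x' (V t) (W t) + g i (x t) V' (W t) + g i (x t) (V t) W') (at t)"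
proof -
  have ev: "\<forall>\<^sub>F s in nhds t. x s \<in> cran M i"
    by (rule eventually_path_in_open[OF x(1) cran_open[OF i] x(2)])
  have d: "((\<lambda>s. g i (x s) v w) has_vector_derivative dmetric i (x t) x' v w) (at t)" for v w
    by (rule has_vector_derivative_chain[OF dmetric(1)[OF i x(2)] x(1)])
  have "((\<lambda>s. g i (x s) (V s) w) has_vector_derivative dmetric i (x t) x' (V t) w + g i (x t) V' w) (at t)" for w
    by (rule linear_path_derivative[where L="\<lambda>s v. g i (x s) v w", OF _ d V])
      (rule eventually_mono[OF ev], use metric_linear i in blast)
  from linear_path_derivative[where L="\<lambda>s. g i (x s) (V s)", OF _ this W]
  show ?thesis using eventually_mono[OF ev, of "\<lambda>s. linear (g i (x s) (V s))"] metric_linear i by auto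
qed

lemma transition_path_derivative:
  assumes ij: "i \<in> charts M" "j \<in> charts M" and x: "(x has_vector_derivative x') (at t)" "x t \<in> overlap i j"
    and V: "(V has_vector_derivative V') (at t)"
  shows "((\<lambda>s. dtr i j (x s) (V s)) has_vector_derivative d2tr i j (x t) x' (V t) + dtr i j (x t) V') (at t)"
proof -
  have ev: "\<forall>\<^sub>F s in nhds t. linear (dtr i j (x s))"
    by (rule eventually_mono[OF eventually_path_in_open[OF x(1) overlap_open[OF ij] x(2)]])
      (rule dtr_linear[OF ij])
  have d: "((\<lambda>s. dtr i j (x s) v) has_vector_derivative d2tr i j (x t) x' v) (at t)" for v
    by (rule has_vector_derivative_chain[OF d2tr(1)[OF ij x(2)] x(1)])
  show ?thesis by (rule linear_path_derivative[OF ev d V])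
qed

text \<open>The transformation law of the metric, differentiated along the line \<open>x + s z\<close>.\<close>

lemma dmetric_transition:
  assumes ij: "i \<in> charts M" "j \<in> charts M" and p: "p \<in> cdom M i" "p \<in> cdom M j"
  defines "x \<equiv> coord M i p" and "y \<equiv> coord M j p"
  shows "dmetric i x z u v = dmetric j y (dtr i j x z) (dtr i j x u) (dtr i j x v)
    + g j y (d2tr i j x z u) (dtr i j x v) + g j y (dtr i j x u) (d2tr i j x z v)"
proof -
  let ?l = "\<lambda>s::real. x + s *\<^sub>R z"
  have l: "(?l has_vector_derivative z) (at 0)" by (auto intro!: derivative_eq_intros)
  have x: "x \<in> overlap i j" using p by (auto simp: x_def)
  have xi: "x \<in> cran M i" "y \<in> cran M j" using p by (auto simp: x_def y_def cran_def)
  have tx: "transition M i j x = y" using p ij by (simp add: x_def y_def transition_coord)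
  have d1: "((\<lambda>s. g i (?l s) u v) has_vector_derivative dmetric i x z u v) (at 0)"
    using has_vector_derivative_chain[OF dmetric(1)[OF ij(1)] l] xi by simp
  have t: "((\<lambda>s. transition M i j (?l s)) has_vector_derivative dtr i j x z) (at 0)"
    using has_vector_derivative_chain[OF dtr[OF ij] l] x by simp
  have D: "((\<lambda>s. dtr i j (?l s) w) has_vector_derivative d2tr i j x z w) (at 0)" for w
    using has_vector_derivative_chain[OF d2tr(1)[OF ij] l] x by simp
  have "((\<lambda>s. g j (transition M i j (?l s)) (dtr i j (?l s) u) (dtr i j (?l s) v)) has_vector_derivative
      dmetric j y (dtr i j x z) (dtr i j x u) (dtr i j x v)
    + g j y (d2tr i j x z u) (dtr i j x v) + g j y (dtr i j x u) (d2tr i j x z v)) (at 0)"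
    using metric_path_derivative[OF ij(2) t _ D D] tx xi by simp
  moreover have "\<forall>\<^sub>F s in nhds 0. ?l s \<in> overlap i j"
    by (rule eventually_path_in_open[OF l overlap_open[OF ij]]) (use x in simp)
  then have "\<forall>\<^sub>F s in nhds 0. g j (transition M i j (?l s)) (dtr i j (?l s) u) (dtr i j (?l s) v) = g i (?l s) u v"
  proof (rule eventually_mono)
    fix s assume "?l s \<in> overlap i j"
    then obtain q where q: "q \<in> cdom M i" "q \<in> cdom M j" "?l s = coord M i q" by auto
    show "g j (transition M i j (?l s)) (dtr i j (?l s) u) (dtr i j (?l s) v) = g i (?l s) u v"
      unfolding q(3) using q(1,2) ij by (simp add: transition_coord metric_transition[of i j q])
  qed
  ultimately have "((\<lambda>s. g i (?l s) u v) has_vector_derivative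
      dmetric j y (dtr i j x z) (dtr i j x u) (dtr i j x v)
    + g j y (d2tr i j x z u) (dtr i j x v) + g j y (dtr i j x u) (d2tr i j x z v)) (at 0)"
    by (subst (asm) has_vector_derivative_cong_ev[where g="\<lambda>s. g i (?l s) u v"])
      (auto elim: eventually_mono dest: eventually_nhds_x_imp_x)
  from vector_derivative_unique_at[OF d1 this] show ?thesis .
qed

text \<open>
  In the alternating sum that defines the symbols of the first kind, the terms of \<open>dmetric_transition\<close> with
  second derivatives cancel by symmetry except for the two with \<open>d2tr i j x u v\<close>; this leaves the familiar inhomogeneous
  term.
\<close>

lemma christoffel_transition:
  assumes ij: "i \<in> charts M" "j \<in> charts M" and p: "p \<in> cdom M i" "p \<in> cdom M j"
  defines "x \<equiv> coord M i p" and "y \<equiv> coord M j p"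
  shows "dtr i j x (christoffel g i x u v) = christoffel g j y (dtr i j x u) (dtr i j x v) + d2tr i j x u v"
proof -
  let ?P = "dtr i j x" and ?D = "d2tr i j x"
  have x: "x \<in> overlap i j" using p by (auto simp: x_def)
  have xi: "x \<in> cran M i" "y \<in> cran M j" using p by (auto simp: x_def y_def cran_def)
  note dm = dmetric_transition[OF ij p, folded x_def y_def]
  note sym = metric_sym[OF ij(2) xi(2)] d2tr_sym[OF ij x]
  have "christoffel g j y (?P u) (?P v) = ?P (christoffel g i x u v) - ?D u v"
  proof (rule christoffel_unique[OF ij(2) xi(2)])
    fix w
    obtain z where w: "w = ?P z" using dtr_inverse[of j i p w] ij p by (auto simp: x_def y_def) metis
    have "christoffel_first_kind g i x u v z
        = christoffel_first_kind g j y (?P u) (?P v) (?P z) + g j y (?D u v) (?P z)"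
      unfolding christoffel_first_kind_def dm
        sym(1)[of "?P u" "?D v z"] sym(1)[of "?P v" "?D u z"] sym(1)[of "?P u" "?D z v"]
        sym(1)[of "?P v" "?D z u"] arg_cong[OF sym(2)[of u v], of "\<lambda>a. g j y a (?P z)"]
        arg_cong[OF sym(2)[of z u], of "\<lambda>a. g j y a (?P v)"]
        arg_cong[OF sym(2)[of z v], of "\<lambda>a. g j y a (?P u)"]
      by simp
    moreover have "christoffel_first_kind g i x u v z = g j y (?P (christoffel g i x u v)) (?P z)"
      using christoffel[OF ij(1) xi(1)] metric_transition[OF ij p] by (simp add: x_def y_def)
    ultimately show "g j y (?P (christoffel g i x u v) - ?D u v) w = christoffel_first_kind g j y (?P u) (?P v) w"
      using linear_diff[OF metric_linear(2)[OF ij(2) xi(2)]] by (simp add: w)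
  qed
  then show ?thesis by simp
qed

section \<open>Tangent vectors and covariant derivatives\<close>

text \<open>The tangent vector at \<open>p\<close> with the components \<open>x\<close> in the chart \<open>i\<close>.\<close>

definition lift_vector :: "'i \<Rightarrow> 'a \<Rightarrow> 'e \<Rightarrow> ('i, 'e) tangent" where
  "lift_vector i p x = (\<lambda>j. if j \<in> charts M \<and> p \<in> cdom M j then dtr i j (coord M i p) x else 0)"

lemma lift_vector_tangent:
  assumes "i \<in> charts M" "p \<in> cdom M i"
  shows "lift_vector i p x \<in> tangent_space M p"
proof -
  have "lift_vector i p x k = dtr j k (coord M j p) (lift_vector i p x j)"
    if "j \<in> charts M" "k \<in> charts M" "p \<in> cdom M j \<inter> cdom M k" for j k
    using that dtr_cocycle[OF assms(1) that(1,2) assms(2), of x] by (simp add: lift_vector_def)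
  moreover have "lift_vector i p x k = 0" if "\<not> (k \<in> charts M \<and> p \<in> cdom M k)" for k
    using that by (simp only: lift_vector_def if_False)
  ultimately show ?thesis unfolding tangent_space_def by blast
qed

lemma lift_vector_self: "i \<in> charts M \<Longrightarrow> p \<in> cdom M i \<Longrightarrow> lift_vector i p x i = x"
  by (simp add: lift_vector_def dtr_id)

lemma tangent_transition:
  "v \<in> tangent_space M p \<Longrightarrow> i \<in> charts M \<Longrightarrow> j \<in> charts M \<Longrightarrow> p \<in> cdom M i \<Longrightarrow> p \<in> cdom M j \<Longrightarrow>
    v j = dtr i j (coord M i p) (v i)"
  unfolding tangent_space_def by blast

lemma tangent_eqI:
  assumes "v \<in> tangent_space M p" "w \<in> tangent_space M p" "i \<in> charts M" "p \<in> cdom M i" "v i = w i"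
  shows "v = w"
proof
  fix j
  show "v j = w j"
  proof (cases "j \<in> charts M \<and> p \<in> cdom M j")
    case True
    then show ?thesis using tangent_transition[OF assms(1) assms(3), of j] tangent_transition[OF assms(2) assms(3), of j] assms(4,5) by metis
  next
    case False
    then have "v j = 0" "w j = 0" using assms(1,2) unfolding tangent_space_def by blast+
    then show ?thesis by simp
  qed
qed

lemma metric_at_chart:
  assumes "v \<in> tangent_space M p" "w \<in> tangent_space M p" "i \<in> charts M" "p \<in> cdom M i"
  shows "metric_at M g p v w = g i (coord M i p) (v i) (w i)"
proof -
  define j where "j = (SOME i. i \<in> charts M \<and> p \<in> cdom M i)"
  have j: "j \<in> charts M \<and> p \<in> cdom M j" unfolding j_def by (rule someI[of _ i]) (use assms in auto)
  have "metric_at M g p v w = g j (coord M j p) (v j) (w j)"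
    by (simp add: metric_at_def j_def Let_def)
  also have "\<dots> = g i (coord M i p) (v i) (w i)"
    using metric_transition[of j i p "v j" "w j"] tangent_transition[of v p j i] tangent_transition[of w p j i] j assms
    by metis
  finally show ?thesis .
qed

text \<open>
  Differentiating \<open>V\<^sub>j = D V\<^sub>i\<close>, where \<open>D\<close> is the differential of the transition map along the curve, produces a second derivative
  that is exactly the inhomogeneous term of \<open>christoffel_transition\<close>.
\<close>

lemma cov_deriv_transition:
  assumes ij: "i \<in> charts M" "j \<in> charts M" and p: "c t \<in> cdom M i" "c t \<in> cdom M j"
    and ev: "\<forall>\<^sub>F s in nhds t. V s j = dtr i j (coord M i (c s)) (V s i)"
    and x: "((\<lambda>s. coord M i (c s)) has_vector_derivative x') (at t)"
    and V: "((\<lambda>s. V s i) has_vector_derivative - christoffel g i (coord M i (c t)) x' (V t i)) (at t)"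
  shows "((\<lambda>s. V s j) has_vector_derivative
    - christoffel g j (coord M j (c t)) (dtr i j (coord M i (c t)) x') (V t j)) (at t)"
proof -
  let ?x = "coord M i (c t)"
  have ev': "\<forall>\<^sub>F s in nhds t. s \<in> UNIV \<longrightarrow> V s j = dtr i j (coord M i (c s)) (V s i)" using ev by simp
  have Vj: "V t j = dtr i j ?x (V t i)" using ev by (rule eventually_nhds_x_imp_x)
  have ov: "?x \<in> overlap i j" using p by auto
  have "((\<lambda>s. dtr i j (coord M i (c s)) (V s i)) has_vector_derivative
      d2tr i j ?x x' (V t i) + dtr i j ?x (- christoffel g i ?x x' (V t i))) (at t)"
    by (rule transition_path_derivative[OF ij x ov V])
  also have "d2tr i j ?x x' (V t i) + dtr i j ?x (- christoffel g i ?x x' (V t i))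
      = - christoffel g j (coord M j (c t)) (dtr i j ?x x') (V t j)"
    using christoffel_transition[OF ij p, of x' "V t i"] linear_neg[OF dtr_linear[OF ij ov]] by (simp add: Vj)
  finally show ?thesis
    using has_vector_derivative_cong_ev[OF ev' Vj] by blast
qed

section \<open>Parallel transport\<close>

lemma topspace_chart: "p \<in> topspace (mtop M) \<Longrightarrow> \<exists>i\<in>charts M. p \<in> cdom M i"
  by (simp add: topspace_charts)

lemma curve_in_topspace:
  "continuous_map (top_of_set J) (mtop M) c \<Longrightarrow> t \<in> J \<Longrightarrow> c t \<in> topspace (mtop M)"
  by (metis continuous_map_image_subset_topspace image_subset_iff topspace_euclidean_subtopology)

lemma curve_preimage_openin:
  assumes "continuous_map (top_of_set J) (mtop M) c" "openin (mtop M) U"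
  shows "openin (top_of_set J) {t \<in> J. c t \<in> U}"
  using openin_continuous_map_preimage[OF assms] by simp

lemma curve_preimage_open:
  assumes "continuous_map (top_of_set J) (mtop M) c" "open J" "openin (mtop M) U"
  shows "open {t \<in> J. c t \<in> U}"
  using curve_preimage_openin[OF assms(1,3)] openin_open_trans assms(2) by blast

lemma smooth_curve_derivative:
  assumes c: "smooth_curve_on M J c" and i: "i \<in> charts M" and t: "t \<in> J" "c t \<in> cdom M i"
  shows "((\<lambda>s. coord M i (c s)) has_vector_derivative velocity M c t i) (at t)"
proof -
  have "Ck_on (Suc 0) {t \<in> J. c t \<in> cdom M i} (\<lambda>t. coord M i (c t))"
    using c i unfolding smooth_curve_on_def smooth_on_def by blast
  then have "(\<lambda>t. coord M i (c t)) differentiable at t" using t by simp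
  then show ?thesis using i t by (simp add: velocity_def vector_derivative_works)
qed

lemma smooth_curve_velocity_continuous:
  assumes c: "smooth_curve_on M J c" and i: "i \<in> charts M"
  shows "continuous_on {t \<in> J. c t \<in> cdom M i} (\<lambda>t. velocity M c t i)"
proof -
  have "Ck_on (Suc 0) {t \<in> J. c t \<in> cdom M i} (\<lambda>t. coord M i (c t))"
    using c i unfolding smooth_curve_on_def smooth_on_def by blast
  then have d: "\<And>t. t \<in> J \<Longrightarrow> c t \<in> cdom M i \<Longrightarrow> (\<lambda>t. coord M i (c t)) differentiable at t"
    and ct: "continuous_on {t \<in> J. c t \<in> cdom M i} (\<lambda>t. frechet_derivative (\<lambda>t. coord M i (c t)) (at t) 1)"
    by auto
  show ?thesis
    by (rule continuous_on_eq[OF ct]) (use d i in \<open>auto simp: velocity_def frechet_derivative_eq_vector_derivative\<close>)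
qed

lemma curve_coord_continuous:
  assumes "continuous_map (top_of_set J) (mtop M) c" "i \<in> charts M"
  shows "continuous_on {t \<in> J. c t \<in> cdom M i} (\<lambda>t. coord M i (c t))"
proof -
  have "continuous_map (top_of_set {t \<in> J. c t \<in> cdom M i}) (mtop M) c"
    by (rule continuous_map_from_subtopology_mono[OF assms(1)]) auto
  then have "continuous_map (top_of_set {t \<in> J. c t \<in> cdom M i}) (subtopology (mtop M) (cdom M i)) c"
    by (auto simp: continuous_map_in_subtopology)
  from continuous_map_compose[OF this coord_continuous[OF assms(2)]]
  show ?thesis by (simp add: o_def)
qed

lemma velocity_transition:
  assumes ij: "i \<in> charts M" "j \<in> charts M" and p: "c t \<in> cdom M i" "c t \<in> cdom M j"
    and N: "open N" "t \<in> N" "\<And>s. s \<in> N \<Longrightarrow> c s \<in> cdom M i"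
    and d: "((\<lambda>s. coord M i (c s)) has_vector_derivative velocity M c t i) (at t)"
  shows "velocity M c t j = dtr i j (coord M i (c t)) (velocity M c t i)"
proof -
  have "((\<lambda>s. transition M i j (coord M i (c s))) has_vector_derivative
      dtr i j (coord M i (c t)) (velocity M c t i)) (at t)"
    by (rule has_vector_derivative_chain[OF dtr[OF ij] d]) (use p in auto)
  then have "((\<lambda>s. coord M j (c s)) has_vector_derivative
      dtr i j (coord M i (c t)) (velocity M c t i)) (at t)"
    by (rule has_vector_derivative_transform_within_open[OF _ N(1,2)]) (simp add: transition_coord ij N(3))
  then show ?thesis using ij p by (simp add: velocity_def vector_derivative_at)
qed

text \<open>Whether a field along a curve is parallel at \<open>t\<close> may be checked in a single chart.\<close>

lemma cov_deriv_zeroI: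
  assumes i: "i \<in> charts M" and p: "c t \<in> cdom M i"
    and N: "open N" "t \<in> N" "\<And>s. s \<in> N \<Longrightarrow> c s \<in> cdom M i" "\<And>s. s \<in> N \<Longrightarrow> V s \<in> tangent_space M (c s)"
    and pre: "\<And>j. j \<in> charts M \<Longrightarrow> c t \<in> cdom M j \<Longrightarrow> \<exists>N. open N \<and> t \<in> N \<and> (\<forall>s\<in>N. c s \<in> cdom M j)"
    and d: "((\<lambda>s. coord M i (c s)) has_vector_derivative velocity M c t i) (at t)"
    and V: "((\<lambda>s. V s i) has_vector_derivative
      - christoffel g i (coord M i (c t)) (velocity M c t i) (V t i)) (at t)"
  shows "cov_deriv_zero M g c V t"
  unfolding cov_deriv_zero_def
proof (intro ballI impI)
  fix j assume j: "j \<in> charts M" "c t \<in> cdom M j"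
  obtain N' where N': "open N'" "t \<in> N'" "\<forall>s\<in>N'. c s \<in> cdom M j" using pre[OF j] by blast
  have "\<forall>\<^sub>F s in nhds t. s \<in> N \<inter> N'" using N N' by (intro eventually_nhds_in_open) auto
  then have ev: "\<forall>\<^sub>F s in nhds t. V s j = dtr i j (coord M i (c s)) (V s i)"
    by (rule eventually_mono) (use tangent_transition i j N N' in blast)
  have "((\<lambda>s. V s j) has_vector_derivative
    - christoffel g j (coord M j (c t)) (dtr i j (coord M i (c t)) (velocity M c t i)) (V t j)) (at t)"
    by (rule cov_deriv_transition[OF i j(1) p j(2) ev d V])
  then show "((\<lambda>s. V s j) has_vector_derivative
    - christoffel g j (coord M j (c t)) (velocity M c t j) (V t j)) (at t)"
    using velocity_transition[OF i j(1) p j(2) N(1-3) d] by simp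
qed

definition parallel_between :: "real \<Rightarrow> real \<Rightarrow> (real \<Rightarrow> 'a) \<Rightarrow> (real \<Rightarrow> ('i, 'e) tangent) \<Rightarrow> bool" where
  "parallel_between a b c V \<longleftrightarrow>
     (\<forall>t\<in>{a..b}. V t \<in> tangent_space M (c t)) \<and>
     (\<forall>i\<in>charts M. continuous_on {t \<in> {a..b}. c t \<in> cdom M i} (\<lambda>t. V t i)) \<and>
     (\<exists>S. finite S \<and> (\<forall>t\<in>{a<..<b} - S. cov_deriv_zero M g c V t))"

lemma parallel_along_between: "parallel_along M g c V \<longleftrightarrow> parallel_between 0 1 c V"
  by (simp add: parallel_along_def parallel_between_def)

text \<open>
  In one chart the equation of parallel fields is a linear differential equation with continuous
  coefficients. The solution is lifted to all charts at once, so that it is a tangent vector by construction.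
\<close>

lemma local_parallel_transport:
  assumes J: "open J" and c: "smooth_curve_on M J c" and t0: "t0 \<in> J"
  shows "\<exists>d>0. \<forall>a b. t0 - d \<le> a \<and> a \<le> b \<and> b \<le> t0 + d \<longrightarrow>
    (\<forall>v\<in>tangent_space M (c a). \<exists>V. parallel_between a b c V \<and> V a = v)"
proof -
  have cc: "continuous_map (top_of_set J) (mtop M) c" using c by (simp add: smooth_curve_on_def)
  obtain i where i: "i \<in> charts M" "c t0 \<in> cdom M i"
    using topspace_chart[OF curve_in_topspace[OF cc t0]] by blast
  let ?D = "{t \<in> J. c t \<in> cdom M i}"
  have "open ?D" by (rule curve_preimage_open[OF cc J cdom_open[OF i(1)]])
  then obtain d0 where d0: "d0 > 0" "cball t0 d0 \<subseteq> ?D" using t0 i open_contains_cball by (metis (mono_tags, lifting) mem_Collect_eq)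
  let ?x = "\<lambda>t. coord M i (c t)" and ?x' = "\<lambda>t. velocity M c t i"
  define A where "A t w = - christoffel g i (?x t) (?x' t) w" for t w
  have cran: "?x t \<in> cran M i" if "t \<in> ?D" for t using that by (auto simp: cran_def)
  have cont: "continuous_on ?D (\<lambda>t. A t w)" for w
    unfolding A_def by (intro continuous_on_minus continuous_christoffel i cran curve_coord_continuous cc
        smooth_curve_velocity_continuous[OF c])
  have lin: "linear (A t)" if "t \<in> ?D" for t
    unfolding A_def using linear_compose_neg[OF christoffel_linear[OF i(1) cran[OF that], of "?x' t"]] .
  obtain K where K: "K > 0" "\<And>t w. t \<in> cball t0 d0 \<Longrightarrow> norm (A t w) \<le> K * norm w"
    by (rule linear_family_bound[of "cball t0 d0" A])
      (use lin d0 in \<open>auto intro: continuous_on_subset[OF cont]\<close>)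
  define d where "d = min d0 (1 / (4 * K))"
  have d: "d > 0" "d \<le> d0" "K * (2 * d) \<le> 1/2"
    using d0 K by (auto simp: d_def min_def field_simps)
  have "\<exists>V. parallel_between a b c V \<and> V a = v"
    if ab: "t0 - d \<le> a" "a \<le> b" "b \<le> t0 + d" and v: "v \<in> tangent_space M (c a)" for a b v
  proof -
    have sub: "{a..b} \<subseteq> cball t0 d0" using ab d by (auto simp: dist_real_def)
    then have subD: "{a..b} \<subseteq> ?D" using d0 by blast
    have Kab: "K * (b - a) \<le> 1/2"
      using mult_left_mono[of "b - a" "2 * d" K] ab d K by linarith
    obtain y where y: "y a = v i" "\<And>t. t \<in> {a..b} \<Longrightarrow> (y has_vector_derivative A t (y t)) (at t within {a..b})"
      by (rule linear_ode_short_interval[of a b K A "v i"])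
        (use ab K Kab lin sub subD in \<open>auto intro: continuous_on_subset[OF cont]\<close>)
    have cy: "continuous_on {a..b} y"
      using y(2) by (meson continuous_on_eq_continuous_within has_vector_derivative_continuous)
    define V where "V t = lift_vector i (c t) (y t)" for t
    have ti: "c t \<in> cdom M i" "t \<in> J" if "t \<in> {a..b}" for t using that subD by auto
    have tan: "V t \<in> tangent_space M (c t)" if "t \<in> {a..b}" for t
      unfolding V_def by (rule lift_vector_tangent[OF i(1) ti(1)[OF that]])
    have Vi: "V t i = y t" if "t \<in> {a..b}" for t
      unfolding V_def by (rule lift_vector_self[OF i(1) ti(1)[OF that]])
    have "V a = v"
      by (rule tangent_eqI[OF tan v i(1) ti(1)]) (use ab Vi[of a] y(1) in auto)
    moreover have "continuous_on {t \<in> {a..b}. c t \<in> cdom M j} (\<lambda>t. V t j)" if j: "j \<in> charts M" for j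
    proof -
      let ?S = "{t \<in> {a..b}. c t \<in> cdom M j}"
      have ov: "?x t \<in> overlap i j" if "t \<in> ?S" for t using that ti by auto
      have cx: "continuous_on ?S ?x"
        by (rule continuous_on_subset[OF curve_coord_continuous[OF cc i(1)]]) (use subD in auto)
      have cD: "continuous_on (overlap i j) (\<lambda>x. dtr i j x w)" for w
      proof -
        have "Ck_on (Suc 0) (overlap i j) (transition M i j)"
          using transition_smooth[OF i(1) j] unfolding smooth_on_def by blast
        then show ?thesis by simp
      qed
      have "continuous_on ?S (\<lambda>t. dtr i j (?x t) (y t))"
      proof (rule linear_path_continuous[where L="\<lambda>t. dtr i j (?x t)"])
        show "linear (dtr i j (?x t))" if "t \<in> ?S" for t using dtr_linear[OF i(1) j ov[OF that]] .
        show "continuous_on ?S (\<lambda>t. dtr i j (?x t) w)" for w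
          by (rule continuous_on_compose2[OF cD cx]) (use ov in blast)
        show "continuous_on ?S y" by (rule continuous_on_subset[OF cy]) auto
      qed
      then show ?thesis by (rule continuous_on_eq) (simp add: V_def lift_vector_def j)
    qed
    moreover have "cov_deriv_zero M g c V t" if t: "t \<in> {a<..<b} - {}" for t
    proof (rule cov_deriv_zeroI[OF i(1), where N="{a<..<b}"])
      have t': "t \<in> {a..b}" using t by auto
      show "c t \<in> cdom M i" using ti[OF t'] by simp
      show "\<exists>N. open N \<and> t \<in> N \<and> (\<forall>s\<in>N. c s \<in> cdom M j)" if "j \<in> charts M" "c t \<in> cdom M j" for j
        by (rule exI[of _ "{t \<in> J. c t \<in> cdom M j}"])
          (use curve_preimage_open[OF cc J cdom_open[OF that(1)]] that ti[OF t'] in auto)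
      show "((\<lambda>s. coord M i (c s)) has_vector_derivative ?x' t) (at t)"
        by (rule smooth_curve_derivative[OF c i(1)]) (use ti[OF t'] in auto)
      have "(y has_vector_derivative A t (y t)) (at t within {a<..<b})"
        by (rule has_vector_derivative_within_subset[OF y(2)[OF t']]) auto
      moreover have "at t within {a<..<b} = at t" by (rule at_within_open) (use t in auto)
      ultimately have "(y has_vector_derivative A t (y t)) (at t)" by metis
      then have "((\<lambda>s. V s i) has_vector_derivative A t (y t)) (at t)"
        by (rule has_vector_derivative_transform_within_open[of _ _ _ "{a<..<b}"]) (use t Vi in auto)
      then show "((\<lambda>s. V s i) has_vector_derivative - christoffel g i (?x t) (?x' t) (V t i)) (at t)"
        using Vi[OF t'] by (simp add: A_def)
    qed (use t ti tan in auto)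
    ultimately have "parallel_between a b c V"
      using tan unfolding parallel_between_def by (intro conjI ballI exI[of _ "{}"]) auto
    with \<open>V a = v\<close> show ?thesis by blast
  qed
  then show ?thesis using d(1) by blast
qed

lemma cov_deriv_zero_cong:
  assumes N: "open N" "t \<in> N" "\<And>s. s \<in> N \<Longrightarrow> c s = c' s" "\<And>s. s \<in> N \<Longrightarrow> V s = V' s"
    and z: "cov_deriv_zero M g c V t"
  shows "cov_deriv_zero M g c' V' t"
proof -
  have ev: "\<forall>\<^sub>F s in nhds t. s \<in> N" using N by (intro eventually_nhds_in_open)
  have "vector_derivative (\<lambda>s. coord M i (c s)) (at t) = vector_derivative (\<lambda>s. coord M i (c' s)) (at t)" for i
    by (rule vector_derivative_cong_eq) (use N ev in \<open>auto elim!: eventually_mono\<close>)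
  then have vel: "velocity M c t = velocity M c' t"
    unfolding velocity_def N(3)[OF N(2)] by (intro ext) metis
  show ?thesis unfolding cov_deriv_zero_def
  proof (intro ballI impI)
    fix i assume i: "i \<in> charts M" "c' t \<in> cdom M i"
    then have "((\<lambda>s. V s i) has_vector_derivative
        - christoffel g i (coord M i (c' t)) (velocity M c' t i) (V' t i)) (at t)"
      using z N(3)[OF N(2)] N(4)[OF N(2)] vel by (auto simp: cov_deriv_zero_def)
    then show "((\<lambda>s. V' s i) has_vector_derivative
        - christoffel g i (coord M i (c' t)) (velocity M c' t i) (V' t i)) (at t)"
      by (rule has_vector_derivative_transform_within_open[OF _ N(1,2)]) (simp add: N)
  qed
qed

lemma parallel_between_cong:
  assumes "parallel_between a b c V" "\<And>t. t \<in> {a..b} \<Longrightarrow> c t = c' t" "\<And>t. t \<in> {a..b} \<Longrightarrow> V t = V' t"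
  shows "parallel_between a b c' V'"
proof -
  obtain S where S: "finite S" "\<And>t. t \<in> {a<..<b} - S \<Longrightarrow> cov_deriv_zero M g c V t"
    using assms(1) by (auto simp: parallel_between_def)
  have "cov_deriv_zero M g c' V' t" if "t \<in> {a<..<b} - S" for t
    by (rule cov_deriv_zero_cong[of "{a<..<b}" t c c' V V']) (use that assms S in auto)
  moreover have "V' t \<in> tangent_space M (c' t)" if "t \<in> {a..b}" for t
    using assms that by (metis parallel_between_def)
  moreover have "continuous_on {t \<in> {a..b}. c' t \<in> cdom M i} (\<lambda>t. V' t i)" if "i \<in> charts M" for i
  proof -
    have "{t \<in> {a..b}. c' t \<in> cdom M i} = {t \<in> {a..b}. c t \<in> cdom M i}" using assms by auto
    moreover have "continuous_on {t \<in> {a..b}. c t \<in> cdom M i} (\<lambda>t. V t i)"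
      using assms(1) that unfolding parallel_between_def by blast
    ultimately have "continuous_on {t \<in> {a..b}. c' t \<in> cdom M i} (\<lambda>t. V t i)" by metis
    then show ?thesis by (rule continuous_on_eq) (use assms(3) in auto)
  qed
  ultimately show ?thesis using S(1) unfolding parallel_between_def by blast
qed

lemma parallel_between_glue:
  assumes V: "parallel_between a b c V" and W: "parallel_between b d c W" and "V b = W b" "a \<le> b" "b \<le> d"
  shows "parallel_between a d c (\<lambda>t. if t \<le> b then V t else W t)"
proof -
  let ?U = "\<lambda>t. if t \<le> b then V t else W t"
  obtain S where S: "finite S" "\<And>t. t \<in> {a<..<b} - S \<Longrightarrow> cov_deriv_zero M g c V t"
    using V by (auto simp: parallel_between_def)
  obtain S' where S': "finite S'" "\<And>t. t \<in> {b<..<d} - S' \<Longrightarrow> cov_deriv_zero M g c W t"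
    using W by (auto simp: parallel_between_def)
  have "cov_deriv_zero M g c ?U t" if t: "t \<in> {a<..<d} - (insert b (S \<union> S'))" for t
  proof (cases "t < b")
    case True
    show ?thesis by (rule cov_deriv_zero_cong[of "{a<..<b}" t c c V]) (use t True S in auto)
  next
    case False
    show ?thesis by (rule cov_deriv_zero_cong[of "{b<..<d}" t c c W]) (use t False S' in auto)
  qed
  moreover have "?U t \<in> tangent_space M (c t)" if "t \<in> {a..d}" for t
    using V W that by (auto simp: parallel_between_def)
  moreover have "continuous_on {t \<in> {a..d}. c t \<in> cdom M i} (\<lambda>t. ?U t i)" if i: "i \<in> charts M" for i
  proof -
    have "continuous_on {t \<in> {a..d}. c t \<in> cdom M i} (\<lambda>t. if t \<le> b then V t i else W t i)"
    proof (rule continuous_on_cases_le[where h="\<lambda>t. t"])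
      show "continuous_on {t \<in> {t \<in> {a..d}. c t \<in> cdom M i}. t \<le> b} (\<lambda>t. V t i)"
        by (rule continuous_on_subset[of "{t \<in> {a..b}. c t \<in> cdom M i}"])
          (use V i in \<open>auto simp: parallel_between_def\<close>)
      show "continuous_on {t \<in> {t \<in> {a..d}. c t \<in> cdom M i}. b \<le> t} (\<lambda>t. W t i)"
        by (rule continuous_on_subset[of "{t \<in> {b..d}. c t \<in> cdom M i}"])
          (use W i in \<open>auto simp: parallel_between_def\<close>)
    qed (use assms in \<open>auto intro: continuous_intros\<close>)
    then show ?thesis by (rule continuous_on_eq) auto
  qed
  ultimately show ?thesis using S(1) S'(1) unfolding parallel_between_def
    by (meson finite.insertI finite_UnI)
qed

text \<open>Existence of transport is transitive and locally true, so it propagates to the whole interval by bisection.\<close>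

lemma smooth_arc_parallel_transport:
  assumes c: "smooth_arc M a b c" and "a \<le> b" and v: "v \<in> tangent_space M (c a)"
  shows "\<exists>V. parallel_between a b c V \<and> V a = v"
proof -
  obtain J c' where J: "open J" "{a..b} \<subseteq> J" "smooth_curve_on M J c'" and c': "\<And>t. t \<in> {a..b} \<Longrightarrow> c' t = c t"
    using c by (auto simp: smooth_arc_def)
  define P where "P s t \<longleftrightarrow> (\<forall>v\<in>tangent_space M (c' s). \<exists>V. parallel_between s t c' V \<and> V s = v)" for s t
  have "P a b"
  proof (rule Bolzano[OF \<open>a \<le> b\<close>])
    fix r s t assume P: "P r s" "P s t" and rst: "r \<le> s" "s \<le> t"
    show "P r t" unfolding P_def
    proof
      fix v assume "v \<in> tangent_space M (c' r)"
      then obtain V where V: "parallel_between r s c' V" "V r = v" using P(1) by (auto simp: P_def)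
      then have "V s \<in> tangent_space M (c' s)" using rst by (auto simp: parallel_between_def)
      then obtain W where W: "parallel_between s t c' W" "W s = V s" using P(2) by (auto simp: P_def)
      from parallel_between_glue[OF V(1) W(1) W(2)[symmetric] rst] V(2) rst
      show "\<exists>V. parallel_between r t c' V \<and> V r = v"
        by (intro exI[of _ "\<lambda>u. if u \<le> s then V u else W u"]) auto
    qed
  next
    fix t assume t: "a \<le> t" "t \<le> b"
    then obtain d where d: "d > 0" "\<And>r s v. t - d \<le> r \<Longrightarrow> r \<le> s \<Longrightarrow> s \<le> t + d \<Longrightarrow> v \<in> tangent_space M (c' r) \<Longrightarrow>
        \<exists>V. parallel_between r s c' V \<and> V r = v"
      using local_parallel_transport[OF J(1,3), of t] J(2) by (metis atLeastAtMost_iff subset_iff)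
    show "\<exists>d>0. \<forall>r s. r \<le> t \<and> t \<le> s \<and> s - r < d \<longrightarrow> P r s"
      by (rule exI[of _ d]) (use d in \<open>auto simp: P_def\<close>)
  qed
  moreover have "v \<in> tangent_space M (c' a)" using v c' \<open>a \<le> b\<close> by simp
  ultimately obtain V where "parallel_between a b c' V" "V a = v" by (auto simp: P_def)
  then show ?thesis using parallel_between_cong[of a b c' V c V] c' by blast
qed

end

section \<open>Reparametrization and concatenation\<close>

lemma affine_image_interval:
  fixes \<alpha> \<beta> a b :: real
  assumes "\<alpha> \<noteq> 0" "a < b"
  defines "l \<equiv> min (\<beta> + a * \<alpha>) (\<beta> + b * \<alpha>)" and "h \<equiv> max (\<beta> + a * \<alpha>) (\<beta> + b * \<alpha>)"
  shows "l < h" "\<And>t. t \<in> {a..b} \<Longrightarrow> \<beta> + t * \<alpha> \<in> {l..h}"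
    "\<And>t. \<beta> + t * \<alpha> \<in> {l<..<h} \<Longrightarrow> t \<in> {a<..<b}"
    "\<And>t. t \<in> {a<..<b} \<Longrightarrow> \<beta> + t * \<alpha> \<in> {l<..<h}"
proof -
  consider "\<alpha> > 0" | "\<alpha> < 0" using assms(1) by linarith
  then have "l < h \<and> (\<forall>t. t \<in> {a..b} \<longrightarrow> \<beta> + t * \<alpha> \<in> {l..h}) \<and> (\<forall>t. \<beta> + t * \<alpha> \<in> {l<..<h} \<longrightarrow> t \<in> {a<..<b})
      \<and> (\<forall>t. t \<in> {a<..<b} \<longrightarrow> \<beta> + t * \<alpha> \<in> {l<..<h})"
  proof cases
    case 1
    have lh: "l = \<beta> + a * \<alpha>" "h = \<beta> + b * \<alpha>" using 1 assms by (auto simp: l_def h_def mult_right_mono)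
    then show ?thesis using 1 assms by auto
  next
    case 2
    have "a * \<alpha> > b * \<alpha>" using 2 assms by simp
    then have lh: "l = \<beta> + b * \<alpha>" "h = \<beta> + a * \<alpha>" by (auto simp: l_def h_def)
    then show ?thesis using 2 assms by (auto simp: mult_le_cancel_right mult_less_cancel_right)
  qed
  then show "l < h" "\<And>t. t \<in> {a..b} \<Longrightarrow> \<beta> + t * \<alpha> \<in> {l..h}"
    "\<And>t. \<beta> + t * \<alpha> \<in> {l<..<h} \<Longrightarrow> t \<in> {a<..<b}"
    "\<And>t. t \<in> {a<..<b} \<Longrightarrow> \<beta> + t * \<alpha> \<in> {l<..<h}" by blast+
qed

lemma open_affine_preimage: "open J \<Longrightarrow> open {t::real. \<beta> + t * \<alpha> \<in> J}"
  using open_vimage[of J "\<lambda>t. \<beta> + t * \<alpha>"] by (simp add: vimage_def continuous_intros)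

lemma finite_affine_preimage: "\<alpha> \<noteq> 0 \<Longrightarrow> finite S \<Longrightarrow> finite {t::real. \<beta> + t * \<alpha> \<in> S}"
  using finite_vimageI[of S "\<lambda>t. \<beta> + t * \<alpha>"] by (simp add: vimage_def inj_on_def)

text \<open>The single affine reparametrization covers reversal, the two halves of a concatenation and the rescaling of geodesics.\<close>

definition reparam :: "real \<Rightarrow> real \<Rightarrow> (real \<Rightarrow> 'b) \<Rightarrow> real \<Rightarrow> 'b" where
  "reparam \<beta> \<alpha> c = (\<lambda>t. c (\<beta> + t * \<alpha>))"

definition join_curves :: "(real \<Rightarrow> 'b) \<Rightarrow> (real \<Rightarrow> 'b) \<Rightarrow> real \<Rightarrow> 'b" where
  "join_curves c d = (\<lambda>t. if t \<le> 1/2 then c (0 + t * 2) else d (- 1 + t * 2))"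

context pseudo_riemannian_manifold
begin

definition smooth_at :: "(real \<Rightarrow> 'a) \<Rightarrow> real \<Rightarrow> bool" where
  "smooth_at c t \<longleftrightarrow> (\<forall>i\<in>charts M. c t \<in> cdom M i \<longrightarrow>
     ((\<lambda>s. coord M i (c s)) has_vector_derivative velocity M c t i) (at t))"

definition piecewise_smooth_between :: "real \<Rightarrow> real \<Rightarrow> (real \<Rightarrow> 'a) \<Rightarrow> bool" where
  "piecewise_smooth_between a b c \<longleftrightarrow> continuous_map (top_of_set {a..b}) (mtop M) c \<and>
     (\<exists>S. finite S \<and> (\<forall>a' b'. a \<le> a' \<and> a' < b' \<and> b' \<le> b \<and> {a'<..<b'} \<inter> S = {} \<longrightarrow> smooth_arc M a' b' c))"

lemma piecewise_smooth_path_between: "piecewise_smooth_path M c \<longleftrightarrow> piecewise_smooth_between 0 1 c"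
  by (simp add: piecewise_smooth_path_def piecewise_smooth_between_def pathin_def)

lemma smooth_curve_affine:
  assumes c: "smooth_curve_on M J c" and J: "open J"
  shows "smooth_curve_on M {t. \<beta> + t * \<alpha> \<in> J} (reparam \<beta> \<alpha> c)"
  unfolding smooth_curve_on_def reparam_def
proof (intro conjI ballI)
  have cc: "continuous_map (top_of_set J) (mtop M) c" using c by (simp add: smooth_curve_on_def)
  have "continuous_map (top_of_set {t. \<beta> + t * \<alpha> \<in> J}) (top_of_set J) (\<lambda>t. \<beta> + t * \<alpha>)"
    by (auto simp: continuous_map_in_subtopology intro!: continuous_intros)
  from continuous_map_compose[OF this cc]
  show "continuous_map (top_of_set {t. \<beta> + t * \<alpha> \<in> J}) (mtop M) (\<lambda>t. c (\<beta> + t * \<alpha>))" by (simp add: o_def)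
  fix i assume i: "i \<in> charts M"
  let ?D = "{t \<in> J. c t \<in> cdom M i}"
  have op: "open ?D" by (rule curve_preimage_open[OF cc J cdom_open[OF i]])
  have eq: "{t \<in> {t. \<beta> + t * \<alpha> \<in> J}. c (\<beta> + t * \<alpha>) \<in> cdom M i} = {t. \<beta> + t * \<alpha> \<in> ?D}" by auto
  show "smooth_on {t \<in> {t. \<beta> + t * \<alpha> \<in> J}. c (\<beta> + t * \<alpha>) \<in> cdom M i} (\<lambda>t. coord M i (c (\<beta> + t * \<alpha>)))"
    unfolding smooth_on_def eq
  proof
    fix k
    have "Ck_on k ?D (\<lambda>t. coord M i (c t))" using c i by (auto simp: smooth_curve_on_def smooth_on_def)
    from Ck_on_affine_compose[OF op bounded_linear_mult_left this]
    show "Ck_on k {t. \<beta> + t * \<alpha> \<in> ?D} (\<lambda>t. coord M i (c (\<beta> + t * \<alpha>)))" .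
  qed
qed

lemma smooth_arc_affine:
  assumes "smooth_arc M a b c" and "\<And>t. t \<in> {a'..b'} \<Longrightarrow> \<beta> + t * \<alpha> \<in> {a..b}"
  shows "smooth_arc M a' b' (reparam \<beta> \<alpha> c)"
proof -
  obtain J c' where J: "open J" "{a..b} \<subseteq> J" "smooth_curve_on M J c'" "\<And>t. t \<in> {a..b} \<Longrightarrow> c' t = c t"
    using assms(1) by (auto simp: smooth_arc_def)
  show ?thesis unfolding smooth_arc_def
    by (intro exI[of _ "{t. \<beta> + t * \<alpha> \<in> J}"] exI[of _ "reparam \<beta> \<alpha> c'"] conjI
        open_affine_preimage smooth_curve_affine J)
      (use assms(2) J(2,4) in \<open>auto simp: reparam_def\<close>)
qed

lemma smooth_arc_cong: "smooth_arc M a b c \<Longrightarrow> (\<And>t. t \<in> {a..b} \<Longrightarrow> c t = c' t) \<Longrightarrow> smooth_arc M a b c'"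
  unfolding smooth_arc_def by metis

lemma smooth_arc_subset: "smooth_arc M a b c \<Longrightarrow> a \<le> a' \<Longrightarrow> b' \<le> b \<Longrightarrow> smooth_arc M a' b' c"
  unfolding smooth_arc_def by (meson atLeastatMost_subset_iff order_trans subsetD)

lemma smooth_arc_continuous:
  assumes "smooth_arc M a b c"
  shows "continuous_map (top_of_set {a..b}) (mtop M) c"
proof -
  obtain J c' where J: "open J" "{a..b} \<subseteq> J" "smooth_curve_on M J c'" "\<And>t. t \<in> {a..b} \<Longrightarrow> c' t = c t"
    using assms(1) by (auto simp: smooth_arc_def)
  have "continuous_map (top_of_set {a..b}) (mtop M) c'"
    by (rule continuous_map_from_subtopology_mono[OF _ J(2)]) (use J(3) in \<open>simp add: smooth_curve_on_def\<close>)
  then show ?thesis by (rule continuous_map_eq) (use J(4) in auto)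
qed

lemma smooth_arc_piecewise: "smooth_arc M a b c \<Longrightarrow> piecewise_smooth_between a b c"
  unfolding piecewise_smooth_between_def
  by (intro conjI smooth_arc_continuous exI[of _ "{}"]) (auto intro: smooth_arc_subset)

lemma piecewise_smooth_cong:
  assumes "piecewise_smooth_between a b c" "\<And>t. t \<in> {a..b} \<Longrightarrow> c t = c' t"
  shows "piecewise_smooth_between a b c'"
proof -
  obtain S where S: "finite S" "\<And>a' b'. a \<le> a' \<Longrightarrow> a' < b' \<Longrightarrow> b' \<le> b \<Longrightarrow> {a'<..<b'} \<inter> S = {} \<Longrightarrow> smooth_arc M a' b' c"
    using assms(1) unfolding piecewise_smooth_between_def by blast
  have "smooth_arc M a' b' c'" if "a \<le> a' \<and> a' < b' \<and> b' \<le> b \<and> {a'<..<b'} \<inter> S = {}" for a' b'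
    by (rule smooth_arc_cong[OF S(2)]) (use that assms(2) in auto)
  moreover have "continuous_map (top_of_set {a..b}) (mtop M) c'"
    by (rule continuous_map_eq[of _ _ c]) (use assms in \<open>auto simp: piecewise_smooth_between_def\<close>)
  ultimately show ?thesis using S(1) unfolding piecewise_smooth_between_def by blast
qed

lemma piecewise_smooth_glue:
  assumes c1: "piecewise_smooth_between a b c" and c2: "piecewise_smooth_between b d c" and ab: "a \<le> b" "b \<le> d"
  shows "piecewise_smooth_between a d c"
proof -
  obtain S where S: "finite S" "\<And>a' b'. a \<le> a' \<Longrightarrow> a' < b' \<Longrightarrow> b' \<le> b \<Longrightarrow> {a'<..<b'} \<inter> S = {} \<Longrightarrow> smooth_arc M a' b' c"
    using c1 unfolding piecewise_smooth_between_def by blast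
  obtain S' where S': "finite S'" "\<And>a' b'. b \<le> a' \<Longrightarrow> a' < b' \<Longrightarrow> b' \<le> d \<Longrightarrow> {a'<..<b'} \<inter> S' = {} \<Longrightarrow> smooth_arc M a' b' c"
    using c2 unfolding piecewise_smooth_between_def by blast
  have "smooth_arc M a' b' c" if "a \<le> a' \<and> a' < b' \<and> b' \<le> d \<and> {a'<..<b'} \<inter> (insert b (S \<union> S')) = {}" for a' b'
  proof -
    have "b \<notin> {a'<..<b'}" using that by blast
    then consider "b' \<le> b" | "b \<le> a'" by force
    then show ?thesis using that S(2)[of a' b'] S'(2)[of a' b'] by cases auto
  qed
  moreover have "continuous_map (top_of_set {a..d}) (mtop M) c"
  proof -
    have "continuous_map (top_of_set {a..d}) (mtop M) (\<lambda>t. if t \<le> b then c t else c t)"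
    proof (rule continuous_map_cases_le)
      have "{t \<in> topspace (top_of_set {a..d}). t \<le> b} = {a..b}" using ab by auto
      moreover have "{t \<in> topspace (top_of_set {a..d}). b \<le> t} = {b..d}" using ab by auto
      moreover have "{a..d} \<inter> {a..b} = {a..b}" "{a..d} \<inter> {b..d} = {b..d}" using ab by auto
      ultimately show "continuous_map (subtopology (top_of_set {a..d}) {t \<in> topspace (top_of_set {a..d}). t \<le> b}) (mtop M) c"
        "continuous_map (subtopology (top_of_set {a..d}) {t \<in> topspace (top_of_set {a..d}). b \<le> t}) (mtop M) c"
        using c1 c2 unfolding piecewise_smooth_between_def subtopology_subtopology by metis+
    qed (auto intro: continuous_intros)
    then show ?thesis by simp
  qed
  moreover have "finite (insert b (S \<union> S'))" using S S' by simp
  ultimately show ?thesis unfolding piecewise_smooth_between_def by blast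
qed

lemma piecewise_smooth_affine:
  assumes c: "piecewise_smooth_between a b c" and \<alpha>: "\<alpha> \<noteq> 0"
    and sub: "\<And>t. t \<in> {a'..b'} \<Longrightarrow> \<beta> + t * \<alpha> \<in> {a..b}"
  shows "piecewise_smooth_between a' b' (reparam \<beta> \<alpha> c)"
proof -
  obtain S where S: "finite S" "\<And>a' b'. a \<le> a' \<Longrightarrow> a' < b' \<Longrightarrow> b' \<le> b \<Longrightarrow> {a'<..<b'} \<inter> S = {} \<Longrightarrow> smooth_arc M a' b' c"
    using c unfolding piecewise_smooth_between_def by blast
  have "smooth_arc M r s (reparam \<beta> \<alpha> c)"
    if rs: "a' \<le> r \<and> r < s \<and> s \<le> b' \<and> {r<..<s} \<inter> {t. \<beta> + t * \<alpha> \<in> S} = {}" for r s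
  proof -
    let ?l = "min (\<beta> + r * \<alpha>) (\<beta> + s * \<alpha>)" and ?h = "max (\<beta> + r * \<alpha>) (\<beta> + s * \<alpha>)"
    note im = affine_image_interval[OF \<alpha>, where a=r and b=s and \<beta>=\<beta>]
    have "{?l<..<?h} \<inter> S = {}"
    proof -
      have "u \<notin> S" if "u \<in> {?l<..<?h}" for u
      proof -
        have u: "u = \<beta> + ((u - \<beta>) / \<alpha>) * \<alpha>" using \<alpha> by simp
        have "(u - \<beta>) / \<alpha> \<in> {r<..<s}" by (rule im(3)) (use rs that u in auto)
        then show ?thesis using rs u by auto
      qed
      then show ?thesis by blast
    qed
    moreover have "\<beta> + r * \<alpha> \<in> {a..b}" "\<beta> + s * \<alpha> \<in> {a..b}" using sub rs by auto
    ultimately have "smooth_arc M ?l ?h c" using im(1) rs by (intro S(2)) auto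
    then show ?thesis
    proof (rule smooth_arc_affine)
      show "\<beta> + t * \<alpha> \<in> {?l..?h}" if "t \<in> {r..s}" for t using im(2)[OF _ that] rs by blast
    qed
  qed
  moreover have "continuous_map (top_of_set {a'..b'}) (mtop M) (reparam \<beta> \<alpha> c)"
  proof -
    have "continuous_map (top_of_set {a'..b'}) (top_of_set {a..b}) (\<lambda>t. \<beta> + t * \<alpha>)"
      using sub by (auto simp: continuous_map_in_subtopology intro!: continuous_intros)
    moreover have "continuous_map (top_of_set {a..b}) (mtop M) c"
      using c by (simp add: piecewise_smooth_between_def)
    ultimately have "continuous_map (top_of_set {a'..b'}) (mtop M) (c \<circ> (\<lambda>t. \<beta> + t * \<alpha>))"
      by (rule continuous_map_compose)
    then show ?thesis by (simp add: reparam_def o_def)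
  qed
  ultimately show ?thesis using finite_affine_preimage[OF \<alpha> S(1), of \<beta>] unfolding piecewise_smooth_between_def by blast
qed

lemma piecewise_smooth_at:
  assumes c: "piecewise_smooth_between a b c"
  shows "\<exists>S. finite S \<and> (\<forall>t\<in>{a<..<b} - S. smooth_at c t)"
proof -
  obtain S where S: "finite S" "\<And>a' b'. a \<le> a' \<Longrightarrow> a' < b' \<Longrightarrow> b' \<le> b \<Longrightarrow> {a'<..<b'} \<inter> S = {} \<Longrightarrow> smooth_arc M a' b' c"
    using c unfolding piecewise_smooth_between_def by blast
  have "smooth_at c t" if t: "t \<in> {a<..<b} - S" for t
  proof -
    have "open ({a<..<b} - S)" using S(1) by (simp add: open_Diff finite_imp_closed)
    then obtain e where e: "e > 0" "cball t e \<subseteq> {a<..<b} - S" using t open_contains_cball by blast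
    have "smooth_arc M (t - e) (t + e) c"
    proof (rule S(2))
      have "t - e \<in> cball t e" "t + e \<in> cball t e" using e by (auto simp: dist_real_def)
      then have "t - e \<in> {a<..<b}" "t + e \<in> {a<..<b}" using e(2) by blast+
      then show "a \<le> t - e" "t + e \<le> b" by auto
      have "{t - e<..<t + e} \<subseteq> cball t e" by (auto simp: dist_real_def)
      then show "{t - e<..<t + e} \<inter> S = {}" using e by blast
    qed (use e in simp)
    then obtain J c' where J: "open J" "{t-e..t+e} \<subseteq> J" "smooth_curve_on M J c'" "\<And>s. s \<in> {t-e..t+e} \<Longrightarrow> c' s = c s"
      by (auto simp: smooth_arc_def)
    show ?thesis unfolding smooth_at_def
    proof (intro ballI impI)
      fix i assume i: "i \<in> charts M" "c t \<in> cdom M i"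
      have "((\<lambda>s. coord M i (c' s)) has_vector_derivative velocity M c' t i) (at t)"
        by (rule smooth_curve_derivative[OF J(3) i(1)]) (use J(2,4) e i in auto)
      then have "((\<lambda>s. coord M i (c s)) has_vector_derivative velocity M c' t i) (at t)"
        by (rule has_vector_derivative_transform_within_open[of _ _ _ "{t-e<..<t+e}"]) (use J(4) e in auto)
      then show "((\<lambda>s. coord M i (c s)) has_vector_derivative velocity M c t i) (at t)"
        using i by (simp add: velocity_def vector_derivative_at)
    qed
  qed
  then show ?thesis using S(1) by blast
qed

lemma cov_deriv_zero_affine:
  assumes z: "cov_deriv_zero M g c V (\<beta> + t * \<alpha>)" and s: "smooth_at c (\<beta> + t * \<alpha>)"
  shows "cov_deriv_zero M g (reparam \<beta> \<alpha> c) (reparam \<beta> \<alpha> V) t"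
  unfolding cov_deriv_zero_def
proof (intro ballI impI)
  fix i assume i: "i \<in> charts M" "reparam \<beta> \<alpha> c t \<in> cdom M i"
  let ?t = "\<beta> + t * \<alpha>"
  have ci: "c ?t \<in> cdom M i" using i by (simp add: reparam_def)
  have aff: "((\<lambda>t. \<beta> + t * \<alpha>) has_real_derivative \<alpha>) (at t)" by (auto intro!: derivative_eq_intros)
  have ch: "((\<lambda>t. f (\<beta> + t * \<alpha>)) has_vector_derivative \<alpha> *\<^sub>R f') (at t)"
    if "(f has_vector_derivative f') (at ?t)" for f :: "real \<Rightarrow> 'e" and f'
    using vector_diff_chain_at[OF aff[unfolded has_real_derivative_iff_has_vector_derivative] that]
    by (simp add: o_def)
  have "((\<lambda>s. coord M i (c s)) has_vector_derivative velocity M c ?t i) (at ?t)"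
    using s i(1) ci by (auto simp: smooth_at_def)
  from ch[OF this] have vel: "velocity M (reparam \<beta> \<alpha> c) t i = \<alpha> *\<^sub>R velocity M c ?t i"
    using i by (simp add: velocity_def reparam_def vector_derivative_at)
  have cr: "coord M i (c ?t) \<in> cran M i" using ci by (simp add: cran_def)
  have "((\<lambda>s. V s i) has_vector_derivative - christoffel g i (coord M i (c ?t)) (velocity M c ?t i) (V ?t i)) (at ?t)"
    using z i(1) ci by (auto simp: cov_deriv_zero_def)
  from ch[OF this] have "((\<lambda>s. reparam \<beta> \<alpha> V s i) has_vector_derivative
      \<alpha> *\<^sub>R - christoffel g i (coord M i (c ?t)) (velocity M c ?t i) (V ?t i)) (at t)"
    by (simp add: reparam_def)
  also have "\<alpha> *\<^sub>R - christoffel g i (coord M i (c ?t)) (velocity M c ?t i) (V ?t i)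
      = - christoffel g i (coord M i (c ?t)) (V ?t i) (\<alpha> *\<^sub>R velocity M c ?t i)"
    using linear_cmul[OF christoffel_linear[OF i(1) cr]] christoffel_sym[OF i(1) cr] by simp
  also have "\<dots> = - christoffel g i (coord M i (c ?t)) (\<alpha> *\<^sub>R velocity M c ?t i) (V ?t i)"
    using christoffel_sym[OF i(1) cr] by metis
  finally show "((\<lambda>s. reparam \<beta> \<alpha> V s i) has_vector_derivative
    - christoffel g i (coord M i (reparam \<beta> \<alpha> c t)) (velocity M (reparam \<beta> \<alpha> c) t i) (reparam \<beta> \<alpha> V t i)) (at t)"
    by (simp add: vel) (simp add: reparam_def)
qed

lemma parallel_between_affine:
  assumes V: "parallel_between a b c V" and c: "piecewise_smooth_between a b c" and \<alpha>: "\<alpha> \<noteq> 0"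
    and sub: "\<And>t. t \<in> {a'..b'} \<Longrightarrow> \<beta> + t * \<alpha> \<in> {a..b}"
    and sub': "\<And>t. t \<in> {a'<..<b'} \<Longrightarrow> \<beta> + t * \<alpha> \<in> {a<..<b}"
  shows "parallel_between a' b' (reparam \<beta> \<alpha> c) (reparam \<beta> \<alpha> V)"
proof -
  obtain S where S: "finite S" "\<And>t. t \<in> {a<..<b} - S \<Longrightarrow> cov_deriv_zero M g c V t"
    using V by (auto simp: parallel_between_def)
  obtain S' where S': "finite S'" "\<And>t. t \<in> {a<..<b} - S' \<Longrightarrow> smooth_at c t"
    using piecewise_smooth_at[OF c] by blast
  have "cov_deriv_zero M g (reparam \<beta> \<alpha> c) (reparam \<beta> \<alpha> V) t"
    if "t \<in> {a'<..<b'} - {t. \<beta> + t * \<alpha> \<in> S \<union> S'}" for t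
    by (rule cov_deriv_zero_affine) (use that S(2) S'(2) sub'[of t] in auto)
  moreover have "finite {t. \<beta> + t * \<alpha> \<in> S \<union> S'}" by (rule finite_affine_preimage[OF \<alpha>]) (use S S' in simp)
  moreover have "reparam \<beta> \<alpha> V t \<in> tangent_space M (reparam \<beta> \<alpha> c t)" if "t \<in> {a'..b'}" for t
    using V sub[OF that] by (simp add: reparam_def parallel_between_def)
  moreover have "continuous_on {t \<in> {a'..b'}. reparam \<beta> \<alpha> c t \<in> cdom M i} (\<lambda>t. reparam \<beta> \<alpha> V t i)" if i: "i \<in> charts M" for i
  proof -
    have "continuous_on {t \<in> {a..b}. c t \<in> cdom M i} (\<lambda>t. V t i)"
      using V i unfolding parallel_between_def by blast
    then show ?thesis unfolding reparam_def
      by (rule continuous_on_compose2[where f="\<lambda>t. \<beta> + t * \<alpha>"]) (use sub in \<open>auto intro!: continuous_intros\<close>)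
  qed
  ultimately show ?thesis unfolding parallel_between_def by blast
qed

definition transports :: "(real \<Rightarrow> 'a) \<Rightarrow> ('i, 'e) tangent \<Rightarrow> ('i, 'e) tangent \<Rightarrow> bool" where
  "transports c v w \<longleftrightarrow> (\<exists>V. parallel_along M g c V \<and> V 0 = v \<and> V 1 = w)"

text \<open>
  Asking for transport in both directions makes the notion stable under reversal and concatenation and replaces the
  inverse of a transport map.
\<close>

definition transportable :: "(real \<Rightarrow> 'a) \<Rightarrow> bool" where
  "transportable c \<longleftrightarrow> piecewise_smooth_path M c \<and>
     (\<forall>v\<in>tangent_space M (c 0). \<exists>w. transports c v w) \<and>
     (\<forall>w\<in>tangent_space M (c 1). \<exists>v. transports c v w)"

lemma transports_tangent:
  "transports c v w \<Longrightarrow> v \<in> tangent_space M (c 0) \<and> w \<in> tangent_space M (c 1)"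
  by (auto simp: transports_def parallel_along_def)

lemma reverse_piecewise_smooth:
  "piecewise_smooth_path M c \<Longrightarrow> piecewise_smooth_path M (reparam 1 (- 1) c)"
  unfolding piecewise_smooth_path_between by (rule piecewise_smooth_affine) auto

lemma reparam_reverse_twice: "reparam 1 (- 1) (reparam 1 (- 1) c) = c"
  by (simp add: reparam_def)

lemma transports_reverse:
  assumes "piecewise_smooth_path M c" "transports c v w"
  shows "transports (reparam 1 (- 1) c) w v"
proof -
  obtain V where V: "parallel_between 0 1 c V" "V 0 = v" "V 1 = w"
    using assms by (auto simp: transports_def parallel_along_between)
  have "parallel_between 0 1 (reparam 1 (- 1) c) (reparam 1 (- 1) V)"
    by (rule parallel_between_affine[OF V(1)]) (use assms in \<open>auto simp: piecewise_smooth_path_between\<close>)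
  then show ?thesis unfolding transports_def parallel_along_between
    by (intro exI[of _ "reparam 1 (- 1) V"]) (simp add: reparam_def V)
qed

lemma join_curves_halves:
  assumes "c 1 = d 0"
  shows "t \<in> {0..1/2} \<Longrightarrow> reparam 0 2 c t = join_curves c d t"
    and "t \<in> {1/2..1} \<Longrightarrow> reparam (- 1) 2 d t = join_curves c d t"
  using assms by (auto simp: join_curves_def reparam_def)

lemma join_piecewise_smooth:
  assumes "piecewise_smooth_path M c" "piecewise_smooth_path M d" "c 1 = d 0"
  shows "piecewise_smooth_path M (join_curves c d)"
  unfolding piecewise_smooth_path_between
proof (rule piecewise_smooth_glue[where b="1/2"])
  have "piecewise_smooth_between 0 (1/2) (reparam 0 2 c)"
    by (rule piecewise_smooth_affine) (use assms in \<open>auto simp: piecewise_smooth_path_between\<close>)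
  then show "piecewise_smooth_between 0 (1/2) (join_curves c d)"
    by (rule piecewise_smooth_cong) (rule join_curves_halves(1)[of c d, OF assms(3)])
  have "piecewise_smooth_between (1/2) 1 (reparam (- 1) 2 d)"
    by (rule piecewise_smooth_affine) (use assms in \<open>auto simp: piecewise_smooth_path_between\<close>)
  then show "piecewise_smooth_between (1/2) 1 (join_curves c d)"
    by (rule piecewise_smooth_cong) (rule join_curves_halves(2)[of c d, OF assms(3)])
qed auto

lemma transports_join:
  assumes c: "piecewise_smooth_path M c" and d: "piecewise_smooth_path M d" and cd: "c 1 = d 0"
    and vw: "transports c v w" and wz: "transports d w z"
  shows "transports (join_curves c d) v z"
proof -
  obtain V where V: "parallel_between 0 1 c V" "V 0 = v" "V 1 = w"
    using vw by (auto simp: transports_def parallel_along_between)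
  obtain W where W: "parallel_between 0 1 d W" "W 0 = w" "W 1 = z"
    using wz by (auto simp: transports_def parallel_along_between)
  have VW: "V 1 = W 0" using V W by simp
  have "parallel_between 0 (1/2) (reparam 0 2 c) (reparam 0 2 V)"
    by (rule parallel_between_affine[OF V(1)]) (use c in \<open>auto simp: piecewise_smooth_path_between\<close>)
  then have 1: "parallel_between 0 (1/2) (join_curves c d) (join_curves V W)"
    by (rule parallel_between_cong) (use join_curves_halves(1)[of c d, OF cd] join_curves_halves(1)[of V W, OF VW] in auto)
  have "parallel_between (1/2) 1 (reparam (- 1) 2 d) (reparam (- 1) 2 W)"
    by (rule parallel_between_affine[OF W(1)]) (use d in \<open>auto simp: piecewise_smooth_path_between\<close>)
  then have 2: "parallel_between (1/2) 1 (join_curves c d) (join_curves V W)"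
    by (rule parallel_between_cong) (use join_curves_halves(2)[of c d, OF cd] join_curves_halves(2)[of V W, OF VW] in auto)
  have "parallel_between 0 1 (join_curves c d) (\<lambda>t. if t \<le> 1/2 then join_curves V W t else join_curves V W t)"
    by (rule parallel_between_glue[OF 1 2]) auto
  then have "parallel_between 0 1 (join_curves c d) (join_curves V W)" by simp
  then show ?thesis unfolding transports_def parallel_along_between
    by (intro exI[of _ "join_curves V W"]) (auto simp: join_curves_def V W)
qed

lemma transportable_join:
  assumes "transportable c" "transportable d" "c 1 = d 0"
  shows "transportable (join_curves c d)"
proof -
  have ends: "join_curves c d 0 = c 0" "join_curves c d 1 = d 1" by (auto simp: join_curves_def)
  have p: "piecewise_smooth_path M c" "piecewise_smooth_path M d" using assms by (auto simp: transportable_def)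
  show ?thesis unfolding transportable_def ends
  proof (intro conjI ballI)
    show "piecewise_smooth_path M (join_curves c d)" by (rule join_piecewise_smooth[OF p assms(3)])
    show "\<exists>w. transports (join_curves c d) v w" if v: "v \<in> tangent_space M (c 0)" for v
    proof -
      obtain w where w: "transports c v w" using assms(1) v unfolding transportable_def by blast
      then have "w \<in> tangent_space M (d 0)" using transports_tangent assms(3) by metis
      then obtain z where "transports d w z" using assms(2) unfolding transportable_def by blast
      then show ?thesis using transports_join[OF p assms(3) w] by blast
    qed
    show "\<exists>v. transports (join_curves c d) v w" if w: "w \<in> tangent_space M (d 1)" for w
    proof -
      obtain v where v: "transports d v w" using assms(2) w unfolding transportable_def by blast
      then have "v \<in> tangent_space M (c 1)" using transports_tangent assms(3) by metis
      then obtain u where "transports c u v" using assms(1) unfolding transportable_def by blast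
      then show ?thesis using transports_join[OF p assms(3) _ v] by blast
    qed
  qed
qed

lemma transportable_reverse:
  assumes "transportable c"
  shows "transportable (reparam 1 (- 1) c)"
  using assms reverse_piecewise_smooth transports_reverse unfolding transportable_def
  by (simp add: reparam_def) (metis)

lemma smooth_arc_transportable:
  assumes "smooth_arc M 0 1 c"
  shows "transportable c"
proof -
  have fwd: "\<exists>w. transports c v w" if "smooth_arc M 0 1 c" "v \<in> tangent_space M (c 0)" for c v
    using smooth_arc_parallel_transport[OF that(1) _ that(2)]
    unfolding transports_def parallel_along_between by auto
  have rev: "smooth_arc M 0 1 (reparam 1 (- 1) c)" by (rule smooth_arc_affine[OF assms]) auto
  have p: "piecewise_smooth_path M c"
    unfolding piecewise_smooth_path_between by (rule smooth_arc_piecewise[OF assms])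
  have "\<exists>v. transports c v w" if "w \<in> tangent_space M (c 1)" for w
  proof -
    have "w \<in> tangent_space M (reparam 1 (- 1) c 0)" using that by (simp add: reparam_def)
    then obtain v where "transports (reparam 1 (- 1) c) w v" using fwd[OF rev] by blast
    from transports_reverse[OF reverse_piecewise_smooth[OF p] this] show ?thesis
      by (auto simp: reparam_reverse_twice)
  qed
  then show ?thesis using fwd[OF assms] p unfolding transportable_def by blast
qed

text \<open>
  The Christoffel symbols of the first kind, symmetrized in their last two arguments, give the derivative of the metric. Hence
  the three terms in the derivative of \<open>g V W\<close> along the curve cancel.
\<close>

lemma transports_metric:
  assumes c: "piecewise_smooth_path M c" and vw: "transports c v w" and vw': "transports c v' w'"
  shows "metric_at M g (c 0) v v' = metric_at M g (c 1) w w'"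
proof -
  obtain V where V: "parallel_between 0 1 c V" "V 0 = v" "V 1 = w"
    using vw by (auto simp: transports_def parallel_along_between)
  obtain W where W: "parallel_between 0 1 c W" "W 0 = v'" "W 1 = w'"
    using vw' by (auto simp: transports_def parallel_along_between)
  have cc: "continuous_map (top_of_set {0..1}) (mtop M) c"
    using c by (simp add: piecewise_smooth_path_between piecewise_smooth_between_def)
  obtain S where S: "finite S" "\<And>t. t \<in> {0<..<1} - S \<Longrightarrow> smooth_at c t"
    using piecewise_smooth_at[OF c[unfolded piecewise_smooth_path_between]] by blast
  obtain S1 where S1: "finite S1" "\<And>t. t \<in> {0<..<1} - S1 \<Longrightarrow> cov_deriv_zero M g c V t"
    using V by (auto simp: parallel_between_def)
  obtain S2 where S2: "finite S2" "\<And>t. t \<in> {0<..<1} - S2 \<Longrightarrow> cov_deriv_zero M g c W t"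
    using W by (auto simp: parallel_between_def)
  define f where "f t = metric_at M g (c t) (V t) (W t)" for t
  have tan: "V t \<in> tangent_space M (c t)" "W t \<in> tangent_space M (c t)" if "t \<in> {0..1}" for t
    using V W that unfolding parallel_between_def by auto
  have f: "f t = g i (coord M i (c t)) (V t i) (W t i)" if "t \<in> {0..1}" "i \<in> charts M" "c t \<in> cdom M i" for t i
    unfolding f_def by (rule metric_at_chart) (use that tan in auto)
  have chart: "\<exists>i\<in>charts M. c t \<in> cdom M i" if "t \<in> {0..1}" for t
    using topspace_chart[OF curve_in_topspace[OF cc that]] .
  have nbhd: "\<exists>N. open N \<and> t \<in> N \<and> {0..1} \<inter> N = {t \<in> {0..1}. c t \<in> cdom M i}"
    if "t \<in> {0..1}" "i \<in> charts M" "c t \<in> cdom M i" for t i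
    using curve_preimage_openin[OF cc cdom_open[OF that(2)]] that unfolding openin_open by auto
  have "continuous_on {0..1} f"
    unfolding continuous_on_eq_continuous_within
  proof
    fix t :: real assume t: "t \<in> {0..1}"
    obtain i where i: "i \<in> charts M" "c t \<in> cdom M i" using chart[OF t] by blast
    let ?D = "{t \<in> {0..1}. c t \<in> cdom M i}"
    obtain N where N: "open N" "t \<in> N" "{0..1} \<inter> N = ?D" using nbhd[OF t i] by blast
    have cV: "continuous_on ?D (\<lambda>t. V t i)" and cW: "continuous_on ?D (\<lambda>t. W t i)"
      using V W i unfolding parallel_between_def by blast+
    have cr: "coord M i (c t) \<in> cran M i" if "t \<in> ?D" for t using that by (auto simp: cran_def)
    have g1: "continuous_on ?D (\<lambda>t. g i (coord M i (c t)) u w)" for u w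
      by (rule continuous_on_compose2[OF dmetric(3)[OF i(1)] curve_coord_continuous[OF cc i(1)]]) (use cr in blast)
    have g2: "continuous_on ?D (\<lambda>t. g i (coord M i (c t)) (V t i) w)" for w
      by (rule linear_path_continuous[where L="\<lambda>t v. g i (coord M i (c t)) v w", OF _ g1 cV])
        (use metric_linear(2)[OF i(1)] cr in blast)
    have "continuous_on ?D (\<lambda>t. g i (coord M i (c t)) (V t i) (W t i))"
      by (rule linear_path_continuous[where L="\<lambda>t. g i (coord M i (c t)) (V t i)", OF _ g2 cW])
        (use metric_linear(1)[OF i(1)] cr in blast)
    then have "continuous_on ?D f" by (rule continuous_on_eq) (use f i in auto)
    then have "continuous (at t within ?D) f" using t i by (auto simp: continuous_on_eq_continuous_within)
    moreover have "at t within ?D = at t within {0..1}"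
      by (rule at_within_nhd[OF N(2,1)]) (use N(3) in blast)
    ultimately show "continuous (at t within {0..1}) f" by simp
  qed
  moreover have "(f has_vector_derivative 0) (at t)" if t: "t \<in> {0<..<1} - (S \<union> S1 \<union> S2)" for t
  proof -
    have t01: "t \<in> {0..1}" using t by auto
    obtain i where i: "i \<in> charts M" "c t \<in> cdom M i" using chart[OF t01] by blast
    obtain N where N: "open N" "t \<in> N" "{0..1} \<inter> N = {t \<in> {0..1}. c t \<in> cdom M i}" using nbhd[OF t01 i] by blast
    let ?x = "coord M i (c t)" and ?x' = "velocity M c t i"
    have cr: "?x \<in> cran M i" using i by (simp add: cran_def)
    have x: "((\<lambda>s. coord M i (c s)) has_vector_derivative ?x') (at t)"
      using S(2)[of t] t i by (auto simp: smooth_at_def)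
    have dV: "((\<lambda>s. V s i) has_vector_derivative - christoffel g i ?x ?x' (V t i)) (at t)"
      using S1(2)[of t] t i unfolding cov_deriv_zero_def by blast
    have dW: "((\<lambda>s. W s i) has_vector_derivative - christoffel g i ?x ?x' (W t i)) (at t)"
      using S2(2)[of t] t i unfolding cov_deriv_zero_def by blast
    have "g i ?x (- christoffel g i ?x ?x' (V t i)) (W t i) = - christoffel_first_kind g i ?x ?x' (V t i) (W t i)"
      using linear_neg[OF metric_linear(2)[OF i(1) cr]] christoffel[OF i(1) cr] by simp
    moreover have "g i ?x (V t i) (- christoffel g i ?x ?x' (W t i)) = - christoffel_first_kind g i ?x ?x' (W t i) (V t i)"
      using linear_neg[OF metric_linear(2)[OF i(1) cr]] christoffel[OF i(1) cr]
        metric_sym[OF i(1) cr, of "V t i"] by simp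
    moreover have "christoffel_first_kind g i ?x ?x' (V t i) (W t i) + christoffel_first_kind g i ?x ?x' (W t i) (V t i)
        = dmetric i ?x ?x' (V t i) (W t i)"
      using dmetric_sym[OF i(1) cr, of "W t i" "V t i" ?x'] by (simp add: christoffel_first_kind_def field_simps)
    ultimately have "dmetric i ?x ?x' (V t i) (W t i) + g i ?x (- christoffel g i ?x ?x' (V t i)) (W t i)
        + g i ?x (V t i) (- christoffel g i ?x ?x' (W t i)) = 0" by linarith
    with metric_path_derivative[OF i(1) x cr dV dW]
    have "((\<lambda>s. g i (coord M i (c s)) (V s i) (W s i)) has_vector_derivative 0) (at t)" by metis
    then show ?thesis
    proof (rule has_vector_derivative_transform_within_open[of _ _ _ "N \<inter> {0<..<1}"])
      fix s assume s: "s \<in> N \<inter> {0<..<1}"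
      then have "s \<in> {0..1} \<inter> N" by auto
      then have "c s \<in> cdom M i" "s \<in> {0..1}" using N(3) by blast+
      then show "g i (coord M i (c s)) (V s i) (W s i) = f s" using f i by simp
    qed (use N t in auto)
  qed
  ultimately have "f 1 = f 0" by (intro constant_off_finite[of "S \<union> S1 \<union> S2"]) (use S(1) S1(1) S2(1) in auto)
  then show ?thesis by (simp add: f_def V W)
qed

text \<open>
  A holonomy element only has to select, for each vector, the end value of some parallel field. It may thus be
  modified to take the prescribed value \<open>w\<close> at \<open>v\<close>.
\<close>

lemma holonomy_invariant_transports:
  assumes inv: "\<forall>\<tau>\<in>holonomy_group M g p. \<tau> ` U \<subseteq> U"
    and c: "transportable c" "c 0 = p" "c 1 = p" and vw: "transports c v w" and v: "v \<in> U"
  shows "w \<in> U"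
proof -
  have vT: "v \<in> tangent_space M p" using transports_tangent[OF vw] c by simp
  obtain \<tau>0 where \<tau>0: "\<And>u. u \<in> tangent_space M p \<Longrightarrow> transports c u (\<tau>0 u)"
    using c unfolding transportable_def by metis
  define \<tau> where "\<tau> = restrict (\<tau>0(v := w)) (tangent_space M p)"
  have "\<tau> \<in> holonomy_group M g p"
    unfolding holonomy_group_def
  proof (intro CollectI conjI exI[of _ c] ballI)
    show "\<tau> \<in> extensional (tangent_space M p)" by (simp add: \<tau>_def)
    show "piecewise_smooth_path M c" "c 0 = p" "c 1 = p" using c by (auto simp: transportable_def)
    fix u assume u: "u \<in> tangent_space M p"
    then have "transports c u (\<tau> u)" using \<tau>0 vw by (simp add: \<tau>_def)
    then show "\<exists>V. parallel_along M g c V \<and> V 0 = u \<and> V 1 = \<tau> u" by (simp add: transports_def)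
  qed
  then have "\<tau> v \<in> U" using inv v by blast
  then show ?thesis using vT by (simp add: \<tau>_def)
qed

section \<open>Bounds on parallel transport\<close>

text \<open>The curve whose image in the chart \<open>i\<close> is the straight segment from \<open>x\<close> to \<open>y\<close>.\<close>

definition chart_segment :: "'i \<Rightarrow> 'e \<Rightarrow> 'e \<Rightarrow> real \<Rightarrow> 'a" where
  "chart_segment i x y = (\<lambda>s. inv_into (cdom M i) (coord M i) (x + s *\<^sub>R (y - x)))"

lemma coord_inv: "x \<in> cran M i \<Longrightarrow> coord M i (inv_into (cdom M i) (coord M i) x) = x"
  and inv_coord_cdom: "x \<in> cran M i \<Longrightarrow> inv_into (cdom M i) (coord M i) x \<in> cdom M i"
  by (auto simp: cran_def f_inv_into_f inv_into_into)

lemma inv_coord_continuous: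
  assumes i: "i \<in> charts M"
  shows "continuous_map (top_of_set (cran M i)) (mtop M) (inv_into (cdom M i) (coord M i))"
proof -
  obtain h where h: "homeomorphic_maps (subtopology (mtop M) (cdom M i)) (top_of_set (cran M i)) (coord M i) h"
    using coord_homeomorphic_map[OF i] homeomorphic_map_maps by blast
  then have "continuous_map (top_of_set (cran M i)) (mtop M) h"
    by (simp add: homeomorphic_maps_def continuous_map_in_subtopology)
  moreover have "h x = inv_into (cdom M i) (coord M i) x" if x: "x \<in> cran M i" for x
  proof -
    obtain p where p: "p \<in> cdom M i" "x = coord M i p" using x unfolding cran_def by blast
    then have "h x = p" using h topspace_cdom[OF i] by (auto simp: homeomorphic_maps_def)
    then show ?thesis using inv_coord[OF i p(1)] p by simp
  qed
  ultimately show ?thesis by (metis continuous_map_eq topspace_euclidean_subtopology)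
qed

lemma chart_segment_smooth:
  assumes i: "i \<in> charts M" and seg: "\<And>s. s \<in> {0..1} \<Longrightarrow> x + s *\<^sub>R (y - x) \<in> cran M i"
  shows "smooth_arc M 0 1 (chart_segment i x y)"
proof -
  let ?J = "{s. x + s *\<^sub>R (y - x) \<in> cran M i}"
  have J: "open ?J"
    using open_vimage[OF cran_open[OF i], of "\<lambda>s. x + s *\<^sub>R (y - x)"]
    by (simp add: vimage_def continuous_intros)
  have ci: "chart_segment i x y s \<in> cdom M i" "coord M i (chart_segment i x y s) = x + s *\<^sub>R (y - x)" if "s \<in> ?J" for s
    using that by (auto simp: chart_segment_def inv_coord_cdom coord_inv)
  have "smooth_curve_on M ?J (chart_segment i x y)"
    unfolding smooth_curve_on_def
  proof (intro conjI ballI)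
    have "continuous_map (top_of_set ?J) (top_of_set (cran M i)) (\<lambda>s. x + s *\<^sub>R (y - x))"
      by (auto simp: continuous_map_in_subtopology intro!: continuous_intros)
    from continuous_map_compose[OF this inv_coord_continuous[OF i]]
    show "continuous_map (top_of_set ?J) (mtop M) (chart_segment i x y)"
      by (simp add: chart_segment_def o_def)
    fix j assume j: "j \<in> charts M"
    have eq: "{s \<in> ?J. chart_segment i x y s \<in> cdom M j} = {s. x + s *\<^sub>R (y - x) \<in> overlap i j}"
    proof (intro set_eqI iffI)
      fix s assume "s \<in> {s \<in> ?J. chart_segment i x y s \<in> cdom M j}"
      then show "s \<in> {s. x + s *\<^sub>R (y - x) \<in> overlap i j}" using ci[of s] overlapI[of "chart_segment i x y s" i j] by simp
    next
      fix s assume "s \<in> {s. x + s *\<^sub>R (y - x) \<in> overlap i j}"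
      then obtain p where p: "p \<in> cdom M i" "p \<in> cdom M j" "x + s *\<^sub>R (y - x) = coord M i p" by auto
      then show "s \<in> {s \<in> ?J. chart_segment i x y s \<in> cdom M j}"
        using inv_coord[OF i p(1)] by (auto simp: chart_segment_def cran_def)
    qed
    show "smooth_on {s \<in> ?J. chart_segment i x y s \<in> cdom M j} (\<lambda>s. coord M j (chart_segment i x y s))"
      unfolding smooth_on_def eq
    proof
      fix k
      have "Ck_on k (overlap i j) (transition M i j)" using transition_smooth[OF i j] by (simp add: smooth_on_def)
      from Ck_on_affine_compose[OF overlap_open[OF i j] bounded_linear_scaleR_left this, of x "y - x"]
      show "Ck_on k {s. x + s *\<^sub>R (y - x) \<in> overlap i j} (\<lambda>s. coord M j (chart_segment i x y s))"
        by (simp add: transition_def chart_segment_def)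
    qed
  qed
  then show ?thesis unfolding smooth_arc_def using J seg by (intro exI[of _ ?J] exI[of _ "chart_segment i x y"]) auto
qed

text \<open>
  Gronwall's estimate: if \<open>K\<close> bounds the Christoffel symbols on the ball, contracted with a velocity of norm at most \<open>\<rho>\<close>,
  then \<open>(norm V)\<^sup>2 exp (- 2 K s)\<close> does not increase along a parallel field.
\<close>

lemma chart_segment_transport_bound:
  assumes i: "i \<in> charts M" and ball: "cball y \<rho> \<subseteq> cran M i"
  obtains C where "C \<ge> 0" "\<And>x v w. x \<in> cball y \<rho> \<Longrightarrow> transports (chart_segment i x y) v w \<Longrightarrow> norm (w i) \<le> C * norm (v i)"
proof -
  let ?S = "cball y \<rho> \<times> cball (0::'e) \<rho>"
  obtain K where K: "K > 0" "\<And>z v. z \<in> ?S \<Longrightarrow> norm (christoffel g i (fst z) (snd z) v) \<le> K * norm v"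
  proof (rule linear_family_bound[of ?S "\<lambda>z. christoffel g i (fst z) (snd z)"])
    show "compact ?S" by (intro compact_Times compact_cball)
    show "linear (christoffel g i (fst z) (snd z))" if "z \<in> ?S" for z
      by (rule christoffel_linear[OF i]) (use that ball in auto)
    show "continuous_on ?S (\<lambda>z. christoffel g i (fst z) (snd z) v)" for v
      by (rule continuous_christoffel[OF i]) (use ball in \<open>auto intro!: continuous_intros\<close>)
  qed blast
  have "norm (w i) \<le> exp K * norm (v i)"
    if x: "x \<in> cball y \<rho>" and vw: "transports (chart_segment i x y) v w" for x v w
  proof -
    let ?c = "chart_segment i x y"
    have seg: "x + s *\<^sub>R (y - x) \<in> cball y \<rho>" if "s \<in> {0..1}" for s
    proof -
      have "x + s *\<^sub>R (y - x) = (1 - s) *\<^sub>R x + s *\<^sub>R y" by (simp add: algebra_simps)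
      moreover have "y \<in> cball y \<rho>" using x by (metis centre_in_cball dist_not_less_zero dual_order.trans mem_cball not_le)
      ultimately show ?thesis using convexD[OF convex_cball x, of y "1 - s" s] that by auto
    qed
    have cr: "x + s *\<^sub>R (y - x) \<in> cran M i" if "s \<in> {0..1}" for s using seg[OF that] ball by blast
    have cd: "?c s \<in> cdom M i" "coord M i (?c s) = x + s *\<^sub>R (y - x)" if "s \<in> {0..1}" for s
      using cr[OF that] by (auto simp: chart_segment_def inv_coord_cdom coord_inv)
    obtain V where V: "parallel_between 0 1 ?c V" "V 0 = v" "V 1 = w"
      using vw by (auto simp: transports_def parallel_along_between)
    obtain S where S: "finite S" "\<And>t. t \<in> {0<..<1} - S \<Longrightarrow> cov_deriv_zero M g ?c V t"
      using V by (auto simp: parallel_between_def)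
    define f where "f s = (V s i \<bullet> V s i) * exp (- 2 * K * s)" for s
    define A where "A s = - christoffel g i (x + s *\<^sub>R (y - x)) (y - x) (V s i)" for s
    have A: "norm (A s) \<le> K * norm (V s i)" if "s \<in> {0..1}" for s
      using K(2)[of "(x + s *\<^sub>R (y - x), y - x)"] seg[OF that] x by (auto simp: A_def dist_norm norm_minus_commute)
    have cV: "continuous_on {0..1} (\<lambda>s. V s i)"
    proof -
      have "{s \<in> {0..1}. ?c s \<in> cdom M i} = {0..1}" using cd by auto
      then show ?thesis using V(1) i unfolding parallel_between_def by metis
    qed
    have "f 1 \<le> f 0"
    proof (rule nonincreasing_off_finite[OF S(1), where f=f and a=0 and b=1 and f'="\<lambda>s. (2 * (V s i \<bullet> A s) - 2 * K * (V s i \<bullet> V s i)) * exp (- 2 * K * s)"])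
      show "continuous_on {0..1} f" unfolding f_def by (intro continuous_intros cV)
      fix s :: real assume s: "s \<in> {0<..<1} - S"
      then have s': "s \<in> {0..1}" by auto
      have "((\<lambda>s. x + s *\<^sub>R (y - x)) has_vector_derivative (y - x)) (at s)" by (auto intro!: derivative_eq_intros)
      then have "((\<lambda>s. coord M i (?c s)) has_vector_derivative (y - x)) (at s)"
        by (rule has_vector_derivative_transform_within_open[of _ _ _ "{0<..<1}"]) (use s cd in auto)
      then have "velocity M ?c s i = y - x" using i cd[OF s'] by (simp add: velocity_def vector_derivative_at)
      then have dV: "((\<lambda>s. V s i) has_vector_derivative A s) (at s)"
        using S(2)[OF s] i cd[OF s'] by (auto simp: cov_deriv_zero_def A_def)
      have "((\<lambda>s. V s i \<bullet> V s i) has_real_derivative V s i \<bullet> A s + A s \<bullet> V s i) (at s)"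
        unfolding has_real_derivative_iff_has_vector_derivative
        by (rule bounded_bilinear.has_vector_derivative[OF bounded_bilinear_inner dV dV])
      then have "(f has_real_derivative (V s i \<bullet> A s + A s \<bullet> V s i) * exp (- 2 * K * s)
          + (- 2 * K) * exp (- 2 * K * s) * (V s i \<bullet> V s i)) (at s)"
        unfolding f_def by (auto intro!: derivative_eq_intros)
      moreover have "(V s i \<bullet> A s + A s \<bullet> V s i) * exp (- 2 * K * s) + (- 2 * K) * exp (- 2 * K * s) * (V s i \<bullet> V s i)
          = (2 * (V s i \<bullet> A s) - 2 * K * (V s i \<bullet> V s i)) * exp (- 2 * K * s)"
        by (simp add: algebra_simps inner_commute)
      ultimately show "(f has_vector_derivative (2 * (V s i \<bullet> A s) - 2 * K * (V s i \<bullet> V s i)) * exp (- 2 * K * s)) (at s)"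
        by (simp add: has_real_derivative_iff_has_vector_derivative)
      have "V s i \<bullet> A s \<le> norm (V s i) * norm (A s)" by (rule norm_cauchy_schwarz)
      also have "\<dots> \<le> norm (V s i) * (K * norm (V s i))" by (rule mult_left_mono[OF A[OF s']]) simp
      also have "\<dots> = K * (V s i \<bullet> V s i)" by (simp add: dot_square_norm power2_eq_square)
      finally show "(2 * (V s i \<bullet> A s) - 2 * K * (V s i \<bullet> V s i)) * exp (- 2 * K * s) \<le> 0"
        by (simp add: mult_le_0_iff)
    qed simp
    then have "(norm (w i))\<^sup>2 * exp (- 2 * K) \<le> (norm (v i))\<^sup>2"
      by (simp add: f_def V dot_square_norm)
    note le = mult_right_mono[OF this, of "exp (2 * K)"]
    have e: "exp (- 2 * K) * exp (2 * K) = 1" by (simp add: exp_add[symmetric])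
    have "(norm (w i))\<^sup>2 = (norm (w i))\<^sup>2 * exp (- 2 * K) * exp (2 * K)"
      by (simp only: mult.assoc e mult_1_right)
    also have "\<dots> \<le> (norm (v i))\<^sup>2 * exp (2 * K)" by (rule le) simp
    also have "\<dots> = (exp K * norm (v i))\<^sup>2" by (simp add: power_mult_distrib exp_double)
    finally have "(norm (w i))\<^sup>2 \<le> (exp K * norm (v i))\<^sup>2" .
    then show ?thesis by (rule power2_le_imp_le) simp
  qed
  then show ?thesis using that[of "exp K"] by simp
qed

definition negative_definite_on :: "'a \<Rightarrow> ('i, 'e) tangent set \<Rightarrow> bool" where
  "negative_definite_on p W \<longleftrightarrow> (\<forall>w\<in>W. w \<noteq> (\<lambda>_. 0) \<longrightarrow> metric_at M g p w w < 0)"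

definition transport_invariant :: "'a \<Rightarrow> ('i, 'e) tangent set \<Rightarrow> bool" where
  "transport_invariant p W \<longleftrightarrow> (\<forall>c v w. transportable c \<longrightarrow> c 0 = p \<longrightarrow> c 1 = p \<longrightarrow>
     transports c v w \<longrightarrow> v \<in> W \<longrightarrow> w \<in> W)"

lemma subspace_components:
  assumes "linear_subspace_of W (tangent_space M p)"
  shows "subspace ((\<lambda>w. w j) ` W)"
proof (rule subspaceI)
  show "0 \<in> (\<lambda>w. w j) ` W" using assms by (force simp: linear_subspace_of_def)
next
  fix x y assume "x \<in> (\<lambda>w. w j) ` W" "y \<in> (\<lambda>w. w j) ` W"
  then obtain u v where "u \<in> W" "v \<in> W" "x = u j" "y = v j" by auto
  moreover then have "(\<lambda>i. u i + v i) \<in> W" using assms by (simp add: linear_subspace_of_def)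
  ultimately show "x + y \<in> (\<lambda>w. w j) ` W" by force
next
  fix c x assume "x \<in> (\<lambda>w. w j) ` W"
  then obtain u where "u \<in> W" "x = u j" by auto
  moreover then have "(\<lambda>i. c *\<^sub>R u i) \<in> W" using assms by (simp add: linear_subspace_of_def)
  ultimately show "c *\<^sub>R x \<in> (\<lambda>w. w j) ` W" by force
qed

lemma metric_at_fixed_continuous:
  assumes "j \<in> charts M" "x \<in> cran M j"
  shows "continuous_on S (\<lambda>u. g j x u u)"
proof -
  have "continuous_on UNIV (\<lambda>u. g j x u z)" for z
    by (rule linear_continuous_on[OF linear_conv_bounded_linear[THEN iffD1, OF metric_linear(2)[OF assms]]])
  then have "continuous_on UNIV (\<lambda>u. g j x u u)"
    by (rule linear_path_continuous[where L="g j x", OF metric_linear(1)[OF assms] _ continuous_on_id])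
  then show ?thesis using continuous_on_subset by blast
qed

text \<open>A continuous positive function on the compact unit sphere of \<open>W\<close> is bounded away from \<open>0\<close>.\<close>

lemma negative_definite_coercive:
  assumes W: "linear_subspace_of W (tangent_space M p)" and neg: "negative_definite_on p W"
    and j: "j \<in> charts M" "p \<in> cdom M j"
  obtains \<kappa> where "\<kappa> > 0" "\<And>w. w \<in> W \<Longrightarrow> \<kappa> * (norm (w j))\<^sup>2 \<le> - metric_at M g p w w"
proof -
  let ?x = "coord M j p"
  let ?S = "(\<lambda>w. w j) ` W"
  let ?h = "\<lambda>u. - g j ?x u u"
  have x: "?x \<in> cran M j" using j by (simp add: cran_def)
  have sub: "subspace ?S" by (rule subspace_components[OF W])
  have WT: "w \<in> tangent_space M p" if "w \<in> W" for w using W that by (auto simp: linear_subspace_of_def)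
  have h: "?h (w j) = - metric_at M g p w w" if "w \<in> W" for w
    using metric_at_chart[OF WT[OF that] WT[OF that] j] by simp
  have pos: "?h u > 0" if "u \<in> ?S" "u \<noteq> 0" for u
  proof -
    obtain w where w: "w \<in> W" "u = w j" using \<open>u \<in> ?S\<close> by auto
    then have "w \<noteq> (\<lambda>_. 0)" using \<open>u \<noteq> 0\<close> by auto
    then show ?thesis using neg w h[OF w(1)] by (auto simp: negative_definite_on_def)
  qed
  let ?C = "?S \<inter> sphere 0 1"
  have "\<exists>\<kappa>>0. \<forall>u\<in>?C. \<kappa> \<le> ?h u"
  proof (cases "?C = {}")
    case False
    have "compact ?C" using closed_subspace[OF sub] by (simp add: closed_Int_compact)
    moreover have "continuous_on ?C ?h" by (intro continuous_intros metric_at_fixed_continuous j x)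
    ultimately obtain u where u: "u \<in> ?C" "\<And>v. v \<in> ?C \<Longrightarrow> ?h u \<le> ?h v"
      using continuous_attains_inf[of ?C ?h] False by blast
    have "?h u > 0" by (rule pos) (use u in auto)
    then show ?thesis using u by blast
  qed (auto intro: exI[of _ 1])
  then obtain \<kappa> where \<kappa>: "\<kappa> > 0" "\<And>u. u \<in> ?C \<Longrightarrow> \<kappa> \<le> ?h u" by blast
  have "\<kappa> * (norm u)\<^sup>2 \<le> ?h u" if u: "u \<in> ?S" for u
  proof (cases "u = 0")
    case True
    then show ?thesis using linear_0[OF metric_linear(1)[OF j(1) x]] by simp
  next
    case False
    let ?u = "(1 / norm u) *\<^sub>R u"
    have "?u \<in> ?C" using u False subspace_scale[OF sub] by simp
    then have "\<kappa> \<le> ?h ?u" by (rule \<kappa>(2))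
    also have "?h ?u = (1 / norm u)\<^sup>2 * ?h u"
      using linear_cmul[OF metric_linear(1)[OF j(1) x]] linear_cmul[OF metric_linear(2)[OF j(1) x]]
      by (simp add: power2_eq_square)
    finally show ?thesis using False by (simp add: field_simps)
  qed
  then show ?thesis using that[OF \<kappa>(1)] h by force
qed

text \<open>
  Invariance enters here. Closing the curve \<open>\<alpha>\<close> up through the centre of the ball and a fixed curve \<open>\<beta>\<close> turns the transported
  vector into an element of the fixed definite space \<open>W\<close>, where its conserved square controls its norm, however long \<open>\<alpha>\<close>
  is. The vector \<open>e\<close> only travels along the short segment, where Gronwall's estimate applies, and along \<open>\<beta>\<close>.
\<close>

lemma bounded_pairing_in_coordinate_ball:
  assumes W: "linear_subspace_of W (tangent_space M p)" and neg: "negative_definite_on p W"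
    and inv: "transport_invariant p W" and w: "w \<in> W"
    and i: "i \<in> charts M" and ball: "cball y \<rho> \<subseteq> cran M i" and \<rho>: "\<rho> > 0"
  obtains B where "\<And>\<alpha> w' e. transportable \<alpha> \<Longrightarrow> \<alpha> 0 = p \<Longrightarrow> \<alpha> 1 \<in> cdom M i \<Longrightarrow> coord M i (\<alpha> 1) \<in> ball y \<rho> \<Longrightarrow>
    transports \<alpha> w w' \<Longrightarrow> e \<in> tangent_space M (\<alpha> 1) \<Longrightarrow> norm (e i) \<le> 1 \<Longrightarrow> \<bar>metric_at M g (\<alpha> 1) w' e\<bar> \<le> B"
proof -
  let ?q = "inv_into (cdom M i) (coord M i) y"
  define good where "good \<alpha> \<longleftrightarrow> transportable \<alpha> \<and> \<alpha> 0 = p \<and> \<alpha> 1 \<in> cdom M i \<and> coord M i (\<alpha> 1) \<in> ball y \<rho>" for \<alpha> :: "real \<Rightarrow> 'a"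
  show ?thesis
  proof (cases "\<exists>\<alpha>. good \<alpha>")
    case False
    then show ?thesis using that[of 0] unfolding good_def by blast
  next
    case True
    then obtain \<alpha>0 where \<alpha>0: "good \<alpha>0" by blast
    have yc: "y \<in> cran M i" using ball \<rho> by auto
    have q: "?q \<in> cdom M i" "coord M i ?q = y" using yc by (auto simp: inv_coord_cdom coord_inv)
    define \<sigma> where "\<sigma> \<alpha> = chart_segment i (coord M i (\<alpha> 1)) y" for \<alpha> :: "real \<Rightarrow> 'a"
    have \<sigma>: "transportable (\<sigma> \<alpha>)" "\<sigma> \<alpha> 0 = \<alpha> 1" "\<sigma> \<alpha> 1 = ?q" if "good \<alpha>" for \<alpha>
    proof -
      let ?x = "coord M i (\<alpha> 1)"
      have x: "?x \<in> cball y \<rho>" "y \<in> cball y \<rho>" using that \<rho> by (auto simp: good_def)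
      have "?x + s *\<^sub>R (y - ?x) \<in> cran M i" if "s \<in> {0..1}" for s
      proof -
        have "?x + s *\<^sub>R (y - ?x) = (1 - s) *\<^sub>R ?x + s *\<^sub>R y" by (simp add: algebra_simps)
        then have "?x + s *\<^sub>R (y - ?x) \<in> cball y \<rho>" using convexD[OF convex_cball x, of "1 - s" s] that by auto
        then show ?thesis using ball by blast
      qed
      then show "transportable (\<sigma> \<alpha>)" unfolding \<sigma>_def by (intro smooth_arc_transportable chart_segment_smooth i) auto
      show "\<sigma> \<alpha> 0 = \<alpha> 1" "\<sigma> \<alpha> 1 = ?q" using that inv_coord[OF i] by (auto simp: \<sigma>_def chart_segment_def good_def)
    qed
    have ends: "join_curves c d 0 = c 0" "join_curves c d 1 = d 1" for c d :: "real \<Rightarrow> 'a" by (auto simp: join_curves_def)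
    have rends: "reparam 1 (- 1) c 0 = c 1" "reparam 1 (- 1) c 1 = c 0" for c :: "real \<Rightarrow> 'a" by (auto simp: reparam_def)
    define \<beta> where "\<beta> = join_curves \<alpha>0 (\<sigma> \<alpha>0)"
    have \<beta>: "transportable \<beta>" "\<beta> 0 = p" "\<beta> 1 = ?q"
      unfolding \<beta>_def using \<sigma>[OF \<alpha>0] \<alpha>0 by (auto simp: good_def ends intro!: transportable_join)
    let ?r = "reparam 1 (- 1) \<beta>"
    have r: "transportable ?r" "?r 0 = ?q" "?r 1 = p" using transportable_reverse[OF \<beta>(1)] \<beta> by (auto simp: rends)
    have psp: "piecewise_smooth_path M c" if "transportable c" for c using that by (simp add: transportable_def)
    have wT: "w \<in> tangent_space M p" using W w by (auto simp: linear_subspace_of_def)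
    have "p \<in> topspace (mtop M)"
      using curve_in_topspace[of "{0..1}" \<beta> 0] psp[OF \<beta>(1)] \<beta>(2)
      by (auto simp: piecewise_smooth_path_between piecewise_smooth_between_def)
    then obtain j where j: "j \<in> charts M" "p \<in> cdom M j" using topspace_chart by blast
    let ?z = "coord M j p"
    have z: "?z \<in> cran M j" using j by (simp add: cran_def)
    obtain \<kappa> where \<kappa>: "\<kappa> > 0" "\<And>w. w \<in> W \<Longrightarrow> \<kappa> * (norm (w j))\<^sup>2 \<le> - metric_at M g p w w"
      by (rule negative_definite_coercive[OF W neg j]) blast
    obtain C where C: "C \<ge> 0" "\<And>x v w. x \<in> cball y \<rho> \<Longrightarrow> transports (chart_segment i x y) v w \<Longrightarrow> norm (w i) \<le> C * norm (v i)"
      by (rule chart_segment_transport_bound[OF i ball]) blast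
    obtain D where D: "D > 0" "\<And>u v. \<bar>g i y u v\<bar> \<le> D * norm u * norm v"
      using bilinear_bounded_pos[OF metric_bilinear[OF i yc]] by auto
    have "\<exists>E. transports \<beta> (lift_vector j p b) E" for b
      using \<beta>(1,2) lift_vector_tangent[OF j, of b] unfolding transportable_def by auto
    then obtain E where E: "\<And>b. transports \<beta> (lift_vector j p b) (E b)" by metis
    \<comment> \<open>\<open>R\<close> bounds the elements of \<open>W\<close> with the square of \<open>w\<close>; the vectors \<open>E b\<close> bound the transport back along \<open>\<beta>\<close>\<close>
    define R where "R = sqrt (- metric_at M g p w w / \<kappa>)"
    define B where "B = (\<Sum>b\<in>Basis. R * (D * C * norm (E b i)))"
    have "\<bar>metric_at M g (\<alpha> 1) w' e\<bar> \<le> B"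
      if \<alpha>: "transportable \<alpha>" "\<alpha> 0 = p" "\<alpha> 1 \<in> cdom M i" "coord M i (\<alpha> 1) \<in> ball y \<rho>"
        and w': "transports \<alpha> w w'" and e: "e \<in> tangent_space M (\<alpha> 1)" "norm (e i) \<le> 1" for \<alpha> w' e
    proof -
      have g\<alpha>: "good \<alpha>" using \<alpha> by (simp add: good_def)
      note \<sigma>\<alpha> = \<sigma>[OF g\<alpha>]
      have w'T: "w' \<in> tangent_space M (\<alpha> 1)" using transports_tangent[OF w'] by simp
      obtain w1 where w1: "transports (\<sigma> \<alpha>) w' w1" using \<sigma>\<alpha> w'T unfolding transportable_def by auto
      obtain e1 where e1: "transports (\<sigma> \<alpha>) e e1" using \<sigma>\<alpha> e unfolding transportable_def by auto
      have T1: "w1 \<in> tangent_space M ?q" "e1 \<in> tangent_space M ?q"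
        using transports_tangent[OF w1] transports_tangent[OF e1] \<sigma>\<alpha> by auto
      obtain w2 where w2: "transports ?r w1 w2" using r T1 unfolding transportable_def by auto
      obtain e2 where e2: "transports ?r e1 e2" using r T1 unfolding transportable_def by auto
      have T2: "w2 \<in> tangent_space M p" "e2 \<in> tangent_space M p"
        using transports_tangent[OF w2] transports_tangent[OF e2] r by auto
      have j1: "transportable (join_curves \<alpha> (\<sigma> \<alpha>))" "join_curves \<alpha> (\<sigma> \<alpha>) 0 = p" "join_curves \<alpha> (\<sigma> \<alpha>) 1 = ?q"
        using \<sigma>\<alpha> \<alpha> by (auto simp: ends intro!: transportable_join)
      have t1: "transports (join_curves \<alpha> (\<sigma> \<alpha>)) w w1"
        by (rule transports_join[OF psp psp _ w' w1]) (use \<sigma>\<alpha> \<alpha> in auto)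
      let ?L = "join_curves (join_curves \<alpha> (\<sigma> \<alpha>)) ?r"
      have L: "transportable ?L" "?L 0 = p" "?L 1 = p"
        using j1 r by (auto simp: ends intro!: transportable_join)
      have t2: "transports ?L w w2"
        by (rule transports_join[OF psp psp _ t1 w2]) (use j1 r in auto)
      have w2W: "w2 \<in> W" using inv L t2 w unfolding transport_invariant_def by blast
      have "metric_at M g p w2 w2 = metric_at M g p w w"
        using transports_metric[OF psp[OF L(1)] t2 t2] L by simp
      then have "\<kappa> * (norm (w2 j))\<^sup>2 \<le> - metric_at M g p w w" using \<kappa>(2)[OF w2W] by simp
      then have "(norm (w2 j))\<^sup>2 \<le> - metric_at M g p w w / \<kappa>" using \<kappa>(1) by (simp add: field_simps)
      then have nw2: "norm (w2 j) \<le> R" unfolding R_def by (rule real_le_rsqrt)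
      have R: "R \<ge> 0" using order_trans[OF norm_ge_zero nw2] .
      have ne1: "norm (e1 i) \<le> C"
      proof -
        have "norm (e1 i) \<le> C * norm (e i)" by (rule C(2)[of "coord M i (\<alpha> 1)" e e1]) (use \<alpha> e1 in \<open>auto simp: \<sigma>_def\<close>)
        also have "\<dots> \<le> C" using mult_left_mono[OF e(2) C(1)] by simp
        finally show ?thesis .
      qed
      \<comment> \<open>the components of \<open>e2\<close> are its products with basis vectors, which may be computed at the other end of \<open>\<beta>\<close>\<close>
      have comp: "\<bar>g j ?z b (e2 j)\<bar> \<le> D * C * norm (E b i)" for b
      proof -
        let ?l = "lift_vector j p b"
        have lT: "?l \<in> tangent_space M p" by (rule lift_vector_tangent[OF j])
        have ET: "E b \<in> tangent_space M ?q" using transports_tangent[OF E[of b]] \<beta> by simp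
        have "transports ?r (E b) ?l" by (rule transports_reverse[OF psp[OF \<beta>(1)] E])
        from transports_metric[OF psp[OF r(1)] this e2] r
        have "metric_at M g p ?l e2 = metric_at M g ?q (E b) e1" by simp
        moreover have "metric_at M g p ?l e2 = g j ?z b (e2 j)"
          using metric_at_chart[OF lT T2(2) j] lift_vector_self[OF j] by simp
        moreover have "metric_at M g ?q (E b) e1 = g i y (E b i) (e1 i)"
          using metric_at_chart[OF ET T1(2) i q(1)] q(2) by simp
        ultimately have "\<bar>g j ?z b (e2 j)\<bar> \<le> D * norm (E b i) * norm (e1 i)" using D(2) by simp
        also have "\<dots> \<le> D * norm (E b i) * C" by (rule mult_left_mono[OF ne1]) (use D in simp)
        finally show ?thesis by (simp add: mult_ac)
      qed
      have "metric_at M g (\<alpha> 1) w' e = metric_at M g ?q w1 e1"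
        using transports_metric[OF psp[OF \<sigma>\<alpha>(1)] w1 e1] \<sigma>\<alpha> by simp
      also have "\<dots> = metric_at M g p w2 e2"
        using transports_metric[OF psp[OF r(1)] w2 e2] r by simp
      also have "\<dots> = g j ?z (w2 j) (e2 j)" by (rule metric_at_chart[OF T2 j])
      also have "\<dots> = (\<Sum>b\<in>Basis. (w2 j \<bullet> b) *\<^sub>R g j ?z b (e2 j))"
        by (rule euclidean_linear_expand[OF metric_linear(2)[OF j(1) z]])
      finally have "\<bar>metric_at M g (\<alpha> 1) w' e\<bar> = norm (\<Sum>b\<in>Basis. (w2 j \<bullet> b) *\<^sub>R g j ?z b (e2 j))" by simp
      also have "\<dots> \<le> B"
        unfolding B_def
      proof (rule sum_norm_le)
        fix b :: 'e assume b: "b \<in> Basis"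
        have "\<bar>w2 j \<bullet> b\<bar> \<le> R" using Basis_le_norm[OF b, of "w2 j"] nw2 by linarith
        then have "\<bar>w2 j \<bullet> b\<bar> * \<bar>g j ?z b (e2 j)\<bar> \<le> R * (D * C * norm (E b i))"
          using comp[of b] R by (intro mult_mono) auto
        then show "norm ((w2 j \<bullet> b) *\<^sub>R g j ?z b (e2 j)) \<le> R * (D * C * norm (E b i))"
          by (simp add: abs_mult)
      qed
      finally show ?thesis .
    qed
    then show ?thesis using that by blast
  qed
qed

section \<open>Orthogonal complements of invariant subspaces\<close>

definition orthogonal_complement :: "'a \<Rightarrow> ('i, 'e) tangent set \<Rightarrow> ('i, 'e) tangent set" where
  "orthogonal_complement p U = {v \<in> tangent_space M p. \<forall>u\<in>U. metric_at M g p v u = 0}"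

lemma holonomy_invariant_imp_transport_invariant:
  assumes "\<forall>\<tau>\<in>holonomy_group M g p. \<tau> ` U \<subseteq> U"
  shows "transport_invariant p U"
  unfolding transport_invariant_def using holonomy_invariant_transports[OF assms] by blast

text \<open>Backward transport of \<open>u\<close> along the loop stays in \<open>U\<close> and turns the product with \<open>u\<close> at the end into one at the start.\<close>

lemma orthogonal_complement_invariant:
  assumes U: "U \<subseteq> tangent_space M p" and inv: "transport_invariant p U"
  shows "transport_invariant p (orthogonal_complement p U)"
  unfolding transport_invariant_def
proof (intro allI impI)
  fix c v w
  assume c: "transportable c" "c 0 = p" "c 1 = p" and vw: "transports c v w" and v: "v \<in> orthogonal_complement p U"
  have p: "piecewise_smooth_path M c" using c by (simp add: transportable_def)
  have "metric_at M g p w u = 0" if u: "u \<in> U" for u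
  proof -
    have "u \<in> tangent_space M (c 1)" using u U c by auto
    then obtain u0 where u0: "transports c u0 u" using c(1) unfolding transportable_def by blast
    have "u0 \<in> U"
      using inv transportable_reverse[OF c(1)] transports_reverse[OF p u0] u c
      unfolding transport_invariant_def by (auto simp: reparam_def)
    then have "metric_at M g p v u0 = 0" using v by (simp add: orthogonal_complement_def)
    then show ?thesis using transports_metric[OF p vw u0] c by simp
  qed
  then show "w \<in> orthogonal_complement p U"
    using transports_tangent[OF vw] c by (simp add: orthogonal_complement_def)
qed

lemma tangent_space_subspace:
  assumes "u \<in> tangent_space M p" "v \<in> tangent_space M p"
  shows "(\<lambda>i. u i + v i) \<in> tangent_space M p" "(\<lambda>i. a *\<^sub>R u i) \<in> tangent_space M p" "(\<lambda>i. 0) \<in> tangent_space M p"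
proof -
  have l: "linear (dtr i j (coord M i p))" if "i \<in> charts M" "j \<in> charts M" "p \<in> cdom M i \<inter> cdom M j" for i j
    by (rule dtr_linear) (use that in auto)
  have z: "u i = 0 \<and> v i = 0" if "\<not> (i \<in> charts M \<and> p \<in> cdom M i)" for i
    using assms that unfolding tangent_space_def by blast
  have t: "u j = dtr i j (coord M i p) (u i) \<and> v j = dtr i j (coord M i p) (v i)"
    if "i \<in> charts M" "j \<in> charts M" "p \<in> cdom M i \<inter> cdom M j" for i j
    using tangent_transition assms that by blast
  show "(\<lambda>i. u i + v i) \<in> tangent_space M p"
    unfolding tangent_space_def
  proof (intro CollectI conjI allI ballI impI)
    fix i j assume ij: "i \<in> charts M" "j \<in> charts M" "p \<in> cdom M i \<inter> cdom M j"
    show "u j + v j = dtr i j (coord M i p) (u i + v i)"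
      using t[OF ij] linear_add[OF l[OF ij], of "u i" "v i"] by metis
  qed (simp add: z)
  show "(\<lambda>i. a *\<^sub>R u i) \<in> tangent_space M p"
    unfolding tangent_space_def
  proof (intro CollectI conjI allI ballI impI)
    fix i j assume ij: "i \<in> charts M" "j \<in> charts M" "p \<in> cdom M i \<inter> cdom M j"
    show "a *\<^sub>R u j = dtr i j (coord M i p) (a *\<^sub>R u i)"
      using t[OF ij] linear_cmul[OF l[OF ij], of a "u i"] by metis
  qed (simp add: z)
  show "(\<lambda>i. 0) \<in> tangent_space M p"
    unfolding tangent_space_def
  proof (intro CollectI conjI allI ballI impI)
    fix i j assume ij: "i \<in> charts M" "j \<in> charts M" "p \<in> cdom M i \<inter> cdom M j"
    show "0 = dtr i j (coord M i p) 0" using linear_0[OF l[OF ij]] by metis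
  qed simp
qed

lemma orthogonal_complement_subspace:
  assumes p: "p \<in> topspace (mtop M)" and U: "U \<subseteq> tangent_space M p"
  shows "linear_subspace_of (orthogonal_complement p U) (tangent_space M p)"
proof -
  obtain j where j: "j \<in> charts M" "p \<in> cdom M j" using topspace_chart[OF p] by blast
  have x: "coord M j p \<in> cran M j" using j by (simp add: cran_def)
  note m = metric_at_chart[OF _ _ j]
  note l = linear_add[OF metric_linear(2)[OF j(1) x]] linear_cmul[OF metric_linear(2)[OF j(1) x]] linear_0[OF metric_linear(2)[OF j(1) x]]
  have z: "(\<lambda>i. 0) \<in> tangent_space M p" using tangent_space_subspace(3) lift_vector_tangent[OF j] by blast
  have mU: "metric_at M g p v u = g j (coord M j p) (v j) (u j)" if "v \<in> tangent_space M p" "u \<in> U" for u v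
    using m that U by blast
  show ?thesis
    unfolding linear_subspace_of_def orthogonal_complement_def
    using tangent_space_subspace mU z by (auto simp: l)
qed

text \<open>
  Lowering indices maps \<open>U\<close> to a space of dimension less than that of the tangent space, so some nonzero vector is
  orthogonal to its image in the Euclidean sense.
\<close>

lemma orthogonal_complement_nontrivial:
  assumes p: "p \<in> topspace (mtop M)" and U: "linear_subspace_of U (tangent_space M p)" "U \<noteq> tangent_space M p"
  shows "\<exists>v\<in>orthogonal_complement p U. v \<noteq> (\<lambda>_. 0)"
proof -
  obtain j where j: "j \<in> charts M" "p \<in> cdom M j" using topspace_chart[OF p] by blast
  let ?x = "coord M j p"
  have x: "?x \<in> cran M j" using j by (simp add: cran_def)
  have UT: "U \<subseteq> tangent_space M p" using U by (simp add: linear_subspace_of_def)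
  let ?S = "(\<lambda>w. w j) ` U"
  have sub: "subspace ?S" by (rule subspace_components[OF U(1)])
  have "?S \<noteq> UNIV"
  proof
    assume S: "?S = UNIV"
    have "v \<in> U" if v: "v \<in> tangent_space M p" for v
    proof -
      obtain u where u: "u \<in> U" "v j = u j" using S by (metis UNIV_I imageE)
      then have "v = u" using tangent_eqI[OF v _ j, of u] UT by blast
      then show ?thesis using u by simp
    qed
    then show False using U UT by blast
  qed
  then have dim: "dim ?S < DIM('e)"
    using sub dim_eq_full[of ?S] span_eq_iff[of ?S] dim_subset_UNIV[of ?S] by (metis le_neq_implies_less)
  let ?G = "flat (g j ?x)"
  have "dim (?G ` ?S) < DIM('e)"
    using dim_image_le[OF linear_flat[OF metric_bilinear[OF j(1) x]], of ?S] dim by linarith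
  then obtain y where y: "y \<noteq> 0" "\<And>z. z \<in> span (?G ` ?S) \<Longrightarrow> orthogonal y z"
    using orthogonal_to_subspace_exists by blast
  let ?v = "lift_vector j p y"
  have vT: "?v \<in> tangent_space M p" and vj: "?v j = y" using lift_vector_tangent[OF j] lift_vector_self[OF j] by auto
  have "metric_at M g p ?v u = 0" if u: "u \<in> U" for u
  proof -
    have "metric_at M g p ?v u = g j ?x (u j) y"
      using metric_at_chart[OF vT _ j, of u] u UT vj metric_sym[OF j(1) x] by auto
    also have "\<dots> = ?G (u j) \<bullet> y" by (rule inner_flat[OF metric_bilinear[OF j(1) x], symmetric])
    also have "\<dots> = 0" using y(2)[of "?G (u j)"] u by (auto simp: orthogonal_def inner_commute intro: span_base)
    finally show ?thesis .
  qed
  then have "?v \<in> orthogonal_complement p U" using vT by (simp add: orthogonal_complement_def)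
  moreover have "?v \<noteq> (\<lambda>_. 0)" using vj y by metis
  ultimately show ?thesis by blast
qed

end

section \<open>The cone\<close>

lemma second_countable_prod_topology:
  assumes "second_countable X" "second_countable Y"
  shows "second_countable (prod_topology X Y)"
proof -
  obtain A where A: "countable A" "\<And>V. V \<in> A \<Longrightarrow> openin X V"
    "\<And>U x. openin X U \<Longrightarrow> x \<in> U \<Longrightarrow> \<exists>V\<in>A. x \<in> V \<and> V \<subseteq> U"
    using assms(1) unfolding second_countable_def by auto
  obtain B where B: "countable B" "\<And>V. V \<in> B \<Longrightarrow> openin Y V"
    "\<And>U x. openin Y U \<Longrightarrow> x \<in> U \<Longrightarrow> \<exists>V\<in>B. x \<in> V \<and> V \<subseteq> U"
    using assms(2) unfolding second_countable_def by auto
  let ?C = "(\<lambda>(U, V). U \<times> V) ` (A \<times> B)"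
  have "\<exists>W\<in>?C. z \<in> W \<and> W \<subseteq> S" if S: "openin (prod_topology X Y) S" "z \<in> S" for S z
  proof -
    obtain x y where z: "z = (x, y)" by fastforce
    obtain U V where UV: "openin X U" "openin Y V" "x \<in> U" "y \<in> V" "U \<times> V \<subseteq> S"
      using S(1)[unfolded openin_prod_topology_alt, rule_format, OF S(2)[unfolded z]] by metis
    obtain U' where U': "U' \<in> A" "x \<in> U'" "U' \<subseteq> U" using A(3)[OF UV(1,3)] by blast
    obtain V' where V': "V' \<in> B" "y \<in> V'" "V' \<subseteq> V" using B(3)[OF UV(2,4)] by blast
    have "U' \<times> V' \<in> ?C" using U'(1) V'(1) by force
    moreover have "z \<in> U' \<times> V'" using U'(2) V'(2) z by simp
    moreover have "U' \<times> V' \<subseteq> S" using U'(3) V'(3) UV(5) by blast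
    ultimately show ?thesis by (rule_tac bexI[of _ "U' \<times> V'"]) (rule conjI)
  qed
  moreover have "openin (prod_topology X Y) W" if "W \<in> ?C" for W
    using that A(2) B(2) by (auto simp: openin_prod_Times_iff)
  moreover have "countable ?C" using A(1) B(1) by auto
  ultimately show ?thesis unfolding second_countable_def by (intro exI[of _ ?C]) blast
qed

lemma second_countable_top_of_set:
  "second_countable (top_of_set (S :: 'a::second_countable_topology set))"
proof (rule second_countable_subtopology)
  obtain B :: "'a set set" where B: "countable B" "topological_basis B" using ex_countable_basis by blast
  show "second_countable (euclidean :: 'a topology)"
    unfolding second_countable_def
  proof (intro exI[of _ B] conjI ballI allI impI)
    show "openin euclidean V" if "V \<in> B" for V using topological_basis_open[OF B(2) that] by simp
    show "\<exists>V\<in>B. x \<in> V \<and> V \<subseteq> U" if "openin euclidean U \<and> x \<in> U" for U x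
      using topological_basisE[OF B(2), of U x] that by (metis open_openin)
  qed (rule B)
qed

lemma Ck_on_add:
  assumes "open S" "Ck_on k S f" "Ck_on k S h"
  shows "Ck_on k S (\<lambda>x. f x + h x)"
  using assms(2,3)
proof (induction k arbitrary: f h)
  case 0
  then show ?case by (auto intro: continuous_intros)
next
  case (Suc k)
  then show ?case
    by (intro Ck_on_SucI[OF assms(1), where f'="\<lambda>x v. frechet_derivative f (at x) v + frechet_derivative h (at x) v"]
        has_derivative_add Suc.IH) (auto simp: frechet_derivative_works)
qed

lemma Ck_on_Suc_imp: "Ck_on (Suc k) S f \<Longrightarrow> Ck_on k S f"
proof (induction k arbitrary: f)
  case 0
  then show ?case
    by (auto intro!: continuous_at_imp_continuous_on differentiable_imp_continuous_within)
next
  case (Suc k)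
  have "Ck_on k S (\<lambda>x. frechet_derivative f (at x) v)" for v
    using Suc.IH Suc.prems by (metis Ck_on.simps(2))
  then show ?case using Suc.prems by simp
qed

lemma Ck_on_mult:
  fixes f h :: "'a::real_normed_vector \<Rightarrow> real"
  assumes "open S" "Ck_on k S f" "Ck_on k S h"
  shows "Ck_on k S (\<lambda>x. f x * h x)"
  using assms(2,3)
proof (induction k arbitrary: f h)
  case 0
  then show ?case by (auto intro: continuous_intros)
next
  case (Suc k)
  let ?D = "\<lambda>x v. f x * frechet_derivative h (at x) v + frechet_derivative f (at x) v * h x"
  show ?case
  proof (rule Ck_on_SucI[OF assms(1), where f'="?D"])
    show "((\<lambda>x. f x * h x) has_derivative ?D x) (at x)" if "x \<in> S" for x
      using Suc.prems that by (intro has_derivative_mult) (auto simp: frechet_derivative_works)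
    show "Ck_on k S (\<lambda>x. ?D x v)" for v
      using Suc.prems Ck_on_Suc_imp[OF Suc.prems(1)] Ck_on_Suc_imp[OF Suc.prems(2)]
      by (intro Ck_on_add assms(1) Suc.IH) auto
  qed
qed

lemma Ck_on_snd:
  assumes "open S" "Ck_on k S f"
  shows "Ck_on k (R \<times> S) (\<lambda>z. f (snd z))"
  by (rule Ck_on_subset[of k "{z. 0 + snd z \<in> S}"])
    (use Ck_on_affine_compose[OF assms(1) bounded_linear_snd assms(2), of 0] in auto)

lemma cone_simps [simp]:
  "charts (cone_manifold M) = charts M"
  "cdom (cone_manifold M) i = {0<..} \<times> cdom M i"
  "coord (cone_manifold M) i z = (fst z, coord M i (snd z))"
  "mtop (cone_manifold M) = prod_topology (top_of_set {0<..}) (mtop M)"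
  by (auto simp: cone_manifold_def case_prod_beta)

lemma cone_cran: "cran (cone_manifold M) i = {0<..} \<times> cran M i"
  by (force simp: cran_def image_iff)

lemma cone_metric_apply: "cone_metric g i z u v = fst u * fst v + (fst z)\<^sup>2 * g i (snd z) (snd u) (snd v)"
  by (simp add: cone_metric_def case_prod_beta)

context pseudo_riemannian_manifold
begin

abbreviation CM :: "(real \<times> 'a, 'i, real \<times> 'e) manifold" where "CM \<equiv> cone_manifold M"

abbreviation cg :: "('i, real \<times> 'e) metric" where "cg \<equiv> cone_metric g"

lemma cone_transition:
  assumes "i \<in> charts M" "r > 0" "x \<in> cran M i"
  shows "transition CM i j (r, x) = (r, transition M i j x)"
proof -
  let ?p = "inv_into (cdom M i) (coord M i) x"
  have inj: "inj_on (coord CM i) (cdom CM i)"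
    using coord_inj[OF assms(1)] by (auto simp: inj_on_def)
  have "inv_into (cdom CM i) (coord CM i) (coord CM i (r, ?p)) = (r, ?p)"
    by (rule inv_into_f_f[OF inj]) (use assms inv_coord_cdom in auto)
  then have "inv_into (cdom CM i) (coord CM i) (r, x) = (r, ?p)"
    using coord_inv[OF assms(3)] by simp
  then show ?thesis by (simp add: transition_def)
qed

lemma cone_overlap: "coord CM i ` (cdom CM i \<inter> cdom CM j) = {0<..} \<times> overlap i j"
  by (force simp: image_iff)

lemma overlap_subset_cran: "overlap i j \<subseteq> cran M i"
  by (auto simp: cran_def)

lemma cone_smooth_manifold: "smooth_manifold CM"
  unfolding smooth_manifold_def
proof (intro conjI ballI)
  have H: "Hausdorff_space (mtop M)" "second_countable (mtop M)" using manifold by (auto simp: smooth_manifold_def)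
  show "Hausdorff_space (mtop CM)"
    using H(1) by (simp add: Hausdorff_space_prod_topology Hausdorff_space_subtopology)
  show "second_countable (mtop CM)"
    using H(2) by (simp add: second_countable_prod_topology second_countable_top_of_set)
  show "(\<Union>i\<in>charts CM. cdom CM i) = topspace (mtop CM)"
    by (auto simp: topspace_charts)
  fix i assume "i \<in> charts CM"
  then have i: "i \<in> charts M" by simp
  show "openin (mtop CM) (cdom CM i)"
    using cdom_open[OF i] by (simp add: openin_prod_Times_iff)
  show "open (cran CM i)" unfolding cone_cran by (intro open_Times cran_open i) simp
  obtain h where h: "homeomorphic_maps (subtopology (mtop M) (cdom M i)) (top_of_set (cran M i)) (coord M i) h"
    using coord_homeomorphic_map[OF i] homeomorphic_map_maps by blast
  have "homeomorphic_maps (top_of_set {0<..}) (top_of_set {0<..}) (\<lambda>r::real. r) (\<lambda>r. r)"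
    by (simp add: homeomorphic_maps_def)
  then have "homeomorphic_maps (prod_topology (top_of_set {0<..}) (subtopology (mtop M) (cdom M i)))
      (prod_topology (top_of_set {0<..}) (top_of_set (cran M i))) (\<lambda>(r::real, q). (r, coord M i q)) (\<lambda>(r, x). (r, h x))"
    using h unfolding homeomorphic_maps_prod by blast
  moreover have "prod_topology (top_of_set {0<..}) (subtopology (mtop M) (cdom M i))
      = subtopology (mtop CM) (cdom CM i)"
    by (simp add: subtopology_Times subtopology_subtopology)
  moreover have "prod_topology (top_of_set {0<..}) (top_of_set (cran M i)) = top_of_set (cran CM i)"
    by (simp add: cone_cran)
  moreover have "(\<lambda>(r::real, q). (r, coord M i q)) = coord CM i" by auto
  ultimately show "homeomorphic_map (subtopology (mtop CM) (cdom CM i))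
      (top_of_set (cran CM i)) (coord CM i)"
    using homeomorphic_map_maps by metis
  fix j assume "j \<in> charts CM"
  then have j: "j \<in> charts M" by simp
  show "smooth_on (coord CM i ` (cdom CM i \<inter> cdom CM j)) (transition CM i j)"
    unfolding smooth_on_def cone_overlap
  proof
    fix k
    have op: "open ({0<..} \<times> overlap i j :: (real \<times> 'e) set)" by (intro open_Times overlap_open i j) simp
    have "Ck_on k ({0<..} \<times> overlap i j) (\<lambda>z :: real \<times> 'e. (fst z, transition M i j (snd z)))"
      by (intro Ck_on_Pair[OF op] Ck_on_bounded_linear[OF bounded_linear_fst] Ck_on_snd overlap_open i j)
        (use transition_smooth[OF i j] in \<open>simp add: smooth_on_def\<close>)
    then show "Ck_on k ({0<..} \<times> overlap i j) (transition CM i j)"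
    proof (rule Ck_on_cong[OF op, rotated])
      fix z :: "real \<times> 'e" assume "z \<in> {0<..} \<times> overlap i j"
      then have z: "fst z > 0" "snd z \<in> overlap i j" by (simp_all add: mem_Times_iff)
      from z(1) subsetD[OF overlap_subset_cran z(2)] have "fst z > 0" "snd z \<in> cran M i" .
      from cone_transition[OF i this, of j] show "(fst z, transition M i j (snd z)) = transition CM i j z" by simp
    qed
  qed
qed

lemma cone_dtr:
  assumes ij: "i \<in> charts M" "j \<in> charts M" and x: "r > 0" "x \<in> overlap i j"
  shows "frechet_derivative (transition CM i j) (at (r, x)) u = (fst u, dtr i j x (snd u))"
proof -
  have op: "open ({0<..} \<times> overlap i j :: (real \<times> 'e) set)" by (intro open_Times overlap_open ij) simp
  have "((\<lambda>z. transition M i j (snd z)) has_derivative (\<lambda>u. dtr i j x (snd u))) (at (r, x))"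
    by (rule has_derivative_compose[of snd snd "(r, x)" UNIV "transition M i j"])
      (use dtr[OF ij x(2)] in \<open>auto intro!: bounded_linear_imp_has_derivative bounded_linear_snd\<close>)
  then have "((\<lambda>z. (fst z, transition M i j (snd z))) has_derivative (\<lambda>u. (fst u, dtr i j x (snd u)))) (at (r, x))"
    by (intro has_derivative_Pair) (auto intro!: bounded_linear_imp_has_derivative bounded_linear_fst)
  then have "(transition CM i j has_derivative (\<lambda>u. (fst u, dtr i j x (snd u)))) (at (r, x))"
  proof (rule has_derivative_transform_within_open[OF _ op])
    fix z :: "real \<times> 'e" assume "z \<in> {0<..} \<times> overlap i j"
    then have z: "fst z > 0" "snd z \<in> overlap i j" by (simp_all add: mem_Times_iff)
    from z(1) subsetD[OF overlap_subset_cran z(2)] have "fst z > 0" "snd z \<in> cran M i" .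
    from cone_transition[OF ij(1) this, of j] show "(fst z, transition M i j (snd z)) = transition CM i j z" by simp
  qed (use x in auto)
  from frechet_derivative_at[OF this] show ?thesis by metis
qed

lemma cone_pseudo_riemannian_metric: "pseudo_riemannian_metric CM cg"
  unfolding pseudo_riemannian_metric_def
proof (intro conjI ballI allI)
  fix i x assume "i \<in> charts CM" "x \<in> cran CM i"
  then have i: "i \<in> charts M" and x: "fst x > 0" "snd x \<in> cran M i" by (auto simp: cone_cran)
  note l1 = linear_add[OF metric_linear(1)[OF i x(2)]] linear_cmul[OF metric_linear(1)[OF i x(2)]]
  note l2 = linear_add[OF metric_linear(2)[OF i x(2)]] linear_cmul[OF metric_linear(2)[OF i x(2)]]
  show "bilinear (cg i x)"
    unfolding bilinear_def
    by (intro conjI allI linearI) (simp_all add: cone_metric_apply l1 l2 algebra_simps)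
  show "cg i x u v = cg i x v u" for u v
    using metric_sym[OF i x(2)] by (simp add: cone_metric_apply mult.commute)
  show "(\<forall>v. cg i x u v = 0) \<longrightarrow> u = 0" for u
  proof
    assume u: "\<forall>v. cg i x u v = 0"
    have g0: "g i (snd x) w 0 = 0" for w using linear_0[OF metric_linear(1)[OF i x(2)]] .
    have "fst u = 0" using u[rule_format, of "(1, 0)"] g0 by (simp add: cone_metric_apply)
    moreover have "g i (snd x) (snd u) v = 0" for v using u[rule_format, of "(0, v)"] x by (simp add: cone_metric_apply)
    then have "snd u = 0" using metric_nondegenerate[OF i x(2)] by blast
    ultimately show "u = 0" by (simp add: prod_eq_iff)
  qed
next
  fix i and u v :: "real \<times> 'e" assume "i \<in> charts CM"
  then have i: "i \<in> charts M" by simp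
  have op: "open ({0<..} \<times> cran M i :: (real \<times> 'e) set)" by (intro open_Times cran_open i) simp
  show "smooth_on (cran CM i) (\<lambda>x. cg i x u v)"
    unfolding smooth_on_def cone_cran cone_metric_apply power2_eq_square
  proof
    fix k
    show "Ck_on k ({0<..} \<times> cran M i) (\<lambda>x. fst u * fst v + fst x * fst x * g i (snd x) (snd u) (snd v))"
      by (intro Ck_on_add[OF op] Ck_on_mult[OF op] Ck_on_const Ck_on_bounded_linear[OF bounded_linear_fst] Ck_on_snd[where f="\<lambda>x. g i x (snd u) (snd v)"] cran_open i)
        (use metric_smooth[OF i] in \<open>simp add: smooth_on_def\<close>)
  qed
next
  fix i j p and u v :: "real \<times> 'e"
  assume "i \<in> charts CM" "j \<in> charts CM" "p \<in> cdom CM i \<inter> cdom CM j"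
  then have ij: "i \<in> charts M" "j \<in> charts M" and p: "fst p > 0" "snd p \<in> cdom M i" "snd p \<in> cdom M j" by auto
  have d: "frechet_derivative (transition CM i j) (at (coord CM i p)) w
      = (fst w, dtr i j (coord M i (snd p)) (snd w))" for w
    using cone_dtr[OF ij p(1) overlapI[OF p(2,3)]] by simp
  show "cg i (coord CM i p) u v =
        cg j (coord CM j p)
          (frechet_derivative (transition CM i j) (at (coord CM i p)) u)
          (frechet_derivative (transition CM i j) (at (coord CM i p)) v)"
    unfolding d using metric_transition[OF ij p(2,3)] by (simp add: cone_metric_apply)
qed

end

text \<open>Interpreting the cone inside the locale of its base would iterate forever (cones over cones), hence a separate locale.\<close>

locale metric_cone = pseudo_riemannian_manifold M g
  for M :: "('a, 'i, 'e::euclidean_space) manifold" and g :: "('i, 'e) metric"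
begin

sublocale cone: pseudo_riemannian_manifold "cone_manifold M" "cone_metric g"
  by unfold_locales (rule cone_smooth_manifold cone_pseudo_riemannian_metric)+

lemma cone_dmetric:
  assumes i: "i \<in> charts M" and x: "r > 0" "x \<in> cran M i"
  shows "frechet_derivative (\<lambda>z. cg i z v w) (at (r, x)) u
    = 2 * r * fst u * g i x (snd v) (snd w) + r\<^sup>2 * dmetric i x (snd u) (snd v) (snd w)"
proof -
  have dm: "((\<lambda>y. g i y (snd v) (snd w)) has_derivative (\<lambda>u. dmetric i x u (snd v) (snd w))) (at (snd (r, x)))"
    unfolding snd_conv by (rule dmetric(1)[OF i x(2)])
  have "((\<lambda>z. g i (snd z) (snd v) (snd w)) has_derivative (\<lambda>u. dmetric i x (snd u) (snd v) (snd w))) (at (r, x))"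
    by (rule has_derivative_compose[OF bounded_linear_imp_has_derivative[OF bounded_linear_snd] dm])
  then have "((\<lambda>z. fst v * fst w + (fst z * fst z) * g i (snd z) (snd v) (snd w)) has_derivative
      (\<lambda>u. 0 + ((fst (r, x) * fst (r, x)) * dmetric i x (snd u) (snd v) (snd w)
        + (fst (r, x) * fst u + fst u * fst (r, x)) * g i (snd (r, x)) (snd v) (snd w)))) (at (r, x))"
    by (intro has_derivative_add has_derivative_mult has_derivative_const)
      (auto intro!: bounded_linear_imp_has_derivative bounded_linear_fst)
  then have "((\<lambda>z. cg i z v w) has_derivative
      (\<lambda>u. 2 * r * fst u * g i x (snd v) (snd w) + r\<^sup>2 * dmetric i x (snd u) (snd v) (snd w))) (at (r, x))"
    by (simp add: cone_metric_apply power2_eq_square algebra_simps)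
  from fun_cong[OF frechet_derivative_at[OF this], of u] show ?thesis by (rule sym)
qed

text \<open>
  The derivative of the factor \<open>r\<^sup>2\<close> contributes the radial component, which is the second fundamental form of the slice at
  distance \<open>r\<close>, and the two terms with \<open>1 / r\<close>.
\<close>

lemma cone_christoffel:
  assumes i: "i \<in> charts M" and x: "r > 0" "x \<in> cran M i"
  shows "christoffel cg i (r, x) u v =
    (- r * g i x (snd u) (snd v), christoffel g i x (snd u) (snd v) + (1 / r) *\<^sub>R (fst u *\<^sub>R snd v + fst v *\<^sub>R snd u))"
proof (rule cone.christoffel_unique)
  show "i \<in> charts CM" "(r, x) \<in> cran CM i" by (simp_all add: cone_cran i x)
  note l2 = linear_add[OF metric_linear(2)[OF i x(2)]] linear_cmul[OF metric_linear(2)[OF i x(2)]]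
  fix z :: "real \<times> 'e"
  show "cg i (r, x) (- r * g i x (snd u) (snd v), christoffel g i x (snd u) (snd v) + (1 / r) *\<^sub>R (fst u *\<^sub>R snd v + fst v *\<^sub>R snd u)) z
      = christoffel_first_kind cg i (r, x) u v z"
    unfolding christoffel_first_kind_def[of "cg"] cone_dmetric[OF i x]
    unfolding cone_metric_apply
    using x by (simp add: l2 christoffel[OF i x(2)] christoffel_first_kind_def field_simps power2_eq_square)
qed

end

section \<open>Geodesics\<close>

context pseudo_riemannian_manifold
begin

text \<open>The curve \<open>c\<close> is traversed from time \<open>0\<close> to \<open>t\<close>, rescaled to the unit interval; \<open>t\<close> may be negative.\<close>

lemma parallel_field_transports:
  assumes c: "smooth_curve_on M UNIV c" and tan: "\<And>s. V s \<in> tangent_space M (c s)"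
    and z: "\<And>s. cov_deriv_zero M g c V s"
  shows "transports (reparam 0 t c) (V 0) (V t)"
proof -
  have sa: "smooth_at c s" for s
    unfolding smooth_at_def using smooth_curve_derivative[OF c] by blast
  have cc: "continuous_map (top_of_set UNIV) (mtop M) c" using c by (simp add: smooth_curve_on_def)
  have "continuous_on {s \<in> {0..1}. reparam 0 t c s \<in> cdom M i} (\<lambda>s. reparam 0 t V s i)" if i: "i \<in> charts M" for i
  proof -
    have "continuous_on {s. c s \<in> cdom M i} (\<lambda>s. V s i)"
    proof (rule continuous_at_imp_continuous_on, rule ballI)
      fix s assume "s \<in> {s. c s \<in> cdom M i}"
      then have "((\<lambda>s. V s i) has_vector_derivative
          - christoffel g i (coord M i (c s)) (velocity M c s i) (V s i)) (at s)"
        using z[of s] i by (simp add: cov_deriv_zero_def)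
      then show "continuous (at s) (\<lambda>s. V s i)" by (rule has_vector_derivative_continuous)
    qed
    then show ?thesis unfolding reparam_def
      by (rule continuous_on_compose2[where f="\<lambda>s. 0 + s * t"]) (auto intro!: continuous_intros)
  qed
  moreover have "reparam 0 t V s \<in> tangent_space M (reparam 0 t c s)" for s
    using tan by (simp add: reparam_def)
  moreover have "cov_deriv_zero M g (reparam 0 t c) (reparam 0 t V) s" for s
    by (rule cov_deriv_zero_affine[OF z sa])
  ultimately have "parallel_between 0 1 (reparam 0 t c) (reparam 0 t V)"
    unfolding parallel_between_def by (intro conjI ballI exI[of _ "{}"]) auto
  then show ?thesis unfolding transports_def parallel_along_between
    by (intro exI[of _ "reparam 0 t V"]) (simp add: reparam_def)
qed

lemma smooth_curve_arc: "smooth_curve_on M UNIV c \<Longrightarrow> smooth_arc M a b (reparam \<beta> \<alpha> c)"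
  unfolding smooth_arc_def using smooth_curve_affine[of UNIV c \<beta> \<alpha>] by (intro exI[of _ UNIV]) auto

lemma velocity_tangent:
  assumes c: "smooth_curve_on M UNIV c"
  shows "velocity M c t \<in> tangent_space M (c t)"
  unfolding tangent_space_def
proof (intro CollectI conjI allI ballI impI)
  have cc: "continuous_map (top_of_set UNIV) (mtop M) c" using c by (simp add: smooth_curve_on_def)
  fix i j assume ij: "i \<in> charts M" "j \<in> charts M" and p: "c t \<in> cdom M i \<inter> cdom M j"
  have d: "((\<lambda>s. coord M i (c s)) has_vector_derivative velocity M c t i) (at t)"
    by (rule smooth_curve_derivative[OF c ij(1)]) (use p in auto)
  show "velocity M c t j = dtr i j (coord M i (c t)) (velocity M c t i)"
    by (rule velocity_transition[OF ij _ _ curve_preimage_open[OF cc _ cdom_open[OF ij(1)]] _ _ d]) (use p in auto)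
qed (auto simp: velocity_def)

lemma geodesic_speed_constant:
  assumes c: "complete_geodesic M g c"
  shows "metric_at M g (c t) (velocity M c t) (velocity M c t) = metric_at M g (c 0) (velocity M c 0) (velocity M c 0)"
proof -
  have s: "smooth_curve_on M UNIV c" and z: "\<And>t. cov_deriv_zero M g c (velocity M c) t"
    using c by (auto simp: complete_geodesic_def)
  have p: "piecewise_smooth_path M (reparam 0 t c)"
    unfolding piecewise_smooth_path_between by (rule smooth_arc_piecewise[OF smooth_curve_arc[OF s]])
  have tr: "transports (reparam 0 t c) (velocity M c 0) (velocity M c t)"
    by (rule parallel_field_transports[OF s velocity_tangent[OF s] z])
  show ?thesis using transports_metric[OF p tr tr] by (simp add: reparam_def)
qed

end

section \<open>Null directions over geodesics\<close>

text \<open>At \<open>t = (C + \<bar>a\<bar> + 1) / (k \<bar>b\<bar>)\<close> the estimate \<open>exp (k t) \<ge> 1 + k t\<close> already contradicts the bound.\<close>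

lemma bounded_exponential_combination:
  fixes a b k C :: real
  assumes k: "k > 0" and bd: "\<And>t. \<bar>exp (- k * t) * a + exp (k * t) * b\<bar> \<le> C"
  shows "b = 0"
proof (rule ccontr)
  assume b: "b \<noteq> 0"
  have C: "C \<ge> 0" using bd[of 0] by (meson abs_ge_zero order_trans)
  define t where "t = (C + \<bar>a\<bar> + 1) / (k * \<bar>b\<bar>)"
  have t: "t \<ge> 0" using k b C by (simp add: t_def)
  have "k * t * \<bar>b\<bar> = C + \<bar>a\<bar> + 1" using k b by (simp add: t_def)
  moreover have "k * t * \<bar>b\<bar> \<le> exp (k * t) * \<bar>b\<bar>"
    using exp_ge_add_one_self[of "k * t"] by (intro mult_right_mono) linarith+
  moreover have "exp (- k * t) * \<bar>a\<bar> \<le> 1 * \<bar>a\<bar>"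
    using k t by (intro mult_right_mono) auto
  moreover have "\<bar>exp (k * t) * b\<bar> = exp (k * t) * \<bar>b\<bar>" "\<bar>exp (- k * t) * a\<bar> = exp (- k * t) * \<bar>a\<bar>"
    by (simp_all add: abs_mult)
  ultimately show False using bd[of t] by linarith
qed

context metric_cone
begin

lemma cone_curve_smooth:
  assumes c: "smooth_curve_on M J c" and J: "open J" and r: "r > 0"
  shows "smooth_curve_on CM J (\<lambda>t. (r, c t))"
  unfolding smooth_curve_on_def
proof (intro conjI ballI)
  have cc: "continuous_map (top_of_set J) (mtop M) c" using c by (simp add: smooth_curve_on_def)
  have "continuous_map (top_of_set J) (top_of_set {0<..}) (\<lambda>t. r)" using r by simp
  with cc show "continuous_map (top_of_set J) (mtop CM) (\<lambda>t. (r, c t))"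
    by (simp add: continuous_map_pairedI)
  fix i assume "i \<in> charts CM"
  then have i: "i \<in> charts M" by simp
  have eq: "{t \<in> J. (r, c t) \<in> cdom CM i} = {t \<in> J. c t \<in> cdom M i}" using r by auto
  show "smooth_on {t \<in> J. (r, c t) \<in> cdom CM i} (\<lambda>t. coord CM i (r, c t))"
    unfolding eq smooth_on_def
  proof
    fix k
    have "Ck_on k {t \<in> J. c t \<in> cdom M i} (\<lambda>t. coord M i (c t))" using c i by (auto simp: smooth_curve_on_def smooth_on_def)
    then show "Ck_on k {t \<in> J. c t \<in> cdom M i} (\<lambda>t. coord CM i (r, c t))"
      using Ck_on_Pair[OF curve_preimage_open[OF cc J cdom_open[OF i]] Ck_on_const, of k "\<lambda>t. coord M i (c t)" r] by simp
  qed
qed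

lemma cone_velocity:
  assumes c: "smooth_curve_on M UNIV c" and r: "r > 0" and i: "i \<in> charts M" "c t \<in> cdom M i"
  shows "velocity CM (\<lambda>t. (r, c t)) t i = (0, velocity M c t i)"
proof -
  have "((\<lambda>s. coord M i (c s)) has_vector_derivative velocity M c t i) (at t)"
    by (rule smooth_curve_derivative[OF c i(1) _ i(2)]) simp
  then have "((\<lambda>s. (r, coord M i (c s))) has_vector_derivative (0, velocity M c t i)) (at t)"
    by (intro has_vector_derivative_Pair has_vector_derivative_const)
  then show ?thesis using i r by (simp add: velocity_def vector_derivative_at)
qed

definition cone_vector :: "'a \<Rightarrow> real \<Rightarrow> ('i, 'e) tangent \<Rightarrow> ('i, real \<times> 'e) tangent" where
  "cone_vector q a u = (\<lambda>i. if i \<in> charts M \<and> q \<in> cdom M i then (a, u i) else 0)"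

lemma cone_vector_tangent:
  assumes u: "u \<in> tangent_space M q" and r: "r > 0"
  shows "cone_vector q a u \<in> tangent_space CM (r, q)"
proof -
  have 1: "cone_vector q a u j = frechet_derivative (transition CM i j) (at (coord CM i (r, q))) (cone_vector q a u i)"
    if "i \<in> charts M" "j \<in> charts M" "q \<in> cdom M i" "q \<in> cdom M j" for i j
    using cone_dtr[OF that(1,2) r overlapI[OF that(3,4)]] tangent_transition[OF u that] that
    by (simp add: cone_vector_def)
  have 2: "cone_vector q a u i = 0" if "\<not> (i \<in> charts M \<and> q \<in> cdom M i)" for i
    using that by (simp only: cone_vector_def if_False)
  show ?thesis
    unfolding tangent_space_def
  proof (intro CollectI conjI allI ballI impI)
    fix i assume "\<not> (i \<in> charts CM \<and> (r, q) \<in> cdom CM i)"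
    with r show "cone_vector q a u i = 0" by (intro 2) simp
  next
    fix i j
    assume "i \<in> charts CM" "j \<in> charts CM"
      "(r, q) \<in> cdom CM i \<inter> cdom CM j"
    then show "cone_vector q a u j = frechet_derivative (transition CM i j)
        (at (coord CM i (r, q))) (cone_vector q a u i)"
      by (intro 1) simp_all
  qed
qed

text \<open>
  Over a geodesic with \<open>g c' c' = - \<mu>\<^sup>2\<close> the cone is a flat, totally geodesic Lorentzian surface. The radial
  direction turns in it by hyperbolic rotations, with the null directions as eigenvectors: they are parallel after
  rescaling by \<open>exp (\<mu> s)\<close>. The second null direction is obtained from \<open>- \<mu>\<close>.
\<close>

definition null_field :: "real \<Rightarrow> real \<Rightarrow> (real \<Rightarrow> 'a) \<Rightarrow> real \<Rightarrow> ('i, real \<times> 'e) tangent" where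
  "null_field r \<mu> c s = cone_vector (c s) (exp (\<mu> * s)) (\<lambda>i. (- (exp (\<mu> * s) / (r * \<mu>))) *\<^sub>R velocity M c s i)"

lemma null_field_tangent:
  assumes c: "smooth_curve_on M UNIV c" and r: "r > 0"
  shows "null_field r \<mu> c s \<in> tangent_space CM (r, c s)"
  unfolding null_field_def
  by (intro cone_vector_tangent r tangent_space_subspace(2)[OF velocity_tangent[OF c] velocity_tangent[OF c]])

lemma null_field_parallel:
  assumes c: "complete_geodesic M g c" and r: "r > 0" and \<mu>: "\<mu> \<noteq> 0"
    and speed: "metric_at M g (c 0) (velocity M c 0) (velocity M c 0) = - \<mu>\<^sup>2"
  shows "cov_deriv_zero CM cg (\<lambda>t. (r, c t)) (null_field r \<mu> c) s"
  unfolding cov_deriv_zero_def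
proof (intro ballI impI)
  have sm: "smooth_curve_on M UNIV c" and z: "\<And>t. cov_deriv_zero M g c (velocity M c) t"
    using c by (auto simp: complete_geodesic_def)
  have cc: "continuous_map (top_of_set UNIV) (mtop M) c" using sm by (simp add: smooth_curve_on_def)
  fix i assume "i \<in> charts CM" "(r, c s) \<in> cdom CM i"
  then have i: "i \<in> charts M" "c s \<in> cdom M i" by auto
  let ?x = "coord M i (c s)" and ?v = "velocity M c s i"
  have x: "?x \<in> cran M i" using i by (simp add: cran_def)
  have gv: "g i ?x ?v ?v = - \<mu>\<^sup>2"
    using metric_at_chart[OF velocity_tangent[OF sm] velocity_tangent[OF sm] i] geodesic_speed_constant[OF c, of s] speed by simp
  let ?k = "\<lambda>s. - (exp (\<mu> * s) / (r * \<mu>))"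
  have dv: "((\<lambda>s. velocity M c s i) has_vector_derivative - christoffel g i ?x ?v ?v) (at s)"
    using z[of s] i by (simp add: cov_deriv_zero_def)
  have dk: "(?k has_real_derivative - (exp (\<mu> * s) / r)) (at s)"
    using \<mu> r by (auto intro!: derivative_eq_intros simp: field_simps)
  have de: "((\<lambda>s. exp (\<mu> * s)) has_vector_derivative \<mu> * exp (\<mu> * s)) (at s)"
    unfolding has_real_derivative_iff_has_vector_derivative[symmetric]
    by (auto intro!: derivative_eq_intros)
  have D: "((\<lambda>s. (exp (\<mu> * s), ?k s *\<^sub>R velocity M c s i)) has_vector_derivative
      (\<mu> * exp (\<mu> * s), ?k s *\<^sub>R (- christoffel g i ?x ?v ?v) + (- (exp (\<mu> * s) / r)) *\<^sub>R ?v)) (at s)"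
    by (intro has_vector_derivative_Pair de has_vector_derivative_scaleR dk dv)
  have "((\<lambda>s. null_field r \<mu> c s i) has_vector_derivative
      (\<mu> * exp (\<mu> * s), ?k s *\<^sub>R (- christoffel g i ?x ?v ?v) + (- (exp (\<mu> * s) / r)) *\<^sub>R ?v)) (at s)"
    by (rule has_vector_derivative_transform_within_open[OF D curve_preimage_open[OF cc open_UNIV cdom_open[OF i(1)]]])
      (use i in \<open>auto simp: null_field_def cone_vector_def\<close>)
  moreover have "(\<mu> * exp (\<mu> * s), ?k s *\<^sub>R (- christoffel g i ?x ?v ?v) + (- (exp (\<mu> * s) / r)) *\<^sub>R ?v)
      = - christoffel cg i (r, ?x) (0, ?v) (exp (\<mu> * s), ?k s *\<^sub>R ?v)"
  proof -
    have c1: "g i ?x ?v (?k s *\<^sub>R ?v) = ?k s * - \<mu>\<^sup>2"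
      using linear_cmul[OF metric_linear(1)[OF i(1) x], of ?v "?k s" ?v] unfolding gv by simp
    have c2: "christoffel g i ?x ?v (?k s *\<^sub>R ?v) = ?k s *\<^sub>R christoffel g i ?x ?v ?v"
      by (rule linear_cmul[OF christoffel_linear[OF i(1) x]])
    show ?thesis
      unfolding cone_christoffel[OF i(1) r x] fst_conv snd_conv c1 c2
      using r \<mu> by (simp add: field_simps power2_eq_square)
  qed
  ultimately show "((\<lambda>s. null_field r \<mu> c s i) has_vector_derivative
      - christoffel cg i (coord CM i (r, c s))
        (velocity CM (\<lambda>t. (r, c t)) s i) (null_field r \<mu> c s i)) (at s)"
    using cone_velocity[OF sm r i] i by (simp add: null_field_def cone_vector_def)
qed

section \<open>Indecomposability of the cone\<close>

text \<open>
  The radial vector has norm \<open>1\<close> in every chart, so the local bound applies to it in each coordinate ball around a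
  point of the slice at distance \<open>r\<close>. By compactness of \<open>M\<close> finitely many of these balls cover the slice.
\<close>

lemma radial_pairing_bounded:
  assumes comp: "compact_space (mtop M)" and r: "r > 0" and c: "smooth_curve_on M UNIV c"
    and W: "linear_subspace_of W (tangent_space CM (r, c 0))"
    and neg: "cone.negative_definite_on (r, c 0) W" and inv: "cone.transport_invariant (r, c 0) W" and w: "w \<in> W"
  shows "\<exists>B. \<forall>t w'. cone.transports (reparam 0 t (\<lambda>t. (r, c t))) w w' \<longrightarrow>
    \<bar>metric_at CM cg (r, c t) w' (cone_vector (c t) 1 (\<lambda>_. 0))\<bar> \<le> B"
proof -
  let ?P = "\<lambda>t B. \<forall>w'. cone.transports (reparam 0 t (\<lambda>t. (r, c t))) w w' \<longrightarrow>
    \<bar>metric_at CM cg (r, c t) w' (cone_vector (c t) 1 (\<lambda>_. 0))\<bar> \<le> B"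
  have cc: "continuous_map (top_of_set UNIV) (mtop M) c" using c by (simp add: smooth_curve_on_def)
  have cs: "smooth_curve_on CM UNIV (\<lambda>t. (r, c t))" by (rule cone_curve_smooth[OF c open_UNIV r])
  have loc: "\<exists>N B. openin (mtop M) N \<and> q \<in> N \<and> (\<forall>t. c t \<in> N \<longrightarrow> ?P t B)" if q: "q \<in> topspace (mtop M)" for q
  proof -
    obtain i where i: "i \<in> charts M" "q \<in> cdom M i" using topspace_chart[OF q] by blast
    let ?y = "(r, coord M i q)"
    have i': "i \<in> charts CM" using i by simp
    have "?y \<in> cran CM i" using r coord_in_cran[OF i(2)] by (simp add: cone_cran)
    then obtain \<rho> where \<rho>: "\<rho> > 0" "cball ?y \<rho> \<subseteq> cran CM i"
      using cone.cran_open[OF i'] open_contains_cball by blast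
    obtain B where B: "\<And>\<alpha> w' e. cone.transportable \<alpha> \<Longrightarrow> \<alpha> 0 = (r, c 0) \<Longrightarrow> \<alpha> 1 \<in> cdom CM i \<Longrightarrow>
        coord CM i (\<alpha> 1) \<in> ball ?y \<rho> \<Longrightarrow> cone.transports \<alpha> w w' \<Longrightarrow>
        e \<in> tangent_space CM (\<alpha> 1) \<Longrightarrow> norm (e i) \<le> 1 \<Longrightarrow>
        \<bar>metric_at CM cg (\<alpha> 1) w' e\<bar> \<le> B"
      by (rule cone.bounded_pairing_in_coordinate_ball[OF W neg inv w i' \<rho>(2,1)]) blast
    let ?O = "{x. (r, x) \<in> ball ?y \<rho>}"
    let ?N = "{p \<in> cdom M i. coord M i p \<in> ?O}"
    have "open ?O" using open_vimage[OF open_ball[of ?y \<rho>], of "\<lambda>x. (r, x)"]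
      by (simp add: vimage_def continuous_intros)
    then have "openin (mtop M) ?N" by (rule coord_preimage_open[OF i(1)])
    moreover have "q \<in> ?N" using i \<rho> by simp
    moreover have "?P t B" if t: "c t \<in> ?N" for t
    proof (intro allI impI)
      fix w' assume w': "cone.transports (reparam 0 t (\<lambda>t. (r, c t))) w w'"
      let ?\<alpha> = "reparam 0 t (\<lambda>t. (r, c t))"
      have \<alpha>: "?\<alpha> 0 = (r, c 0)" "?\<alpha> 1 = (r, c t)" by (simp_all add: reparam_def)
      have e: "cone_vector (c t) 1 (\<lambda>_. 0) \<in> tangent_space CM (r, c t)"
        by (rule cone_vector_tangent[OF tangent_space_subspace(3) r]; rule velocity_tangent[OF c])
      have "\<bar>metric_at CM cg (?\<alpha> 1) w' (cone_vector (c t) 1 (\<lambda>_. 0))\<bar> \<le> B"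
      proof (rule B[OF _ \<alpha>(1) _ _ w'])
        show "cone.transportable ?\<alpha>" by (rule cone.smooth_arc_transportable[OF cone.smooth_curve_arc[OF cs]])
      qed (use t r e i \<alpha> in \<open>auto simp: cone_vector_def norm_Pair\<close>)
      then show "\<bar>metric_at CM cg (r, c t) w' (cone_vector (c t) 1 (\<lambda>_. 0))\<bar> \<le> B"
        using \<alpha> by simp
    qed
    ultimately show ?thesis by blast
  qed
  then obtain N B where NB: "\<And>q. q \<in> topspace (mtop M) \<Longrightarrow> openin (mtop M) (N q) \<and> q \<in> N q \<and> (\<forall>t. c t \<in> N q \<longrightarrow> ?P t (B q))"
    by metis
  have N: "openin (mtop M) (N q)" "q \<in> N q" if "q \<in> topspace (mtop M)" for q using NB[OF that] by simp_all
  have "\<forall>U\<in>N ` topspace (mtop M). openin (mtop M) U" using N(1) by auto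
  moreover have "topspace (mtop M) \<subseteq> \<Union> (N ` topspace (mtop M))" using N(2) by auto
  ultimately obtain F where F: "finite F" "F \<subseteq> N ` topspace (mtop M)" "topspace (mtop M) \<subseteq> \<Union> F"
    using comp[unfolded compact_space_alt, rule_format, of "N ` topspace (mtop M)"] by auto
  then obtain Q where Q: "Q \<subseteq> topspace (mtop M)" "finite Q" "F = N ` Q" using finite_subset_image[OF F(1,2)] by blast
  have "?P t (\<Sum>q\<in>Q. \<bar>B q\<bar>)" for t
  proof (intro allI impI)
    fix w' assume w': "cone.transports (reparam 0 t (\<lambda>t. (r, c t))) w w'"
    have "c t \<in> topspace (mtop M)" using curve_in_topspace[OF cc] by simp
    then obtain q where q: "q \<in> Q" "c t \<in> N q" using F(3) Q(3) by blast
    then have "\<bar>metric_at CM cg (r, c t) w' (cone_vector (c t) 1 (\<lambda>_. 0))\<bar> \<le> B q"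
      using NB Q(1) w' by blast
    also have "\<dots> \<le> \<bar>B q\<bar>" by simp
    also have "\<dots> \<le> (\<Sum>q\<in>Q. \<bar>B q\<bar>)" by (rule member_le_sum) (use q Q in auto)
    finally show "\<bar>metric_at CM cg (r, c t) w' (cone_vector (c t) 1 (\<lambda>_. 0))\<bar> \<le> (\<Sum>q\<in>Q. \<bar>B q\<bar>)" .
  qed
  then show ?thesis by blast
qed

text \<open>
  Twice the radial vector is the sum of the two null fields with the coefficients \<open>exp (- \<mu> t)\<close> and \<open>exp (\<mu> t)\<close>, and
  their products with the transported \<open>w\<close> are constant.
\<close>

lemma orthogonal_to_null_vectors:
  assumes comp: "compact_space (mtop M)" and r: "r > 0" and c: "complete_geodesic M g c"
    and \<mu>: "\<mu> > 0" and speed: "metric_at M g (c 0) (velocity M c 0) (velocity M c 0) = - \<mu>\<^sup>2"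
    and W: "linear_subspace_of W (tangent_space CM (r, c 0))"
    and neg: "cone.negative_definite_on (r, c 0) W" and inv: "cone.transport_invariant (r, c 0) W" and w: "w \<in> W"
  shows "metric_at CM cg (r, c 0) w (null_field r \<mu> c 0) = 0"
    and "metric_at CM cg (r, c 0) w (null_field r (- \<mu>) c 0) = 0"
proof -
  let ?m = "metric_at CM cg"
  have sm: "smooth_curve_on M UNIV c" using c by (simp add: complete_geodesic_def)
  have cs: "smooth_curve_on CM UNIV (\<lambda>t. (r, c t))" by (rule cone_curve_smooth[OF sm open_UNIV r])
  obtain B where B: "\<And>t w'. cone.transports (reparam 0 t (\<lambda>t. (r, c t))) w w' \<Longrightarrow>
      \<bar>?m (r, c t) w' (cone_vector (c t) 1 (\<lambda>_. 0))\<bar> \<le> B"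
    using radial_pairing_bounded[OF comp r sm W neg inv w] by blast
  have wT: "w \<in> tangent_space CM (r, c 0)" using W w by (auto simp: linear_subspace_of_def)
  let ?a = "?m (r, c 0) w (null_field r \<mu> c 0)" and ?b = "?m (r, c 0) w (null_field r (- \<mu>) c 0)"
  have bd: "\<bar>exp (- \<mu> * t) * ?a + exp (\<mu> * t) * ?b\<bar> \<le> 2 * B" for t
  proof -
    let ?c = "reparam 0 t (\<lambda>t. (r, c t))"
    have e: "?c 0 = (r, c 0)" "?c 1 = (r, c t)" by (simp_all add: reparam_def)
    have tr: "cone.transportable ?c" by (rule cone.smooth_arc_transportable[OF cone.smooth_curve_arc[OF cs]])
    then have p: "piecewise_smooth_path CM ?c" by (simp add: cone.transportable_def)
    obtain w' where w': "cone.transports ?c w w'" using tr wT e unfolding cone.transportable_def by metis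
    have w'T: "w' \<in> tangent_space CM (r, c t)" using cone.transports_tangent[OF w'] e by simp
    have N: "?m (r, c 0) w (null_field r l c 0) = ?m (r, c t) w' (null_field r l c t)" if "l\<^sup>2 = \<mu>\<^sup>2" "l \<noteq> 0" for l
    proof -
      have "cone.transports ?c (null_field r l c 0) (null_field r l c t)"
        by (rule cone.parallel_field_transports[OF cs null_field_tangent[OF sm r] null_field_parallel[OF c r that(2)]])
          (use speed that in simp)
      from cone.transports_metric[OF p w' this] show ?thesis using e by simp
    qed
    have N1: "?a = ?m (r, c t) w' (null_field r \<mu> c t)" and N2: "?b = ?m (r, c t) w' (null_field r (- \<mu>) c t)"
      using N[of \<mu>] N[of "- \<mu>"] \<mu> by auto
    have "continuous_map (top_of_set UNIV) (mtop M) c" using sm by (simp add: smooth_curve_on_def)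
    then obtain i where i: "i \<in> charts M" "c t \<in> cdom M i" using topspace_chart curve_in_topspace by blast
    have i': "i \<in> charts CM" "(r, c t) \<in> cdom CM i" using i r by auto
    have x: "coord M i (c t) \<in> cran M i" using i by (simp add: cran_def)
    have rad: "cone_vector (c t) 1 (\<lambda>_. 0) \<in> tangent_space CM (r, c t)"
      by (rule cone_vector_tangent[OF tangent_space_subspace(3) r]; rule velocity_tangent[OF sm])
    note mc = cone.metric_at_chart[OF w'T _ i']
    note l1 = linear_cmul[OF metric_linear(1)[OF i(1) x]] linear_0[OF metric_linear(1)[OF i(1) x]]
    let ?h = "g i (coord M i (c t)) (snd (w' i)) (velocity M c t i)"
    have nf: "?m (r, c t) w' (null_field r l c t) = exp (l * t) * (fst (w' i) - r / l * ?h)" if "l \<noteq> 0" for l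
      unfolding mc[OF null_field_tangent[OF sm r]] cone_simps fst_conv snd_conv cone_metric_apply
      using i r that by (simp add: null_field_def cone_vector_def linear_neg[OF metric_linear(1)[OF i(1) x]]
          l1(1) power2_eq_square field_simps)
    have ra: "?m (r, c t) w' (cone_vector (c t) 1 (\<lambda>_. 0)) = fst (w' i)"
      unfolding mc[OF rad] cone_simps fst_conv snd_conv cone_metric_apply
      using i by (simp add: cone_vector_def l1(2))
    have e1: "exp (- \<mu> * t) * exp (\<mu> * t) = 1" by (simp add: exp_add[symmetric])
    have "exp (- \<mu> * t) * ?a + exp (\<mu> * t) * ?b
        = (exp (- \<mu> * t) * exp (\<mu> * t)) * (fst (w' i) - r / \<mu> * ?h)
          + (exp (- \<mu> * t) * exp (\<mu> * t)) * (fst (w' i) - r / (- \<mu>) * ?h)"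
      unfolding N1 N2 using nf[of \<mu>] nf[of "- \<mu>"] \<mu> by simp
    also have "\<dots> = 2 * ?m (r, c t) w' (cone_vector (c t) 1 (\<lambda>_. 0))"
      unfolding e1 ra by simp
    finally have "exp (- \<mu> * t) * ?a + exp (\<mu> * t) * ?b = 2 * ?m (r, c t) w' (cone_vector (c t) 1 (\<lambda>_. 0))" .
    then show ?thesis using B[OF w'] by simp
  qed
  show "?b = 0" by (rule bounded_exponential_combination[OF \<mu> bd])
  show "?a = 0"
  proof (rule bounded_exponential_combination[OF \<mu>])
    show "\<bar>exp (- \<mu> * t) * ?b + exp (\<mu> * t) * ?a\<bar> \<le> 2 * B" for t using bd[of "- t"] by (simp add: add.commute)
  qed
qed

text \<open>
  Sum and difference of the two null vectors give the radial direction and the direction of the geodesic, which is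
  arbitrary by completeness.
\<close>

lemma negative_definite_invariant_subspace_trivial:
  assumes comp: "compact_space (mtop M)" and complete: "complete_metric M g"
    and g: "\<And>i x u. i \<in> charts M \<Longrightarrow> x \<in> cran M i \<Longrightarrow> u \<noteq> 0 \<Longrightarrow> g i x u u < 0"
    and q: "q \<in> topspace (mtop M)" and r: "r > 0"
    and W: "linear_subspace_of W (tangent_space CM (r, q))"
    and neg: "cone.negative_definite_on (r, q) W" and inv: "cone.transport_invariant (r, q) W" and w: "w \<in> W"
  shows "w = (\<lambda>_. 0)"
proof -
  let ?m = "metric_at CM cg"
  obtain j where j: "j \<in> charts M" "q \<in> cdom M j" using topspace_chart[OF q] by blast
  have j': "j \<in> charts CM" "(r, q) \<in> cdom CM j" using j r by auto
  let ?x = "coord M j q"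
  have x: "?x \<in> cran M j" using j by (simp add: cran_def)
  have wT: "w \<in> tangent_space CM (r, q)" using W w by (auto simp: linear_subspace_of_def)
  have key: "fst (w j) = 0 \<and> g j ?x (snd (w j)) y = 0" if y: "y \<noteq> 0" for y
  proof -
    let ?v = "lift_vector j q y"
    have vT: "?v \<in> tangent_space M q" and vj: "?v j = y" using lift_vector_tangent[OF j] lift_vector_self[OF j] by auto
    obtain c where c: "complete_geodesic M g c" "c 0 = q" "velocity M c 0 = ?v"
      using complete q vT unfolding complete_metric_def by blast
    have sm: "smooth_curve_on M UNIV c" using c by (simp add: complete_geodesic_def)
    define k where "k = sqrt (- g j ?x y y)"
    have k: "k > 0" "k\<^sup>2 = - g j ?x y y" using g[OF j(1) x y] by (auto simp: k_def)
    have speed: "metric_at M g (c 0) (velocity M c 0) (velocity M c 0) = - k\<^sup>2"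
      using metric_at_chart[OF vT vT j] c vj k by simp
    note o = orthogonal_to_null_vectors[OF comp r c(1) k(1) speed, unfolded c(2), OF W neg inv w]
    have nT: "null_field r l c 0 \<in> tangent_space CM (r, q)" for l
      using null_field_tangent[OF sm r, of l 0] c by simp
    have nf: "null_field r l c 0 j = (1, (- (1 / (r * l))) *\<^sub>R y)" for l
      using j c vj by (simp add: null_field_def cone_vector_def)
    have m: "?m (r, q) w (null_field r l c 0) = fst (w j) - r / l * g j ?x (snd (w j)) y" if "l \<noteq> 0" for l
      using cone.metric_at_chart[OF wT nT j', of l] r that linear_cmul[OF metric_linear(1)[OF j(1) x]]
        linear_neg[OF metric_linear(1)[OF j(1) x]]
      by (simp add: cone_metric_apply nf power2_eq_square)
    have "fst (w j) - r / k * g j ?x (snd (w j)) y = 0" "fst (w j) + r / k * g j ?x (snd (w j)) y = 0"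
      using o m[of k] m[of "- k"] k by auto
    then have "fst (w j) = 0" "r / k * g j ?x (snd (w j)) y = 0" by linarith+
    then show ?thesis using r k by simp
  qed
  obtain b :: 'e where "b \<in> Basis" by (meson SOME_Basis)
  then have "fst (w j) = 0" using key[of b] by (auto simp: nonzero_Basis)
  moreover have "g j ?x (snd (w j)) y = 0" for y
    using key[of y] linear_0[OF metric_linear(1)[OF j(1) x]] by (cases "y = 0") auto
  then have "snd (w j) = 0" using metric_nondegenerate[OF j(1) x] by blast
  ultimately have "w j = 0" by (simp add: prod_eq_iff)
  then show ?thesis
    using cone.tangent_eqI[OF wT cone.tangent_space_subspace(3)[OF wT wT] j'] by simp
qed

text \<open>
  The reverse Cauchy--Schwarz inequality: for \<open>u = (a, X)\<close> and \<open>v = (b, Y)\<close> the vector \<open>a Y - b X\<close> is tangent to the base, so its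
  square is not positive; expanding it with \<open>r\<^sup>2 g Y X = - a b\<close> bounds the square of \<open>v\<close>.
\<close>

lemma orthogonal_to_positive_vector_negative:
  assumes i: "i \<in> charts M" and x: "x \<in> cran M i" and r: "r > 0"
    and g: "\<And>u. u \<noteq> 0 \<Longrightarrow> g i x u u < 0"
    and u: "cg i (r, x) u u > 0" and uv: "cg i (r, x) v u = 0" and v: "v \<noteq> 0"
  shows "cg i (r, x) v v < 0"
proof (cases "fst v = 0")
  case True
  then have "snd v \<noteq> 0" using v by (simp add: prod_eq_iff)
  from g[OF this] r True show ?thesis by (simp add: cone_metric_apply mult_pos_neg)
next
  case False
  let ?a = "fst u" and ?b = "fst v" and ?X = "snd u" and ?Y = "snd v"
  note l1 = linear_diff[OF metric_linear(1)[OF i x]] linear_cmul[OF metric_linear(1)[OF i x]]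
  note l2 = linear_diff[OF metric_linear(2)[OF i x]] linear_cmul[OF metric_linear(2)[OF i x]]
  let ?z = "?a *\<^sub>R ?Y - ?b *\<^sub>R ?X"
  have gz: "g i x ?z ?z \<le> 0" using g[of ?z] linear_0[OF metric_linear(1)[OF i x]] by (cases "?z = 0") auto
  have e: "g i x ?z ?z = ?a\<^sup>2 * g i x ?Y ?Y - 2 * ?a * ?b * g i x ?Y ?X + ?b\<^sup>2 * g i x ?X ?X"
    using metric_sym[OF i x, of ?X ?Y] by (simp add: l1 l2 power2_eq_square algebra_simps)
  define P where "P = r\<^sup>2 * g i x ?Y ?Y"
  define Q where "Q = r\<^sup>2 * g i x ?X ?X"
  have R: "r\<^sup>2 * g i x ?Y ?X = - (?a * ?b)" using uv by (simp add: cone_metric_apply mult.commute)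
  have "r\<^sup>2 * g i x ?z ?z = ?a\<^sup>2 * P - 2 * ?a * ?b * (r\<^sup>2 * g i x ?Y ?X) + ?b\<^sup>2 * Q"
    unfolding e P_def Q_def by (simp add: algebra_simps)
  also have "\<dots> = ?a\<^sup>2 * P + 2 * ?a\<^sup>2 * ?b\<^sup>2 + ?b\<^sup>2 * Q"
    unfolding R by (simp add: power2_eq_square algebra_simps)
  finally have "r\<^sup>2 * g i x ?z ?z = ?a\<^sup>2 * P + 2 * ?a\<^sup>2 * ?b\<^sup>2 + ?b\<^sup>2 * Q" .
  moreover have "r\<^sup>2 * g i x ?z ?z \<le> 0" by (rule mult_nonneg_nonpos[OF _ gz]) simp
  ultimately have le: "?a\<^sup>2 * P + 2 * ?a\<^sup>2 * ?b\<^sup>2 + ?b\<^sup>2 * Q \<le> 0" by linarith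
  have Q: "?a\<^sup>2 + Q > 0" using u by (simp add: cone_metric_apply Q_def power2_eq_square)
  show ?thesis
  proof (rule ccontr)
    assume "\<not> ?thesis"
    then have P: "?b\<^sup>2 + P \<ge> 0" by (simp add: cone_metric_apply P_def power2_eq_square)
    have "?b\<^sup>2 * (?a\<^sup>2 + Q) > 0" using Q False by simp
    moreover have "?a\<^sup>2 * (?b\<^sup>2 + P) \<ge> 0" using P by simp
    ultimately show False using le by (simp add: algebra_simps)
  qed
qed

theorem cone_not_decomposable:
  assumes comp: "compact_space (mtop M)" and complete: "complete_metric M g"
    and g: "\<And>i x u. i \<in> charts M \<Longrightarrow> x \<in> cran M i \<Longrightarrow> u \<noteq> 0 \<Longrightarrow> g i x u u < 0"
  shows "\<not> decomposable CM cg"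
proof
  let ?m = "metric_at CM cg" and ?T = "tangent_space CM"
  assume "decomposable CM cg"
  then obtain p U where p: "p \<in> topspace (mtop CM)"
    and U: "linear_subspace_of U (?T p)" "U \<noteq> {\<lambda>_. 0}" "U \<noteq> ?T p"
    and nd: "nondegenerate_on CM cg p U"
    and hol: "\<forall>\<tau>\<in>holonomy_group CM cg p. \<tau> ` U \<subseteq> U"
    unfolding decomposable_def by blast
  obtain r q where rq: "p = (r, q)" by fastforce
  have r: "r > 0" and q: "q \<in> topspace (mtop M)" using p rq by auto
  note trivial = negative_definite_invariant_subspace_trivial[OF comp complete g q r]
  have inv: "cone.transport_invariant p U" by (rule cone.holonomy_invariant_imp_transport_invariant[OF hol])
  have UT: "U \<subseteq> ?T p" using U(1) by (simp add: linear_subspace_of_def)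
  obtain j where j: "j \<in> charts M" "q \<in> cdom M j" using topspace_chart[OF q] by blast
  have j': "j \<in> charts CM" "p \<in> cdom CM j" using j r rq by auto
  let ?x = "coord M j q"
  have x: "?x \<in> cran M j" using j by (simp add: cran_def)
  have x': "(r, ?x) \<in> cran CM j" using x r by (simp add: cone_cran)
  have m: "?m p u v = cg j (r, ?x) (u j) (v j)" if "u \<in> ?T p" "v \<in> ?T p" for u v
    using cone.metric_at_chart[OF that j'] rq by simp
  have "\<not> cone.negative_definite_on p U"
  proof
    assume "cone.negative_definite_on p U"
    then have "u = (\<lambda>_. 0)" if "u \<in> U" for u using trivial[of U u] U inv that rq by blast
    moreover have "(\<lambda>_. 0) \<in> U" using U(1) by (simp add: linear_subspace_of_def)
    ultimately show False using U(2) by blast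
  qed
  then obtain u where u: "u \<in> U" "u \<noteq> (\<lambda>_. 0)" "?m p u u \<ge> 0"
    unfolding cone.negative_definite_on_def by (metis not_le)
  have "\<exists>u\<in>U. ?m p u u > 0"
  proof (cases "?m p u u = 0")
    case False
    then show ?thesis using u by force
  next
    case True
    obtain v where v: "v \<in> U" "?m p u v \<noteq> 0" using nd u unfolding nondegenerate_on_def by blast
    \<comment> \<open>as \<open>u\<close> is null, the square of \<open>v + s u\<close> is affine in \<open>s\<close>; this \<open>s\<close> makes it \<open>1\<close>\<close>
    define s where "s = (1 - ?m p v v) / (2 * ?m p u v)"
    let ?w = "\<lambda>i. v i + s *\<^sub>R u i"
    have sum: "\<forall>u\<in>U. \<forall>v\<in>U. (\<lambda>i. u i + v i) \<in> U" and scale: "\<forall>a. \<forall>u\<in>U. (\<lambda>i. a *\<^sub>R u i) \<in> U"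
      using U(1) unfolding linear_subspace_of_def by blast+
    have w: "?w \<in> U" by (rule sum[rule_format, OF v(1) scale[rule_format, OF u(1)]])
    have T: "u \<in> ?T p" "v \<in> ?T p" "?w \<in> ?T p" using u v w UT by auto
    note l1 = linear_add[OF cone.metric_linear(1)[OF j'(1) x']] linear_cmul[OF cone.metric_linear(1)[OF j'(1) x']]
    note l2 = linear_add[OF cone.metric_linear(2)[OF j'(1) x']] linear_cmul[OF cone.metric_linear(2)[OF j'(1) x']]
    have "?m p ?w ?w = ?m p v v + 2 * s * ?m p u v + s\<^sup>2 * ?m p u u"
      unfolding m[OF T(3) T(3)] m[OF T(2) T(2)] m[OF T(1) T(2)] m[OF T(1) T(1)]
      using cone.metric_sym[OF j'(1) x', of "v j" "u j"] by (simp add: l1 l2 power2_eq_square algebra_simps)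
    also have "\<dots> = 1" using True v by (simp add: s_def field_simps)
    finally show ?thesis using w by (intro bexI[of _ ?w]) auto
  qed
  then obtain u0 where u0: "u0 \<in> U" "?m p u0 u0 > 0" by blast
  let ?W = "cone.orthogonal_complement p U"
  have "cone.negative_definite_on p ?W"
    unfolding cone.negative_definite_on_def
  proof (intro ballI impI)
    fix v assume v: "v \<in> ?W" "v \<noteq> (\<lambda>_. 0)"
    have vT: "v \<in> ?T p" "?m p v u0 = 0" using v u0 by (auto simp: cone.orthogonal_complement_def)
    have u0T: "u0 \<in> ?T p" using u0 UT by blast
    have "v j \<noteq> 0"
      using cone.tangent_eqI[OF vT(1) cone.tangent_space_subspace(3)[OF vT(1) vT(1)] j'] v(2) by auto
    then show "?m p v v < 0"
      using orthogonal_to_positive_vector_negative[OF j(1) x r g[OF j(1) x], of "u0 j" "v j"] vT(2) u0(2)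
      by (simp add: m vT(1) u0T)
  qed
  moreover obtain v where "v \<in> ?W" "v \<noteq> (\<lambda>_. 0)"
    using cone.orthogonal_complement_nontrivial[OF p U(1,3)] by blast
  ultimately show False
    using trivial[of ?W v] cone.orthogonal_complement_subspace[OF p UT] cone.orthogonal_complement_invariant[OF UT inv] rq
    by blast
qed

end

theorem corollary2:
  fixes M :: "('a, 'i, 'e::euclidean_space) manifold"
    and g :: "('i, 'e) metric"
    and n :: nat
  assumes "DIM('e) = n"
    and "closed_manifold M"
    and "connected_space (mtop M)"
    and "pseudo_riemannian_metric M g"
    and "complete_metric M g"
    and "negative_definite_metric M g"
  shows "\<not> decomposable (cone_manifold M) (cone_metric g)"
proof -
  interpret metric_cone M g
    by unfold_locales (use assms in \<open>auto simp: closed_manifold_def\<close>)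
  show ?thesis
  proof (rule cone_not_decomposable)
    show "compact_space (mtop M)" using assms(2) by (simp add: closed_manifold_def)
    show "g i x u u < 0" if "i \<in> charts M" "x \<in> cran M i" "u \<noteq> 0" for i x u
      using assms(6) that by (force simp: negative_definite_metric_def riemannian_metric_def)
  qed (rule assms)
qed

end
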